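(* For any two initial extended simple processes $A$ and $B$: $A \approx B$ (trace equivalence for the concrete semantics) if and only if $A \approx_d^1 B$ (trace equivalence for the reduced symbolic semantics with first-order satisfaction of dependency constraints).
   Context: **Terms and processes.** Fix pairwise disjoint infinite sets $\mathcal X$ (first-order variables), $\mathcal W$ (handles), a set $\mathcal N$ of names, a finite signature $\Sigma$ (constants allowed) and an equational theory $\mathsf E$ with induced congruence $=_{\mathsf E}$ on terms. $\mathcal T(S)$ is the set of terms built from $S$ using $\Sigma$; messages are in $\mathcal T(\mathcal N\cup\mathcal X)$, recipes in $\mathcal T(\mathcal W)$; ground means in $\mathcal T(\mathcal N)$. Fix a set $\mathcal C$ of channels. Basic processes on $c\in\mathcal C$: $P,Q::=0\mid \mathtt{if}\ u=v\ \mathtt{then}\ P\ \mathtt{else}\ Q\mid \mathtt{in}(c,x).P\mid \mathtt{out}(c,u).P$ with $u,v$ messages and $x\in\mathcal X$ (bound by the input); all actions are on the same channel $c$. A simple process $\mathcal P$ is a multiset of basic processes on pairwise distinct channels, null processes being removed. A frame $\Phi$ is a substitution with $\mathrm{dom}(\Phi)\subseteq\mathcal W$ and image in $\mathcal T(\mathcal N\cup\mathcal X)$, written $\{w\triangleright u,\dots\}$. An extended simple (resp. basic) process is a pair $(\mathcal P;\Phi)$ of a simple (resp. basic) process and a frame. All extended processes are closed: no free variables in $\mathcal P$, ground image of $\Phi$. $(\mathcal P;\Phi)$ is *initial* if every $P\in\mathcal P$ is of the form $\mathtt{in}(c,x).P'$. **Concrete semantics.** $(\{\mathtt{if}\ u=v\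 \mathtt{then}\ Q_1\ \mathtt{else}\ Q_2\}\uplus\mathcal P;\Phi)\xrightarrow{\tau}(\{Q_i\}\uplus\mathcal P;\Phi)$ with $i=1$ if $u=_{\mathsf E}v$, $i=2$ if $u\neq_{\mathsf E}v$; $(\{\mathtt{in}(c,x).Q\}\uplus\mathcal P;\Phi)\xrightarrow{\mathtt{in}(c,M)}(\{Q\{x\mapsto M\Phi\}\}\uplus\mathcal P;\Phi)$ for $M\in\mathcal T(\mathrm{dom}(\Phi))$; $(\{\mathtt{out}(c,u).Q\}\uplus\mathcal P;\Phi)\xrightarrow{\mathtt{out}(c,w)}(\{Q\}\uplus\mathcal P;\Phi\cup\{w\triangleright u\})$ for $w\in\mathcal W$ fresh. $A\stackrel{\mathrm{tr}}{\Rightarrow}B$ means $A\xrightarrow{a_1\cdots a_k}B$ for some $a_1\cdots a_k$ ($k\ge0$) that yields $\mathrm{tr}$ after erasing all $\tau$. **Trace equivalence.** $\Phi\sim\Phi'$ (static equivalence) iff $\mathrm{dom}(\Phi)=\mathrm{dom}(\Phi')$ and for all $M,N\in\mathcal T(\mathrm{dom}(\Phi))$: $M\Phi=_{\mathsf E}N\Phi\Leftrightarrow M\Phi'=_{\mathsf E}N\Phi'$. $A\sqsubseteq B$ iff whenever $A\stackrel{\mathrm{tr}}{\Rightarrow}(\mathcal P;\Phi)$ there is $(\mathcal P';\Phi')$ with $B\stackrel{\mathrm{tr}}{\Rightarrow}(\mathcal P';\Phi')$ and $\Phi\sim\Phi'$. $A\approx B$ iff $A\sqsubseteq B$ and $B\sqsubseteq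 A$. **Constraint systems.** Fix a set $\mathcal X^2$ of second-order variables (standing for recipes); $\mathrm{fv}^1,\mathrm{fv}^2$ denote free first-order (in $\mathcal X\cup\mathcal W$) and second-order variables. A constraint system $(\Phi;\mathcal S)$ is a frame with a set $\mathcal S$ of constraints of the forms $D\vdash^?_X x$, $u=^?v$, $u\neq^?v$ ($D\subseteq\mathcal W$, $X\in\mathcal X^2$, $x\in\mathcal X$, $u,v$ messages). All constraint systems $\mathcal K=(\Phi;\mathcal S)$ are well-formed: each $x\in\mathrm{fv}^1(\mathcal K)\cap\mathcal X$ and each $X\in\mathrm{fv}^2(\mathcal K)$ occurs in a unique constraint $D\vdash^?_Xx$ of $\mathcal S$ (write $D_{\mathcal K}(X)=D$), and the relation "$x$ depends on $y$ iff $\mathcal S$ contains $D\vdash^?_Xx$ with $y\in\mathrm{fv}^1(\Phi(D))$" is acyclic. A solution is a substitution $\theta$ with $\mathrm{dom}(\theta)=\mathrm{fv}^2(\mathcal K)$ and $X\theta\in\mathcal T(D_{\mathcal K}(X))$ for all $X$, such that there is a ground substitution $\lambda$ with domain $\mathrm{fv}^1(\mathcal K)\cap\mathcal X$ satisfying $(X\theta)(\Phi\lambda)=_{\mathsf E}x\lambda$ for each $D\vdash^?_Xx$, $u\lambda=_{\mathsf E}v\lambda$ for each $u=^?v$, and $u\lambda\neq_{\mathsf E}v\lambda$ for each $u\neq^?v$. $\mathrm{Sol}(\mathcal K)$ is the set of solutions; $\lambda$ is unique modulo $\mathsf E$ and denoted $\lambda_\theta$. **Compressed symbolic semantics.** A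 symbolic process is $(\mathcal P;\Phi;\mathcal S)$ with $(\Phi;\mathcal S)$ a constraint system and $\mathrm{fv}^1(\mathcal P)\subseteq\mathrm{fv}^1(\mathcal S)\cap\mathcal X$. For basic $P$: $(\mathtt{in}(c,y).P;\Phi;\mathcal S)\overset{\mathtt{in}(c,X)}{\longmapsto}(P\{y\mapsto x\};\Phi;\mathcal S\cup\{\mathrm{dom}(\Phi)\vdash^?_Xx\})$, $X,x$ fresh; $(\mathtt{out}(c,u).P;\Phi;\mathcal S)\overset{\mathtt{out}(c,w)}{\longmapsto}(P;\Phi\cup\{w\triangleright u\};\mathcal S)$, $w$ fresh; $(\mathtt{if}\ u=v\ \mathtt{then}\ P\ \mathtt{else}\ Q;\Phi;\mathcal S)\overset{\tau}{\longmapsto}(P;\Phi;\mathcal S\cup\{u=^?v\})$ and $\overset{\tau}{\longmapsto}(Q;\Phi;\mathcal S\cup\{u\neq^?v\})$. Focused relations $\longmapsto_\ell$, $\ell\in\{i^+,i^*,o^*\}$, are the least with ($K,K',K''$ symbolic basic processes): (In) $K\overset{\mathtt{in}(c,X)}{\longmapsto}K'$ and $K'\overset{\mathrm{tr}}{\longmapsto}_{i^*}K''$ give $K\overset{\mathtt{in}(c,X)\cdot\mathrm{tr}}{\longmapsto}_\ell K''$ for $\ell\in\{i^*,i^+\}$; (Out) $K\overset{\mathtt{out}(c,w)}{\longmapsto}K'$ and $K'\overset{\mathrm{tr}}{\longmapsto}_{o^*}K''$ give $K\overset{\mathtt{out}(c,w)\cdot\mathrm{tr}}{\longmapsto}_\ell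 K''$ for $\ell\in\{i^*,o^*\}$; (Tau) $K\overset{\tau}{\longmapsto}K'$ and $K'\overset{\mathrm{tr}}{\longmapsto}_\ell K''$ give $K\overset{\mathrm{tr}}{\longmapsto}_\ell K''$ for any $\ell$; (Proper) $(P;\Phi;\mathcal S)\overset{\epsilon}{\longmapsto}_{o^*}(P;\Phi;\mathcal S)$ if $P=0$ or $P=\mathtt{in}(c,x).P'$; (Improper) $(0;\Phi;\mathcal S)\overset{\epsilon}{\longmapsto}_{i^*}(\bot;\Phi;\mathcal S)$, $\bot$ a special symbol. $\longmapsto_{\mathrm c}$ is the least reflexive (label $\epsilon$) transitive (labels concatenate) relation such that if $(Q;\Phi;\mathcal S)\overset{\mathrm{tr}}{\longmapsto}_{i^+}(Q';\Phi';\mathcal S')$ then $(\{Q\}\uplus\mathcal P;\Phi;\mathcal S)\overset{\mathrm{tr}}{\longmapsto}_{\mathrm c}(\{Q'\}\uplus\mathcal P;\Phi';\mathcal S')$ when $Q'\neq\bot$, and $\overset{\mathrm{tr}}{\longmapsto}_{\mathrm c}(\varnothing;\Phi';\mathcal S')$ when $Q'=\bot$. **Dependency constraints and reduced semantics.** A dependency constraint is $\vec X\ltimes\vec w$ with $\vec X$ a vector over $\mathcal X^2$, $\vec w$ a vector over $\mathcal W$. A dependency constraint system $\mathcal K$ is a constraint system possibly also containing dependency constraints; $\mathcal K^\circ$ is $\mathcal K$ without them (required well-formed), and $\lambda_\theta$, $D_{\mathcal K}$ refer to $\mathcal K^\circ$. Write $\mathtt{io}_c(\vec X,\vec w)$ for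 the block $\mathtt{in}(c,X_1)\cdots\mathtt{in}(c,X_\ell)\cdot\mathtt{out}(c,w_1)\cdots\mathtt{out}(c,w_k)$. Fix a (strict) total order $\prec$ on $\mathcal C$. For $\mathrm{tr}=\mathtt{io}_{c_1}(\vec X_1,\vec w_1)\cdots\mathtt{io}_{c_n}(\vec X_n,\vec w_n)$ and a channel $c$: if there is $k\le n$ with $c\prec c_k$ and $c_i\prec c$ for all $k<i\le n$, then $\mathrm{dep}(\mathrm{tr},c)$ is the set of handles occurring in $\vec w_k,\dots,\vec w_n$; otherwise $\mathrm{dep}(\mathrm{tr},c)=\varnothing$. $\longmapsto_d$ is the least reflexive relation such that if $(\mathcal P;\Phi;\varnothing)\overset{\mathrm{tr}}{\longmapsto}_d(\mathcal P';\Phi';\mathcal S')$ and $(\mathcal P';\Phi';\mathcal S')\overset{\mathtt{io}_c(\vec X,\vec w)}{\longmapsto}_{\mathrm c}(\mathcal P'';\Phi'';\mathcal S'')$ (one block, with at least one input) then $(\mathcal P;\Phi;\varnothing)\overset{\mathrm{tr}\cdot\mathtt{io}_c(\vec X,\vec w)}{\longmapsto}_d(\mathcal P'';\Phi'';\mathcal S''\cup\{\vec X\ltimes\mathrm{dep}(\mathrm{tr},c)\})$. **First-order reduced equivalence.** For $\mathcal K=(\Phi;\mathcal S)$, $\mathrm{Sol}^1(\mathcal K)$ is the set of $\theta\in\mathrm{Sol}(\mathcal K^\circ)$ such that for each $\vec X\ltimes\vec w$ in $\mathcal K$ with $\vec w$ non-empty there is $X_i\in\vec X$ such that every $M\in\mathcal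 T(D_{\mathcal K}(X_i))$ with $M(\Phi\lambda_\theta)=_{\mathsf E}(X_i\theta)(\Phi\lambda_\theta)$ satisfies $\mathrm{fv}^1(M)\cap\vec w\neq\varnothing$. For $A=(\mathcal P;\Phi)$, $B=(\mathcal Q;\Psi)$: $A\sqsubseteq_d^1B$ iff whenever $(\mathcal P;\Phi;\varnothing)\overset{\mathrm{tr}}{\longmapsto}_d(\mathcal P';\Phi';\mathcal S_A)$ and $\theta\in\mathrm{Sol}^1(\Phi';\mathcal S_A)$, there is $(\mathcal Q;\Psi;\varnothing)\overset{\mathrm{tr}}{\longmapsto}_d(\mathcal Q';\Psi';\mathcal S_B)$ with $\theta\in\mathrm{Sol}^1(\Psi';\mathcal S_B)$ and $\Phi'\lambda^A_\theta\sim\Psi'\lambda^B_\theta$, where $\lambda^A_\theta,\lambda^B_\theta$ are the substitutions associated to $\theta$ in the respective systems. $A\approx_d^1B$ iff $A\sqsubseteq_d^1B$ and $B\sqsubseteq_d^1A$. *)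

theory Defs
  imports "HOL-Library.Multiset" "HOL-Library.Infinite_Typeclass"
begin

datatype ('f, atoms: 'a) trm = Atom 'a | App 'f "('f, 'a) trm list"

primrec subst :: "('a \<Rightarrow> ('f, 'b) trm) \<Rightarrow> ('f, 'a) trm \<Rightarrow> ('f, 'b) trm" where
  "subst \<sigma> (Atom a) = \<sigma> a"
| "subst \<sigma> (App f ts) = App f (map (subst \<sigma>) ts)"

text \<open>A signature is a set of pairs of a function symbol and its arity.\<close>

inductive_set terms :: "('f \<times> nat) set \<Rightarrow> 'a set \<Rightarrow> ('f, 'a) trm set"
  for Sig :: "('f \<times> nat) set" and S :: "'a set" where
  Atom: "a \<in> S \<Longrightarrow> Atom a \<in> terms Sig S"
| App: "(f, length ts) \<in> Sig \<Longrightarrow> \<forall>t \<in> set ts. t \<in> terms Sig S \<Longrightarrow> App f ts \<in> terms Sig S"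

text \<open>Names, first-order variables, handles, second-order variables and channels are the
  elements of types \<open>'n\<close>, \<open>'x\<close>, \<open>'w\<close>, \<open>'s\<close> and \<open>'c\<close>. Messages have leaves in
  \<open>('n, 'x) leaf\<close>, recipes have leaves in \<open>'w\<close>.\<close>

datatype ('n, 'x) leaf = Name 'n | Var 'x

type_synonym ('f, 'n, 'x) msg = "('f, ('n, 'x) leaf) trm"
type_synonym ('f, 'w) recipe = "('f, 'w) trm"
type_synonym ('f, 'n, 'x, 'w) frame = "'w \<rightharpoonup> ('f, 'n, 'x) msg"
type_synonym ('f, 'n, 'x) fo_subst = "'x \<rightharpoonup> ('f, 'n, 'x) msg"
type_synonym ('f, 'w, 's) so_subst = "'s \<rightharpoonup> ('f, 'w) recipe"

definition fv :: "('f, 'n, 'x) msg \<Rightarrow> 'x set" where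
  "fv u = {x. Var x \<in> atoms u}"

definition msubst :: "('f, 'n, 'x) fo_subst \<Rightarrow> ('f, 'n, 'x) msg \<Rightarrow> ('f, 'n, 'x) msg" where
  "msubst \<mu> = subst (\<lambda>a. case a of
      Name n \<Rightarrow> Atom (Name n)
    | Var x \<Rightarrow> (case \<mu> x of None \<Rightarrow> Atom (Var x) | Some t \<Rightarrow> t))"

definition fsubst ::
    "('f, 'n, 'x) fo_subst \<Rightarrow> ('f, 'n, 'x, 'w) frame \<Rightarrow> ('f, 'n, 'x, 'w) frame" where
  "fsubst \<mu> \<Phi> = (\<lambda>w. map_option (msubst \<mu>) (\<Phi> w))"

text \<open>Only meaningful for recipes whose handles belong to the domain of the frame.\<close>

definition recipe_msg ::
    "('f, 'n, 'x, 'w) frame \<Rightarrow> ('f, 'w) recipe \<Rightarrow> ('f, 'n, 'x) msg" where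
  "recipe_msg \<Phi> M = subst (\<lambda>w. the (\<Phi> w)) M"

datatype ('c, 'f, 'n, 'x) proc =
    PNull
  | PIf "('f, 'n, 'x) msg" "('f, 'n, 'x) msg" "('c, 'f, 'n, 'x) proc" "('c, 'f, 'n, 'x) proc"
  | PIn 'c 'x "('c, 'f, 'n, 'x) proc"
  | POut 'c "('f, 'n, 'x) msg" "('c, 'f, 'n, 'x) proc"

primrec fv_proc :: "('c, 'f, 'n, 'x) proc \<Rightarrow> 'x set" where
  "fv_proc PNull = {}"
| "fv_proc (PIf u v P Q) = fv u \<union> fv v \<union> fv_proc P \<union> fv_proc Q"
| "fv_proc (PIn c x P) = fv_proc P - {x}"
| "fv_proc (POut c u P) = fv u \<union> fv_proc P"

text \<open>Includes the bound variables, even those that do not occur.\<close>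

primrec vars_proc :: "('c, 'f, 'n, 'x) proc \<Rightarrow> 'x set" where
  "vars_proc PNull = {}"
| "vars_proc (PIf u v P Q) = fv u \<union> fv v \<union> vars_proc P \<union> vars_proc Q"
| "vars_proc (PIn c x P) = insert x (vars_proc P)"
| "vars_proc (POut c u P) = fv u \<union> vars_proc P"

text \<open>Replacement of the free occurrences of \<open>y\<close> by \<open>m\<close>. It does not rename bound variables;
  below, \<open>m\<close> is either ground or a variable that does not occur in the process at all, so that
  nothing is captured.\<close>

primrec psubst ::
    "'x \<Rightarrow> ('f, 'n, 'x) msg \<Rightarrow> ('c, 'f, 'n, 'x) proc \<Rightarrow> ('c, 'f, 'n, 'x) proc" where
  "psubst y m PNull = PNull"
| "psubst y m (PIf u v P Q) =
     PIf (msubst [y \<mapsto> m] u) (msubst [y \<mapsto> m] v) (psubst y m P) (psubst y m Q)"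
| "psubst y m (PIn c x P) = PIn c x (if x = y then P else psubst y m P)"
| "psubst y m (POut c u P) = POut c (msubst [y \<mapsto> m] u) (psubst y m P)"

text \<open>Null processes are never kept in a multiset of processes.\<close>

definition single :: "('c, 'f, 'n, 'x) proc \<Rightarrow> ('c, 'f, 'n, 'x) proc multiset" where
  "single P = (if P = PNull then {#} else {#P#})"

type_synonym ('c, 'f, 'n, 'x, 'w) eproc =
  "('c, 'f, 'n, 'x) proc multiset \<times> ('f, 'n, 'x, 'w) frame"

definition initial :: "('c, 'f, 'n, 'x, 'w) eproc \<Rightarrow> bool" where
  "initial A \<longleftrightarrow> (\<forall>P \<in># fst A. \<exists>c x P'. P = PIn c x P')"

text \<open>Concrete and symbolic actions: \<open>'i\<close> is the type of recipes, respectively of second-order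
  variables.\<close>

datatype ('c, 'i, 'w) act = Inp 'c 'i | Outp 'c 'w | Tau

text \<open>\<open>Ded D X x\<close> is the deduction constraint with handles \<open>D\<close>, second-order variable \<open>X\<close> and
  first-order variable \<open>x\<close>; \<open>Dep Xs ws\<close> is a dependency constraint. Only the set of handles of
  a dependency constraint matters.\<close>

datatype ('f, 'n, 'x, 'w, 's) constr =
    Ded "'w set" 's 'x
  | Eq "('f, 'n, 'x) msg" "('f, 'n, 'x) msg"
  | Neq "('f, 'n, 'x) msg" "('f, 'n, 'x) msg"
  | is_Dep: Dep "'s list" "'w set"

type_synonym ('f, 'n, 'x, 'w, 's) csys =
  "('f, 'n, 'x, 'w) frame \<times> ('f, 'n, 'x, 'w, 's) constr set"

primrec fv1_constr :: "('f, 'n, 'x, 'w, 's) constr \<Rightarrow> 'x set" where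
  "fv1_constr (Ded D X x) = {x}"
| "fv1_constr (Eq u v) = fv u \<union> fv v"
| "fv1_constr (Neq u v) = fv u \<union> fv v"
| "fv1_constr (Dep Xs ws) = {}"

primrec fv2_constr :: "('f, 'n, 'x, 'w, 's) constr \<Rightarrow> 's set" where
  "fv2_constr (Ded D X x) = {X}"
| "fv2_constr (Eq u v) = {}"
| "fv2_constr (Neq u v) = {}"
| "fv2_constr (Dep Xs ws) = set Xs"

text \<open>First-order variables proper, that is, without the handles.\<close>

definition fv1 :: "('f, 'n, 'x, 'w, 's) csys \<Rightarrow> 'x set" where
  "fv1 K = (\<Union>u \<in> ran (fst K). fv u) \<union> (\<Union>k \<in> snd K. fv1_constr k)"

definition fv2 :: "('f, 'n, 'x, 'w, 's) csys \<Rightarrow> 's set" where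
  "fv2 K = (\<Union>k \<in> snd K. fv2_constr k)"

definition strip :: "('f, 'n, 'x, 'w, 's) csys \<Rightarrow> ('f, 'n, 'x, 'w, 's) csys" where
  "strip K = (fst K, {k \<in> snd K. \<not> is_Dep k})"

definition handles_of :: "('f, 'n, 'x, 'w, 's) csys \<Rightarrow> 's \<Rightarrow> 'w set" where
  "handles_of K X = (THE D. \<exists>x. Ded D X x \<in> snd K)"

definition well_formed :: "('f, 'n, 'x, 'w, 's) csys \<Rightarrow> bool" where
  "well_formed K \<longleftrightarrow>
     (\<forall>x \<in> fv1 K. \<exists>!k. k \<in> snd K \<and> (\<exists>D X. k = Ded D X x)) \<and>
     (\<forall>X \<in> fv2 K. \<exists>!k. k \<in> snd K \<and> (\<exists>D x. k = Ded D X x)) \<and>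
     acyclic {(x, y). \<exists>D X. Ded D X x \<in> snd K \<and> (\<exists>w \<in> D. \<exists>u. fst K w = Some u \<and> y \<in> fv u)}"

type_synonym ('c, 'f, 'n, 'x, 'w, 's) sbasic =
  "('c, 'f, 'n, 'x) proc \<times> ('f, 'n, 'x, 'w) frame \<times> ('f, 'n, 'x, 'w, 's) constr set"

text \<open>Results of the focused relations; \<open>None\<close> is the special symbol \<open>\<bottom>\<close>.\<close>

type_synonym ('c, 'f, 'n, 'x, 'w, 's) sresult =
  "('c, 'f, 'n, 'x) proc option \<times> ('f, 'n, 'x, 'w) frame \<times> ('f, 'n, 'x, 'w, 's) constr set"

type_synonym ('c, 'f, 'n, 'x, 'w, 's) sproc =
  "('c, 'f, 'n, 'x) proc multiset \<times> ('f, 'n, 'x, 'w) frame \<times> ('f, 'n, 'x, 'w, 's) constr set"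

inductive sym_step ::
    "('c, 'f, 'n, 'x, 'w, 's) sbasic \<Rightarrow> ('c, 's, 'w) act \<Rightarrow> ('c, 'f, 'n, 'x, 'w, 's) sbasic \<Rightarrow> bool"
where
  sym_in:
    "X \<notin> fv2 (\<Phi>, S) \<Longrightarrow> x \<notin> fv1 (\<Phi>, S) \<Longrightarrow> x \<notin> vars_proc (PIn c y P) \<Longrightarrow>
     sym_step (PIn c y P, \<Phi>, S) (Inp c X)
       (psubst y (Atom (Var x)) P, \<Phi>, S \<union> {Ded (dom \<Phi>) X x})"
| sym_out:
    "w \<notin> dom \<Phi> \<Longrightarrow> sym_step (POut c u P, \<Phi>, S) (Outp c w) (P, \<Phi>(w \<mapsto> u), S)"
| sym_then:
    "sym_step (PIf u v P Q, \<Phi>, S) Tau (P, \<Phi>, S \<union> {Eq u v})"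
| sym_else:
    "sym_step (PIf u v P Q, \<Phi>, S) Tau (Q, \<Phi>, S \<union> {Neq u v})"

datatype mode = IPlus | IStar | OStar

inductive focused ::
    "mode \<Rightarrow> ('c, 'f, 'n, 'x, 'w, 's) sbasic \<Rightarrow> ('c, 's, 'w) act list \<Rightarrow>
     ('c, 'f, 'n, 'x, 'w, 's) sresult \<Rightarrow> bool"
where
  foc_in:
    "sym_step K (Inp c X) K' \<Longrightarrow> focused IStar K' tr K'' \<Longrightarrow> l \<in> {IStar, IPlus} \<Longrightarrow>
     focused l K (Inp c X # tr) K''"
| foc_out:
    "sym_step K (Outp c w) K' \<Longrightarrow> focused OStar K' tr K'' \<Longrightarrow> l \<in> {IStar, OStar} \<Longrightarrow>
     focused l K (Outp c w # tr) K''"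
| foc_tau:
    "sym_step K Tau K' \<Longrightarrow> focused l K' tr K'' \<Longrightarrow> focused l K tr K''"
| foc_proper:
    "P = PNull \<or> (\<exists>c x P'. P = PIn c x P') \<Longrightarrow> focused OStar (P, \<Phi>, S) [] (Some P, \<Phi>, S)"
| foc_improper:
    "focused IStar (PNull, \<Phi>, S) [] (None, \<Phi>, S)"

inductive compressed ::
    "('c, 'f, 'n, 'x, 'w, 's) sproc \<Rightarrow> ('c, 's, 'w) act list \<Rightarrow>
     ('c, 'f, 'n, 'x, 'w, 's) sproc \<Rightarrow> bool"
where
  comp_refl: "compressed K [] K"
| comp_trans:
    "compressed K tr K' \<Longrightarrow> compressed K' tr' K'' \<Longrightarrow> compressed K (tr @ tr') K''"
| comp_proper:
    "focused IPlus (Q, \<Phi>, S) tr (Some Q', \<Phi>', S') \<Longrightarrow>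
     compressed ({#Q#} + \<P>, \<Phi>, S) tr (single Q' + \<P>, \<Phi>', S')"
| comp_improper:
    "focused IPlus (Q, \<Phi>, S) tr (None, \<Phi>', S') \<Longrightarrow>
     compressed ({#Q#} + \<P>, \<Phi>, S) tr ({#}, \<Phi>', S')"

datatype ('c, 's, 'w) block = Block (chan: 'c) (inputs: "'s list") (outputs: "'w list")

primrec io :: "('c, 's, 'w) block \<Rightarrow> ('c, 's, 'w) act list" where
  "io (Block c Xs ws) = map (Inp c) Xs @ map (Outp c) ws"

text \<open>The total order on channels is that of the class \<open>linorder\<close>. There is at most one \<open>k\<close> as
  below, and \<open>dep tr c\<close> is empty if there is none.\<close>

definition dep :: "('c :: linorder, 's, 'w) block list \<Rightarrow> 'c \<Rightarrow> 'w set" where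
  "dep tr c = {w. \<exists>k < length tr. c < chan (tr ! k) \<and>
     (\<forall>i. k < i \<and> i < length tr \<longrightarrow> chan (tr ! i) < c) \<and>
     (\<exists>i. k \<le> i \<and> i < length tr \<and> w \<in> set (outputs (tr ! i)))}"

text \<open>Traces of the reduced semantics are kept as sequences of blocks. No information is added to
  the underlying sequence of actions: a block without outputs leads to the empty process, so it can
  only be the last one, and all other blocks end where an output is followed by an input.\<close>

inductive reduced ::
    "('c :: linorder, 'f, 'n, 'x, 'w, 's) sproc \<Rightarrow> ('c, 's, 'w) block list \<Rightarrow>
     ('c, 'f, 'n, 'x, 'w, 's) sproc \<Rightarrow> bool"
where
  red_refl: "reduced K [] K"
| red_block:
    "reduced (\<P>, \<Phi>, {}) tr (\<P>', \<Phi>', S') \<Longrightarrow>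
     compressed (\<P>', \<Phi>', S') (io (Block c Xs ws)) (\<P>'', \<Phi>'', S'') \<Longrightarrow> Xs \<noteq> [] \<Longrightarrow>
     reduced (\<P>, \<Phi>, {}) (tr @ [Block c Xs ws]) (\<P>'', \<Phi>'', S'' \<union> {Dep Xs (dep tr c)})"

locale equational_setting =
  fixes Sig :: "('f \<times> nat) set"
    and E :: "(('f, 'n, 'x) msg \<times> ('f, 'n, 'x) msg) set"
  assumes finite_Sig: "finite Sig"
    and E_terms: "E \<subseteq> terms Sig UNIV \<times> terms Sig UNIV"
begin

text \<open>Variables may be instantiated by arbitrary messages, names are left alone. Equations may
  contain names; the usual case of name-free equations is included.\<close>

inductive eqE :: "('f, 'n, 'x) msg \<Rightarrow> ('f, 'n, 'x) msg \<Rightarrow> bool" (infix "=\<^sub>E" 50) where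
  eq_axiom:
    "(u, v) \<in> E \<Longrightarrow> ran \<sigma> \<subseteq> terms Sig UNIV \<Longrightarrow> msubst \<sigma> u =\<^sub>E msubst \<sigma> v"
| eq_refl: "u \<in> terms Sig UNIV \<Longrightarrow> u =\<^sub>E u"
| eq_sym: "u =\<^sub>E v \<Longrightarrow> v =\<^sub>E u"
| eq_trans: "u =\<^sub>E v \<Longrightarrow> v =\<^sub>E t \<Longrightarrow> u =\<^sub>E t"
| eq_cong: "(f, length us) \<in> Sig \<Longrightarrow> list_all2 eqE us vs \<Longrightarrow> App f us =\<^sub>E App f vs"

definition messages :: "('f, 'n, 'x) msg set" where
  "messages = terms Sig UNIV"

definition ground_messages :: "('f, 'n, 'x) msg set" where
  "ground_messages = terms Sig (range Name)"

inductive basic_on :: "'c \<Rightarrow> ('c, 'f, 'n, 'x) proc \<Rightarrow> bool" for c :: 'c where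
  "basic_on c PNull"
| "u \<in> messages \<Longrightarrow> v \<in> messages \<Longrightarrow> basic_on c P \<Longrightarrow> basic_on c Q \<Longrightarrow> basic_on c (PIf u v P Q)"
| "basic_on c P \<Longrightarrow> basic_on c (PIn c x P)"
| "u \<in> messages \<Longrightarrow> basic_on c P \<Longrightarrow> basic_on c (POut c u P)"

definition simple :: "('c, 'f, 'n, 'x) proc multiset \<Rightarrow> bool" where
  "simple \<P> \<longleftrightarrow> PNull \<notin># \<P> \<and>
     (\<exists>cs Ps. \<P> = mset Ps \<and> distinct cs \<and> list_all2 basic_on cs Ps)"

definition extended_simple :: "('c, 'f, 'n, 'x, 'w) eproc \<Rightarrow> bool" where
  "extended_simple A \<longleftrightarrow> (case A of (\<P>, \<Phi>) \<Rightarrow>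
     simple \<P> \<and> (\<forall>P \<in># \<P>. fv_proc P = {}) \<and>
     finite (dom \<Phi>) \<and> ran \<Phi> \<subseteq> ground_messages)"

inductive step ::
    "('c, 'f, 'n, 'x, 'w) eproc \<Rightarrow> ('c, ('f, 'w) recipe, 'w) act \<Rightarrow>
     ('c, 'f, 'n, 'x, 'w) eproc \<Rightarrow> bool"
where
  step_then:
    "u =\<^sub>E v \<Longrightarrow> step ({#PIf u v Q1 Q2#} + \<P>, \<Phi>) Tau (single Q1 + \<P>, \<Phi>)"
| step_else:
    "\<not> u =\<^sub>E v \<Longrightarrow> step ({#PIf u v Q1 Q2#} + \<P>, \<Phi>) Tau (single Q2 + \<P>, \<Phi>)"
| step_in:
    "M \<in> terms Sig (dom \<Phi>) \<Longrightarrow>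
     step ({#PIn c x Q#} + \<P>, \<Phi>) (Inp c M) (single (psubst x (recipe_msg \<Phi> M) Q) + \<P>, \<Phi>)"
| step_out:
    "w \<notin> dom \<Phi> \<Longrightarrow>
     step ({#POut c u Q#} + \<P>, \<Phi>) (Outp c w) (single Q + \<P>, \<Phi>(w \<mapsto> u))"

inductive steps ::
    "('c, 'f, 'n, 'x, 'w) eproc \<Rightarrow> ('c, ('f, 'w) recipe, 'w) act list \<Rightarrow>
     ('c, 'f, 'n, 'x, 'w) eproc \<Rightarrow> bool"
where
  "steps A [] A"
| "step A a B \<Longrightarrow> steps B as C \<Longrightarrow> steps A (a # as) C"

definition trace ::
    "('c, 'f, 'n, 'x, 'w) eproc \<Rightarrow> ('c, ('f, 'w) recipe, 'w) act list \<Rightarrow>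
     ('c, 'f, 'n, 'x, 'w) eproc \<Rightarrow> bool" where
  "trace A tr B \<longleftrightarrow> (\<exists>as. steps A as B \<and> tr = filter (\<lambda>a. a \<noteq> Tau) as)"

definition static_eq ::
    "('f, 'n, 'x, 'w) frame \<Rightarrow> ('f, 'n, 'x, 'w) frame \<Rightarrow> bool" (infix "\<sim>" 50) where
  "\<Phi> \<sim> \<Phi>' \<longleftrightarrow> dom \<Phi> = dom \<Phi>' \<and>
     (\<forall>M \<in> terms Sig (dom \<Phi>). \<forall>N \<in> terms Sig (dom \<Phi>).
        recipe_msg \<Phi> M =\<^sub>E recipe_msg \<Phi> N \<longleftrightarrow> recipe_msg \<Phi>' M =\<^sub>E recipe_msg \<Phi>' N)"

definition trace_incl ::
    "('c, 'f, 'n, 'x, 'w) eproc \<Rightarrow> ('c, 'f, 'n, 'x, 'w) eproc \<Rightarrow> bool" where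
  "trace_incl A B \<longleftrightarrow> (\<forall>tr \<P> \<Phi>. trace A tr (\<P>, \<Phi>) \<longrightarrow>
     (\<exists>\<P>' \<Phi>'. trace B tr (\<P>', \<Phi>') \<and> \<Phi> \<sim> \<Phi>'))"

definition trace_equiv ::
    "('c, 'f, 'n, 'x, 'w) eproc \<Rightarrow> ('c, 'f, 'n, 'x, 'w) eproc \<Rightarrow> bool" where
  "trace_equiv A B \<longleftrightarrow> trace_incl A B \<and> trace_incl B A"

primrec ordinary_constr :: "('f, 'n, 'x, 'w, 's) constr \<Rightarrow> bool" where
  "ordinary_constr (Ded D X x) \<longleftrightarrow> True"
| "ordinary_constr (Eq u v) \<longleftrightarrow> u \<in> messages \<and> v \<in> messages"
| "ordinary_constr (Neq u v) \<longleftrightarrow> u \<in> messages \<and> v \<in> messages"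
| "ordinary_constr (Dep Xs ws) \<longleftrightarrow> False"

definition constraint_system :: "('f, 'n, 'x, 'w, 's) csys \<Rightarrow> bool" where
  "constraint_system K \<longleftrightarrow>
     finite (dom (fst K)) \<and> ran (fst K) \<subseteq> messages \<and>
     (\<forall>k \<in> snd K. ordinary_constr k) \<and> well_formed K"

primrec sat ::
    "('f, 'n, 'x, 'w) frame \<Rightarrow> ('f, 'w, 's) so_subst \<Rightarrow> ('f, 'n, 'x) fo_subst \<Rightarrow>
     ('f, 'n, 'x, 'w, 's) constr \<Rightarrow> bool" where
  "sat \<Phi> \<theta> \<mu> (Ded D X x) \<longleftrightarrow> recipe_msg (fsubst \<mu> \<Phi>) (the (\<theta> X)) =\<^sub>E the (\<mu> x)"
| "sat \<Phi> \<theta> \<mu> (Eq u v) \<longleftrightarrow> msubst \<mu> u =\<^sub>E msubst \<mu> v"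
| "sat \<Phi> \<theta> \<mu> (Neq u v) \<longleftrightarrow> \<not> msubst \<mu> u =\<^sub>E msubst \<mu> v"
| "sat \<Phi> \<theta> \<mu> (Dep Xs ws) \<longleftrightarrow> True"

definition first_order_part ::
    "('f, 'n, 'x, 'w, 's) csys \<Rightarrow> ('f, 'w, 's) so_subst \<Rightarrow> ('f, 'n, 'x) fo_subst \<Rightarrow> bool" where
  "first_order_part K \<theta> \<mu> \<longleftrightarrow>
     dom \<mu> = fv1 K \<and> ran \<mu> \<subseteq> ground_messages \<and> (\<forall>k \<in> snd K. sat (fst K) \<theta> \<mu> k)"

text \<open>Solutions are only defined for (well-formed) constraint systems. This does not restrict the
  equivalences below: every system that is reachable from a closed extended process is well-formed.\<close>

definition Sol :: "('f, 'n, 'x, 'w, 's) csys \<Rightarrow> ('f, 'w, 's) so_subst set" where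
  "Sol K = {\<theta>. constraint_system K \<and> dom \<theta> = fv2 K \<and>
     (\<forall>X \<in> fv2 K. the (\<theta> X) \<in> terms Sig (handles_of K X)) \<and>
     (\<exists>\<mu>. first_order_part K \<theta> \<mu>)}"

text \<open>The substitution \<open>\<lambda>\<^sub>\<theta>\<close>; it is unique up to \<open>=\<^sub>E\<close> if \<open>\<theta> \<in> Sol K\<close>.\<close>

definition lam ::
    "('f, 'n, 'x, 'w, 's) csys \<Rightarrow> ('f, 'w, 's) so_subst \<Rightarrow> ('f, 'n, 'x) fo_subst" where
  "lam K \<theta> = (SOME \<mu>. first_order_part K \<theta> \<mu>)"

definition inst_frame ::
    "('f, 'n, 'x, 'w, 's) csys \<Rightarrow> ('f, 'w, 's) so_subst \<Rightarrow> ('f, 'n, 'x, 'w) frame" where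
  "inst_frame K \<theta> = fsubst (lam (strip K) \<theta>) (fst K)"

definition Sol1 :: "('f, 'n, 'x, 'w, 's) csys \<Rightarrow> ('f, 'w, 's) so_subst set" where
  "Sol1 K = {\<theta> \<in> Sol (strip K). \<forall>Xs ws. Dep Xs ws \<in> snd K \<and> ws \<noteq> {} \<longrightarrow>
     (\<exists>X \<in> set Xs. \<forall>M \<in> terms Sig (handles_of (strip K) X).
        recipe_msg (inst_frame K \<theta>) M =\<^sub>E recipe_msg (inst_frame K \<theta>) (the (\<theta> X)) \<longrightarrow>
        atoms M \<inter> ws \<noteq> {})}"

text \<open>The first argument only fixes the type of second-order variables.\<close>

definition reduced_incl1 ::
    "'s itself \<Rightarrow> ('c :: linorder, 'f, 'n, 'x, 'w) eproc \<Rightarrow> ('c, 'f, 'n, 'x, 'w) eproc \<Rightarrow> bool" where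
  "reduced_incl1 (_ :: 's itself) A B \<longleftrightarrow>
     (\<forall>(tr :: ('c, 's, 'w) block list) \<P>' \<Phi>' S\<^sub>A \<theta>.
        reduced (fst A, snd A, {}) tr (\<P>', \<Phi>', S\<^sub>A) \<and> \<theta> \<in> Sol1 (\<Phi>', S\<^sub>A) \<longrightarrow>
        (\<exists>\<Q>' \<Psi>' S\<^sub>B. reduced (fst B, snd B, {}) tr (\<Q>', \<Psi>', S\<^sub>B) \<and> \<theta> \<in> Sol1 (\<Psi>', S\<^sub>B) \<and>
           inst_frame (\<Phi>', S\<^sub>A) \<theta> \<sim> inst_frame (\<Psi>', S\<^sub>B) \<theta>))"

definition reduced_equiv1 ::
    "'s itself \<Rightarrow> ('c :: linorder, 'f, 'n, 'x, 'w) eproc \<Rightarrow> ('c, 'f, 'n, 'x, 'w) eproc \<Rightarrow> bool" where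
  "reduced_equiv1 S2 A B \<longleftrightarrow> reduced_incl1 S2 A B \<and> reduced_incl1 S2 B A"

end

end

theory Submission
  imports Defs
begin

text \<open>
  Read modulo \<open>=\<^sub>E\<close>, with silent steps erased, a basic process is a deterministic tree of inputs and
  outputs. Hence a concrete state is a family of such trees, one per channel, with a frame of values,
  and whether a trace can be executed only depends on its projections on the channels, given that its
  recipes only use available handles. Symbolic executions with a solution are the executions of
  blocks of this kind.

  If \<open>A\<close> and \<open>B\<close> are trace equivalent, then \<open>B\<close> follows every sequence of blocks of \<open>A\<close>; its blocks are
  maximal, since otherwise \<open>B\<close> would have an action that \<open>A\<close> lacks. Conversely, a trace of \<open>A\<close> is
  extended until every channel has finished its current block, and its actions are grouped into
  blocks. A block that violates its dependency constraint is moved forward, and its recipes are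
  replaced by equivalent ones; a lexicographically minimal sequence satisfies all the constraints, so
  \<open>B\<close> can execute it, and therefore the original trace. Improper blocks are treated one at a time,
  after the proper ones.
\<close>

section \<open>Terms and values\<close>

text \<open>The obstacle is the improper block. In the compressed semantics it erases all processes,
  so a reduced trace contains at most one, at its end, whereas a concrete trace may leave several
  channels stopped after inputs. These inputs are therefore set aside while the blocks with outputs
  are reordered. Each of them is then appended alone, as an improper block, and the results are
  combined. This is sound because channels do not influence each other once the frame is fixed. That
  independence is built into the notion of run: every channel is executed relative to the final
  frame, and the interleaving only decides when handles become available.

  Reordering terminates because a moved block lands in front of a block on a larger channel, while
  only finitely many channels occur. It preserves projections because no block of its own channel is
  overtaken. Moving is always possible for a violated constraint: violation says precisely that
  every recipe of the block can avoid the handles it is supposed to depend on.\<close>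

lemma subst_subst: "subst \<sigma> (subst \<tau> t) = subst (\<lambda>a. subst \<sigma> (\<tau> a)) t"
  by (induction t) auto

lemma subst_cong_atoms:
  assumes "\<And>a. a \<in> atoms t \<Longrightarrow> \<sigma> a = \<tau> a"
  shows "subst \<sigma> t = subst \<tau> t"
  using assms by (induction t) auto

lemma atoms_terms: "t \<in> terms Sig S \<Longrightarrow> atoms t \<subseteq> S"
  by (induction rule: terms.induct) auto

lemma terms_atoms_mono: "t \<in> terms Sig S \<Longrightarrow> atoms t \<subseteq> S' \<Longrightarrow> t \<in> terms Sig S'"
proof (induction rule: terms.induct)
  case (App f ts)
  then have "\<forall>t\<in>set ts. t \<in> terms Sig S'" by fastforce
  with App.hyps(1) show ?case by (rule terms.App)
qed (simp add: terms.Atom)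

lemma terms_mono: "t \<in> terms Sig S \<Longrightarrow> S \<subseteq> S' \<Longrightarrow> t \<in> terms Sig S'"
  using atoms_terms[of t Sig S] terms_atoms_mono[of t Sig S S'] by simp

lemma subst_terms:
  "t \<in> terms Sig S \<Longrightarrow> (\<And>a. a \<in> S \<Longrightarrow> \<sigma> a \<in> terms Sig S') \<Longrightarrow> subst \<sigma> t \<in> terms Sig S'"
proof (induction rule: terms.induct)
  case (App f ts)
  then show ?case by (simp add: terms.App)
qed simp

lemma atoms_subst: "atoms (subst \<sigma> t) = (\<Union>a\<in>atoms t. atoms (\<sigma> a))"
  by (induction t) auto

text \<open>Reads a partial substitution as a total map that fixes the variables outside its domain,
  so that congruence statements need no side conditions on domains.\<close>

definition fo_val :: "('f, 'n, 'x) fo_subst \<Rightarrow> 'x \<Rightarrow> ('f, 'n, 'x) msg" where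
  "fo_val \<mu> x = (case \<mu> x of None \<Rightarrow> Atom (Var x) | Some t \<Rightarrow> t)"

lemma fo_val_simps [simp]:
  "\<mu> x = Some t \<Longrightarrow> fo_val \<mu> x = t"
  "\<mu> x = None \<Longrightarrow> fo_val \<mu> x = Atom (Var x)"
  by (auto simp: fo_val_def)

lemma fo_val_upd: "fo_val (\<mu>(x \<mapsto> t)) y = (if y = x then t else fo_val \<mu> y)"
  by (simp add: fo_val_def)

lemma fv_Var [simp]: "fv (Atom (Var x)) = {x}"
  by (auto simp: fv_def)

lemma msubst_alt:
  "msubst \<mu> = subst (\<lambda>a. case a of Name n \<Rightarrow> Atom (Name n) | Var x \<Rightarrow> fo_val \<mu> x)"
  unfolding msubst_def fo_val_def ..

lemma msubst_Var [simp]: "msubst \<mu> (Atom (Var x)) = fo_val \<mu> x"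
  by (simp add: msubst_alt)

lemma msubst_cong:
  "(\<And>x. x \<in> fv u \<Longrightarrow> fo_val \<mu> x = fo_val \<nu> x) \<Longrightarrow> msubst \<mu> u = msubst \<nu> u"
  unfolding msubst_alt by (rule subst_cong_atoms) (auto simp: fv_def split: leaf.splits)

lemma msubst_upd_fresh: "x \<notin> fv u \<Longrightarrow> msubst (\<mu>(x \<mapsto> t)) u = msubst \<mu> u"
  by (rule msubst_cong) (auto simp: fo_val_upd)

lemma msubst_ground: "fv u = {} \<Longrightarrow> msubst \<mu> u = u"
proof -
  assume "fv u = {}"
  then have "msubst \<mu> u = msubst Map.empty u" by (intro msubst_cong) auto
  also have "\<dots> = u"
    unfolding msubst_alt by (induction u) (auto simp: map_idI split: leaf.splits)
  finally show ?thesis .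
qed

lemma msubst_msubst_single:
  "msubst \<mu> (msubst [y \<mapsto> m] u) = msubst (\<mu>(y \<mapsto> msubst \<mu> m)) u"
  unfolding msubst_alt subst_subst
  by (rule subst_cong_atoms) (auto simp: fo_val_def split: leaf.splits)

lemma fv_msubst: "fv (msubst \<mu> u) = (\<Union>x\<in>fv u. fv (fo_val \<mu> x))"
proof -
  have "Var x \<in> atoms (case a of Name n \<Rightarrow> Atom (Name n) | Var y \<Rightarrow> fo_val \<mu> y) \<longleftrightarrow>
      (\<exists>y. a = Var y \<and> Var x \<in> atoms (fo_val \<mu> y))" for x a
    by (cases a) auto
  then show ?thesis unfolding fv_def msubst_alt atoms_subst by auto
qed

lemma fv_msubst_single: "fv (msubst [y \<mapsto> m] u) \<subseteq> (fv u - {y}) \<union> (if y \<in> fv u then fv m else {})"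
  by (auto simp: fv_msubst fo_val_def split: if_splits)

lemma finite_atoms: "finite (atoms t)"
  by (induction t) auto

lemma finite_fv: "finite (fv u)"
proof -
  have "fv u = Var -` atoms u" by (auto simp: fv_def)
  then show ?thesis using finite_vimageI[OF finite_atoms, of Var] by (simp add: inj_def)
qed

lemma finite_vars_proc: "finite (vars_proc P)"
  by (induction P) (auto simp: finite_fv)

lemma fv_proc_subset_vars: "fv_proc P \<subseteq> vars_proc P"
  by (induction P) auto

lemma fv_proc_psubst:
  "fv_proc (psubst y m P) \<subseteq> (fv_proc P - {y}) \<union> fv m"
proof (induction P)
  case (PIf u v P Q)
  then show ?case using fv_msubst_single[of y m u] fv_msubst_single[of y m v]
    by (auto split: if_splits)
next
  case (POut c u P)
  then show ?case using fv_msubst_single[of y m u] by (auto split: if_splits)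
qed auto

text \<open>Values received by \<open>Recv\<close> are meant to be messages; internal choices are resolved when a
  process is interpreted, so this tree has no silent transitions.\<close>

datatype 'v beh = Stop | Send 'v "'v beh" | Recv "'v \<Rightarrow> 'v beh"

primrec beh_ins :: "'v beh \<Rightarrow> 'v list \<Rightarrow> 'v beh option" where
  "beh_ins b [] = Some b"
| "beh_ins b (v # vs) = (case b of Recv k \<Rightarrow> beh_ins (k v) vs | _ \<Rightarrow> None)"

fun beh_outs :: "'v beh \<Rightarrow> 'v list \<times> 'v beh" where
  "beh_outs (Send v b) = (v # fst (beh_outs b), snd (beh_outs b))"
| "beh_outs b = ([], b)"

definition is_Send :: "'v beh \<Rightarrow> bool" where
  "is_Send b \<longleftrightarrow> (\<exists>v b'. b = Send v b')"

lemma is_Send_simps [simp]: "\<not> is_Send Stop" "\<not> is_Send (Recv k)" "is_Send (Send v b)"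
  by (auto simp: is_Send_def)

lemma beh_outs_not_Send: "\<not> is_Send (snd (beh_outs b))"
  by (induction b rule: beh_outs.induct) auto

section \<open>Messages modulo the equational theory\<close>

context equational_setting
begin

lemma messages_Atom [simp]: "Atom a \<in> messages"
  by (simp add: messages_def terms.Atom)

lemma ground_messages_subset: "ground_messages \<subseteq> messages"
  unfolding ground_messages_def messages_def by (auto intro: terms_mono)

lemma ground_messages_iff: "t \<in> ground_messages \<longleftrightarrow> t \<in> messages \<and> fv t = {}"
proof
  assume "t \<in> ground_messages"
  then show "t \<in> messages \<and> fv t = {}"
    using ground_messages_subset atoms_terms[of t Sig "range Name"]
    by (auto simp: ground_messages_def fv_def)
next
  assume *: "t \<in> messages \<and> fv t = {}"
  then have "atoms t \<subseteq> range Name"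
    by (auto simp: fv_def) (metis leaf.exhaust rangeI)
  then show "t \<in> ground_messages"
    using * terms_atoms_mono[of t Sig UNIV] by (simp add: ground_messages_def messages_def)
qed

lemma fo_val_messages: "ran \<mu> \<subseteq> messages \<Longrightarrow> fo_val \<mu> x \<in> messages"
  by (auto simp: fo_val_def ran_def split: option.splits)

lemma msubst_messages:
  "u \<in> messages \<Longrightarrow> (\<And>x. x \<in> fv u \<Longrightarrow> fo_val \<mu> x \<in> messages) \<Longrightarrow> msubst \<mu> u \<in> messages"
proof -
  assume "u \<in> messages" and v: "\<And>x. x \<in> fv u \<Longrightarrow> fo_val \<mu> x \<in> messages"
  then have "u \<in> terms Sig (atoms u)" using terms_atoms_mono[of u Sig UNIV] by (simp add: messages_def)
  then show ?thesis unfolding messages_def msubst_alt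
    by (rule subst_terms) (use v in \<open>auto simp: fv_def messages_def terms.Atom split: leaf.splits\<close>)
qed

text \<open>Reflexivity holds for messages only, so congruence arguments have to carry membership in
  \<open>messages\<close>; conversely, every equation delivers it.\<close>

lemma eqE_messages: "u =\<^sub>E v \<Longrightarrow> u \<in> messages \<and> v \<in> messages"
proof (induction rule: eqE.induct)
  case (eq_axiom u v \<sigma>)
  then have "u \<in> messages" "v \<in> messages" using E_terms by (auto simp: messages_def)
  moreover have "fo_val \<sigma> x \<in> messages" for x
    using eq_axiom fo_val_messages by (simp add: messages_def)
  ultimately show ?case using msubst_messages by blast
next
  case (eq_cong f us vs)
  then have len: "length us = length vs"
    and m: "\<And>i. i < length us \<Longrightarrow> us ! i \<in> messages \<and> vs ! i \<in> messages"
    by (simp_all add: list_all2_conv_all_nth)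
  then have "\<forall>u \<in> set us. u \<in> messages" "\<forall>v \<in> set vs. v \<in> messages"
    by (simp_all add: all_set_conv_all_nth)
  with eq_cong len show ?case by (simp add: messages_def terms.App)
qed (auto simp: messages_def)

lemma eqE_refl: "u \<in> messages \<Longrightarrow> u =\<^sub>E u"
  by (simp add: messages_def eq_refl)

lemma subst_eqE:
  "t \<in> terms Sig S \<Longrightarrow> (\<And>a. a \<in> S \<Longrightarrow> \<sigma> a =\<^sub>E \<tau> a) \<Longrightarrow> subst \<sigma> t =\<^sub>E subst \<tau> t"
proof (induction rule: terms.induct)
  case (App f ts)
  then show ?case by (auto intro!: eq_cong simp: list_all2_conv_all_nth)
qed auto

lemma msubst_eqE:
  "u \<in> messages \<Longrightarrow> (\<And>x. x \<in> fv u \<Longrightarrow> fo_val \<mu> x =\<^sub>E fo_val \<nu> x) \<Longrightarrow> msubst \<mu> u =\<^sub>E msubst \<nu> u"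
proof -
  assume "u \<in> messages" and v: "\<And>x. x \<in> fv u \<Longrightarrow> fo_val \<mu> x =\<^sub>E fo_val \<nu> x"
  then have "u \<in> terms Sig (atoms u)" using terms_atoms_mono[of u Sig UNIV] by (simp add: messages_def)
  then show ?thesis unfolding msubst_alt
    by (rule subst_eqE) (use v in \<open>auto simp: fv_def eqE_refl split: leaf.splits\<close>)
qed

lemma eqE_right_cong: "s =\<^sub>E t \<Longrightarrow> r =\<^sub>E s \<longleftrightarrow> r =\<^sub>E t"
  using eq_trans[of r s t] eq_trans[of r t s] eq_sym[of s t] by blast

lemma eqE_left_cong: "s =\<^sub>E t \<Longrightarrow> s =\<^sub>E r \<longleftrightarrow> t =\<^sub>E r"
  using eq_trans[of s t r] eq_trans[of t s r] eq_sym[of s t] by blast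

text \<open>A choice of representatives turns \<open>=\<^sub>E\<close> into equality, so that trees
  and frames can be compared by equality and runs become deterministic. The representative of a
  ground message need not be ground: values are only known to be messages.\<close>

definition canon :: "('f, 'n, 'x) msg \<Rightarrow> ('f, 'n, 'x) msg" where
  "canon t = (SOME s. s =\<^sub>E t)"

lemma canon_eqE: "t \<in> messages \<Longrightarrow> canon t =\<^sub>E t"
  unfolding canon_def by (rule someI_ex) (use eqE_refl in blast)

lemma canon_messages: "t \<in> messages \<Longrightarrow> canon t \<in> messages"
  using canon_eqE eqE_messages by blast

lemma canon_cong: "s =\<^sub>E t \<Longrightarrow> canon s = canon t"
  unfolding canon_def by (simp add: eqE_right_cong)

lemma canon_eq_iff: "s \<in> messages \<Longrightarrow> t \<in> messages \<Longrightarrow> canon s = canon t \<longleftrightarrow> s =\<^sub>E t"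
  using canon_cong[of s t] eqE_left_cong[OF canon_eqE, of s t] canon_eqE[of t] by auto

text \<open>Tests are decided here, which removes the silent steps. An input outside
  \<open>messages\<close> leads to \<open>Stop\<close>: trees have to agree as functions on all
  arguments, but \<open>=\<^sub>E\<close> is reflexive on messages only.\<close>

primrec den :: "('c, 'f, 'n, 'x) proc \<Rightarrow> ('f, 'n, 'x) fo_subst \<Rightarrow> ('f, 'n, 'x) msg beh" where
  "den PNull \<mu> = Stop"
| "den (PIf u v P Q) \<mu> = (if msubst \<mu> u =\<^sub>E msubst \<mu> v then den P \<mu> else den Q \<mu>)"
| "den (PIn c x P) \<mu> = Recv (\<lambda>v. if v \<in> messages then den P (\<mu>(x \<mapsto> v)) else Stop)"
| "den (POut c u P) \<mu> = Send (canon (msubst \<mu> u)) (den P \<mu>)"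

inductive_cases basic_on_PIfE: "basic_on c (PIf u v P Q)"
inductive_cases basic_on_PInE: "basic_on c (PIn d x P)"
inductive_cases basic_on_POutE: "basic_on c (POut d u P)"

lemma den_cong:
  "basic_on c P \<Longrightarrow> (\<And>x. x \<in> fv_proc P \<Longrightarrow> fo_val \<mu> x =\<^sub>E fo_val \<nu> x) \<Longrightarrow> den P \<mu> = den P \<nu>"
proof (induction arbitrary: \<mu> \<nu> rule: basic_on.induct)
  case (2 u v P Q)
  have "msubst \<mu> u =\<^sub>E msubst \<nu> u" "msubst \<mu> v =\<^sub>E msubst \<nu> v"
    using 2 by (auto intro!: msubst_eqE)
  then have "msubst \<mu> u =\<^sub>E msubst \<mu> v \<longleftrightarrow> msubst \<nu> u =\<^sub>E msubst \<nu> v"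
    using eqE_left_cong eqE_right_cong by blast
  moreover have "den P \<mu> = den P \<nu>" "den Q \<mu> = den Q \<nu>" using 2 by auto
  ultimately show ?case by simp
next
  case (3 P x)
  have "den P (\<mu>(x \<mapsto> v)) = den P (\<nu>(x \<mapsto> v))" if "v \<in> messages" for v
  proof (rule "3.IH")
    show "fo_val (\<mu>(x \<mapsto> v)) y =\<^sub>E fo_val (\<nu>(x \<mapsto> v)) y" if "y \<in> fv_proc P" for y
      using "3.prems"[of y] that \<open>v \<in> messages\<close> by (simp add: fo_val_upd eqE_refl)
  qed
  then show ?case by auto
next
  case (4 u P)
  have "msubst \<mu> u =\<^sub>E msubst \<nu> u" using 4 by (auto intro!: msubst_eqE)
  with 4 show ?case using canon_cong by auto
qed auto

text \<open>Covers both uses of \<open>psubst\<close>, with a ground message and with a fresh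
  variable. No variable of \<open>m\<close> is bound in \<open>P\<close>, so updates made below
  binders leave the value of \<open>m\<close> alone.\<close>

lemma den_psubst:
  "fv m \<inter> vars_proc P = {} \<Longrightarrow> den (psubst y m P) \<mu> = den P (\<mu>(y \<mapsto> msubst \<mu> m))"
proof (induction P arbitrary: \<mu>)
  case (PIn c x P)
  have m: "msubst (\<mu>(x \<mapsto> v)) m = msubst \<mu> m" for v
    using PIn by (intro msubst_upd_fresh) auto
  show ?case
  proof (cases "x = y")
    case False
    have "den (psubst y m P) (\<mu>(x \<mapsto> v)) = den P (\<mu>(y \<mapsto> msubst \<mu> m, x \<mapsto> v))" for v
    proof -
      have "fv m \<inter> vars_proc P = {}" using PIn.prems by auto
      then have "den (psubst y m P) (\<mu>(x \<mapsto> v)) = den P (\<mu>(x \<mapsto> v, y \<mapsto> msubst (\<mu>(x \<mapsto> v)) m))"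
        by (rule PIn.IH)
      then show ?thesis unfolding m by (simp only: fun_upd_twist[OF False])
    qed
    then show ?thesis unfolding psubst.simps den.simps by (simp only: False if_False)
  next
    case True
    \<comment> \<open>The binder shadows \<open>y\<close>: its update overwrites the one that stems
      from the substitution.\<close>
    then show ?thesis by (simp only: den.simps psubst.simps fun_upd_upd if_True simp_thms)
  qed
next
  case (PIf u v P Q)
  then have "fv m \<inter> vars_proc P = {}" "fv m \<inter> vars_proc Q = {}" by auto
  then show ?case by (simp only: PIf.IH psubst.simps den.simps msubst_msubst_single)
next
  case (POut c u P)
  then have "fv m \<inter> vars_proc P = {}" by auto
  then show ?case by (simp only: POut.IH psubst.simps den.simps msubst_msubst_single)
qed auto

text \<open>Reconciles two views of an input: a process receives an actual message, a tree receives
  its representative.\<close>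

lemma den_canon:
  assumes "basic_on c P" "v \<in> messages" "\<And>x. fo_val \<mu> x \<in> messages"
  shows "den P (\<mu>(x \<mapsto> canon v)) = den P (\<mu>(x \<mapsto> v))"
  by (rule den_cong[OF assms(1)]) (auto simp: fo_val_upd canon_eqE eqE_refl assms)

lemma basic_on_psubst:
  "basic_on c P \<Longrightarrow> m \<in> messages \<Longrightarrow> basic_on c (psubst y m P)"
proof (induction rule: basic_on.induct)
  case (2 u v P Q)
  then show ?case by (auto intro!: basic_on.intros msubst_messages simp: fo_val_def)
next
  case (4 u P)
  then show ?case by (auto intro!: basic_on.intros msubst_messages simp: fo_val_def)
qed (auto intro: basic_on.intros)

section \<open>Values of recipes and static equivalence of frames of values\<close>

definition recipe_val :: "('f, 'n, 'x, 'w) frame \<Rightarrow> ('f, 'w) recipe \<Rightarrow> ('f, 'n, 'x) msg" where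
  "recipe_val F M = canon (recipe_msg F M)"

definition val_frame :: "('f, 'n, 'x, 'w) frame \<Rightarrow> ('f, 'n, 'x, 'w) frame" where
  "val_frame \<Phi> = map_option canon \<circ> \<Phi>"

lemma dom_val_frame [simp]: "dom (val_frame \<Phi>) = dom \<Phi>"
  by (auto simp: val_frame_def)

lemma val_frame_upd: "val_frame (\<Phi>(w \<mapsto> u)) = (val_frame \<Phi>)(w \<mapsto> canon u)"
  by (auto simp: val_frame_def)

lemma recipe_msg_messages:
  "ran \<Phi> \<subseteq> messages \<Longrightarrow> M \<in> terms Sig (dom \<Phi>) \<Longrightarrow> recipe_msg \<Phi> M \<in> messages"
  unfolding recipe_msg_def messages_def by (erule subst_terms) (auto simp: ran_def)

lemma recipe_msg_ground:
  "ran \<Phi> \<subseteq> ground_messages \<Longrightarrow> M \<in> terms Sig (dom \<Phi>) \<Longrightarrow> recipe_msg \<Phi> M \<in> ground_messages"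
  unfolding recipe_msg_def ground_messages_def by (erule subst_terms) (auto simp: ran_def)

text \<open>Taking representatives inside the frame changes a recipe only up to
  \<open>=\<^sub>E\<close>, which the outer \<open>canon\<close> absorbs.\<close>

lemma recipe_val_val_frame:
  assumes "ran \<Phi> \<subseteq> messages" "M \<in> terms Sig (dom \<Phi>)"
  shows "recipe_val (val_frame \<Phi>) M = canon (recipe_msg \<Phi> M)"
  unfolding recipe_val_def recipe_msg_def
proof (rule canon_cong, rule subst_eqE[OF assms(2)])
  fix w assume "w \<in> dom \<Phi>"
  then obtain u where "\<Phi> w = Some u" "u \<in> messages" using assms(1) by (auto simp: ran_def)
  then show "the (val_frame \<Phi> w) =\<^sub>E the (\<Phi> w)" by (simp add: val_frame_def canon_eqE)
qed

lemma recipe_msg_mono: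
  "M \<in> terms Sig (dom F) \<Longrightarrow> F \<subseteq>\<^sub>m F' \<Longrightarrow> recipe_msg F' M = recipe_msg F M"
  unfolding recipe_msg_def
  by (rule subst_cong_atoms) (metis atoms_terms map_le_def subsetD)

lemma recipe_val_mono:
  "M \<in> terms Sig (dom F) \<Longrightarrow> F \<subseteq>\<^sub>m F' \<Longrightarrow> recipe_val F' M = recipe_val F M"
  unfolding recipe_val_def using recipe_msg_mono[of M F F'] by simp

definition aeq :: "('f, 'n, 'x, 'w) frame \<Rightarrow> ('f, 'n, 'x, 'w) frame \<Rightarrow> bool" where
  "aeq F F' \<longleftrightarrow> dom F = dom F' \<and> (\<forall>M \<in> terms Sig (dom F). \<forall>N \<in> terms Sig (dom F).
     recipe_val F M = recipe_val F N \<longleftrightarrow> recipe_val F' M = recipe_val F' N)"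

lemma static_eq_iff_aeq:
  assumes "ran \<Phi> \<subseteq> messages" "ran \<Psi> \<subseteq> messages"
  shows "\<Phi> \<sim> \<Psi> \<longleftrightarrow> aeq (val_frame \<Phi>) (val_frame \<Psi>)"
proof (cases "dom \<Phi> = dom \<Psi>")
  case True
  have eq: "recipe_msg \<Phi> M =\<^sub>E recipe_msg \<Phi> N \<longleftrightarrow>
      recipe_val (val_frame \<Phi>) M = recipe_val (val_frame \<Phi>) N"
    if "ran \<Phi> \<subseteq> messages" "M \<in> terms Sig (dom \<Phi>)" "N \<in> terms Sig (dom \<Phi>)"
    for \<Phi> :: "('f, 'n, 'x, 'w) frame" and M N
    using that by (simp add: recipe_val_val_frame canon_eq_iff recipe_msg_messages)
  then show ?thesis unfolding static_eq_def aeq_def using True eq[OF assms(1)] eq[OF assms(2)] by simp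
qed (auto simp: static_eq_def aeq_def)

text \<open>Recipes over the smaller domain keep their values when the frame grows, so static
  equivalence passes to earlier frames. This allows a trace to be extended first and cut back at the
  end.\<close>

lemma aeq_restrict:
  assumes "aeq F F'" "F1 \<subseteq>\<^sub>m F" "F1' \<subseteq>\<^sub>m F'" "dom F1 = dom F1'"
  shows "aeq F1 F1'"
proof -
  have "dom F1 \<subseteq> dom F" using assms(2) by (rule map_le_implies_dom_le)
  then have "M \<in> terms Sig (dom F)" if "M \<in> terms Sig (dom F1)" for M
    using that terms_mono by blast
  then show ?thesis
    using assms(1,4) unfolding aeq_def
    by (simp add: recipe_val_mono[OF _ assms(2), symmetric] recipe_val_mono[OF _ assms(3), symmetric])
qed

end

section \<open>Runs of blocks\<close>

text \<open>The list holds the entries of a frame at the output handles, hence the options: each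
  output has to send exactly the value that the frame stores.\<close>

primrec beh_send :: "'v beh \<Rightarrow> 'v option list \<Rightarrow> 'v beh option" where
  "beh_send b [] = Some b"
| "beh_send b (r # rs) =
     (case b of Send v b' \<Rightarrow> if r = Some v then beh_send b' rs else None | _ \<Rightarrow> None)"

definition run_part :: "'v list \<Rightarrow> 'v option list \<Rightarrow> 'v beh \<Rightarrow> 'v beh option" where
  "run_part vs rs b = Option.bind (beh_ins b vs) (\<lambda>b'. beh_send b' rs)"

text \<open>The counterpart of a proper block of the compressed semantics, whereas
  \<open>run_part\<close> stands for arbitrary actions on a channel. Improper blocks are left out
  because they end the whole process and not only their channel.\<close>

definition run_max :: "'v list \<Rightarrow> 'v option list \<Rightarrow> 'v beh \<Rightarrow> 'v beh option" where
  "run_max vs rs b = Option.bind (beh_ins b vs) (\<lambda>b'.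
     if vs \<noteq> [] \<and> rs \<noteq> [] \<and> rs = map Some (fst (beh_outs b')) then Some (snd (beh_outs b')) else None)"

text \<open>The length is all that a block prescribes about its output values: the handles are
  chosen, the values are imposed by the tree.\<close>

definition deterministic :: "('v list \<Rightarrow> 'v option list \<Rightarrow> 'v beh \<Rightarrow> 'v beh option) \<Rightarrow> bool" where
  "deterministic L \<longleftrightarrow> (\<forall>vs rs rs' b x y. L vs rs b = Some x \<longrightarrow> L vs rs' b = Some y \<longrightarrow>
     length rs = length rs' \<longrightarrow> rs = rs' \<and> x = y)"

lemma beh_send_Cons_Some:
  "beh_send b (r # rs) = Some x \<longleftrightarrow> (\<exists>v b'. b = Send v b' \<and> r = Some v \<and> beh_send b' rs = Some x)"
  by (auto split: beh.splits if_splits)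

lemma beh_ins_Cons_Some:
  "beh_ins b (v # vs) = Some x \<longleftrightarrow> (\<exists>k. b = Recv k \<and> beh_ins (k v) vs = Some x)"
  by (auto split: beh.splits)

lemma beh_send_deterministic:
  "beh_send b rs = Some x \<Longrightarrow> beh_send b rs' = Some y \<Longrightarrow> length rs = length rs' \<Longrightarrow> rs = rs' \<and> x = y"
proof (induction rs arbitrary: b rs')
  case (Cons r rs)
  then obtain r' rs'' where "rs' = r' # rs''" by (cases rs') auto
  with Cons show ?case by (auto simp: beh_send_Cons_Some simp del: beh_send.simps(2))
qed auto

lemma beh_send_outs: "beh_send b (map Some (fst (beh_outs b))) = Some (snd (beh_outs b))"
  by (induction b rule: beh_outs.induct) auto

lemma beh_send_maximal:
  "beh_send b rs = Some x \<Longrightarrow> \<not> is_Send x \<Longrightarrow> rs = map Some (fst (beh_outs b)) \<and> x = snd (beh_outs b)"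
proof (induction rs arbitrary: b)
  case Nil
  then show ?case by (cases b) auto
next
  case (Cons r rs)
  then show ?case by (auto simp: beh_send_Cons_Some simp del: beh_send.simps(2))
qed

lemma deterministic_run_part: "deterministic run_part"
  unfolding deterministic_def run_part_def bind_eq_Some_conv
  by (metis beh_send_deterministic option.inject)

lemma deterministic_run_max: "deterministic run_max"
  by (auto simp: deterministic_def run_max_def bind_eq_Some_conv split: if_splits)

lemma run_max_Some:
  "run_max vs rs b = Some x \<longleftrightarrow> (\<exists>b'. beh_ins b vs = Some b' \<and> vs \<noteq> [] \<and> rs \<noteq> [] \<and>
     rs = map Some (fst (beh_outs b')) \<and> x = snd (beh_outs b'))"
  by (auto simp: run_max_def bind_eq_Some_conv)

lemma run_part_Some:
  "run_part vs rs b = Some x \<longleftrightarrow> (\<exists>b'. beh_ins b vs = Some b' \<and> beh_send b' rs = Some x)"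
  by (auto simp: run_part_def bind_eq_Some_conv)

lemma run_max_imp_run_part: "run_max vs rs b = Some x \<Longrightarrow> run_part vs rs b = Some x"
  using beh_send_outs by (fastforce simp: run_max_Some run_part_Some)

section \<open>Sequences of blocks, their projections and their single actions\<close>

definition bouts :: "('c, 'r, 'w) block list \<Rightarrow> 'w set" where
  "bouts bl = (\<Union>B \<in> set bl. set (outputs B))"

definition bproj :: "'c \<Rightarrow> ('c, 'r, 'w) block list \<Rightarrow> ('c, 'r, 'w) block list" where
  "bproj c = filter (\<lambda>B. chan B = c)"

lemma bouts_simps [simp]:
  "bouts [] = {}" "bouts (B # bl) = set (outputs B) \<union> bouts bl" "bouts (bl @ bl') = bouts bl \<union> bouts bl'"
  by (auto simp: bouts_def)

lemma bproj_simps [simp]: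
  "bproj c [] = []" "bproj c (B # bl) = (if chan B = c then B # bproj c bl else bproj c bl)"
  "bproj c (bl @ bl') = bproj c bl @ bproj c bl'"
  by (auto simp: bproj_def)

lemma bproj_empty_iff: "bproj c bl = [] \<longleftrightarrow> c \<notin> chan ` set bl"
  by (auto simp: bproj_def filter_empty_conv)

lemma set_bproj: "set (bproj c bl) \<subseteq> set bl"
  by (auto simp: bproj_def)

primrec single_block :: "('c, 'r, 'w) act \<Rightarrow> ('c, 'r, 'w) block" where
  "single_block (Inp c M) = Block c [M] []"
| "single_block (Outp c w) = Block c [] [w]"
| "single_block Tau = undefined"

text \<open>Single actions are regarded as small blocks, so that concrete traces and sequences of
  blocks share one notion of run.\<close>

definition flat :: "('c, 'r, 'w) block list \<Rightarrow> ('c, 'r, 'w) block list" where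
  "flat bl = map single_block (concat (map io bl))"

lemma flat_simps [simp]:
  "flat [] = []" "flat (B # bl) = map single_block (io B) @ flat bl" "flat (bl @ bl') = flat bl @ flat bl'"
  by (auto simp: flat_def)

lemma bproj_io: "bproj c (map single_block (io B)) = (if chan B = c then map single_block (io B) else [])"
  by (cases B) (auto simp: bproj_def filter_empty_conv filter_id_conv)

lemma bproj_flat: "bproj c (flat bl) = flat (bproj c bl)"
  by (induction bl) (auto simp: bproj_io)

lemma bouts_io: "bouts (map single_block (io B)) = set (outputs B)"
  by (cases B) (auto simp: bouts_def)

lemma bouts_flat [simp]: "bouts (flat bl) = bouts bl"
  by (induction bl) (auto simp: bouts_io)

section \<open>Runs relative to a frame of values\<close>

context equational_setting
begin

text \<open>The only condition of a run that links different channels.\<close>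

primrec bscoped :: "'w set \<Rightarrow> ('c, ('f, 'w) recipe, 'w) block list \<Rightarrow> bool" where
  "bscoped D [] \<longleftrightarrow> True"
| "bscoped D (B # bl) \<longleftrightarrow> set (inputs B) \<subseteq> terms Sig D \<and> distinct (outputs B) \<and>
     set (outputs B) \<inter> D = {} \<and> bscoped (D \<union> set (outputs B)) bl"

lemma bscoped_append: "bscoped D (bl @ bl') \<longleftrightarrow> bscoped D bl \<and> bscoped (D \<union> bouts bl) bl'"
  by (induction bl arbitrary: D) (auto simp: Un_assoc)

lemma bscoped_inputs: "bscoped D bl \<Longrightarrow> B \<in> set bl \<Longrightarrow> set (inputs B) \<subseteq> terms Sig (D \<union> bouts bl)"
proof (induction bl arbitrary: D)
  case (Cons B' bl)
  then show ?case using terms_mono[of _ Sig D "D \<union> bouts (B' # bl)"] by (fastforce simp: Un_assoc)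
qed auto

lemma bscoped_disjoint: "bscoped D bl \<Longrightarrow> D \<inter> bouts bl = {}"
  by (induction bl arbitrary: D) auto

lemma bscoped_Inps:
  "bscoped D (map single_block (map (Inp c) Ms)) \<longleftrightarrow> set Ms \<subseteq> terms Sig D"
  by (induction Ms) auto

lemma bscoped_Outps:
  "bscoped D (map single_block (map (Outp c) ws)) \<longleftrightarrow> distinct ws \<and> set ws \<inter> D = {}"
  by (induction ws arbitrary: D) auto

lemma bscoped_flat: "bscoped D (flat bl) \<longleftrightarrow> bscoped D bl"
proof (induction bl arbitrary: D)
  case (Cons B bl)
  have "bscoped D (map single_block (io B)) \<longleftrightarrow>
      set (inputs B) \<subseteq> terms Sig D \<and> distinct (outputs B) \<and> set (outputs B) \<inter> D = {}"
    by (cases B) (auto simp: bscoped_append bscoped_Inps bscoped_Outps bouts_def simp del: map_map)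
  with Cons show ?case by (auto simp: bscoped_append bouts_io)
qed simp

text \<open>All recipes are evaluated in a single frame, meant to be the final one. As frames only
  grow, the values are those of the intermediate frames, and channels can be run separately.\<close>

primrec lrun :: "(('f, 'n, 'x) msg list \<Rightarrow> ('f, 'n, 'x) msg option list \<Rightarrow> ('f, 'n, 'x) msg beh \<Rightarrow>
      ('f, 'n, 'x) msg beh option) \<Rightarrow> ('f, 'n, 'x, 'w) frame \<Rightarrow> ('c, ('f, 'w) recipe, 'w) block list \<Rightarrow>
      ('f, 'n, 'x) msg beh \<Rightarrow> ('f, 'n, 'x) msg beh option" where
  "lrun L F [] b = Some b"
| "lrun L F (B # bl) b =
     Option.bind (L (map (recipe_val F) (inputs B)) (map F (outputs B)) b) (lrun L F bl)"

lemma lrun_append: "lrun L F (bl @ bl') b = Option.bind (lrun L F bl b) (lrun L F bl')"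
  by (induction bl arbitrary: b) (auto split: bind_split)

lemma lrun_Nil [simp]: "lrun L F [] = Some"
  by (intro ext) simp

lemma lrun_mono:
  assumes "F \<subseteq>\<^sub>m F'" "\<And>B. B \<in> set bl \<Longrightarrow> set (inputs B) \<subseteq> terms Sig (dom F)" "bouts bl \<subseteq> dom F"
  shows "lrun L F' bl b = lrun L F bl b"
  using assms(2,3)
proof (induction bl arbitrary: b)
  case (Cons B bl)
  have "map (recipe_val F') (inputs B) = map (recipe_val F) (inputs B)"
    using Cons.prems(1)[of B] recipe_val_mono[OF _ assms(1)] by auto
  moreover have "map F' (outputs B) = map F (outputs B)"
  proof (rule map_cong[OF refl])
    fix w assume "w \<in> set (outputs B)"
    then have "w \<in> dom F" using Cons.prems(2) by (simp add: subset_iff)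
    then show "F' w = F w" using assms(1) by (simp add: map_le_def)
  qed
  moreover have "lrun L F' bl = lrun L F bl" using Cons by (intro ext) auto
  ultimately show ?case by (simp only: lrun.simps)
qed simp

lemma lrun_Inps:
  "lrun run_part F (map single_block (map (Inp c) Ms)) b = beh_ins b (map (recipe_val F) Ms)"
  by (induction Ms arbitrary: b) (auto simp: run_part_def split: beh.splits)

lemma lrun_Outps:
  "lrun run_part F (map single_block (map (Outp c) ws)) b = beh_send b (map F ws)"
  by (induction ws arbitrary: b) (auto simp: run_part_def split: beh.splits)

lemma lrun_io:
  "lrun run_part F (map single_block (io B)) b =
     run_part (map (recipe_val F) (inputs B)) (map F (outputs B)) b"
  by (cases B) (auto simp: lrun_append lrun_Inps lrun_Outps run_part_def simp del: map_map
      split: bind_split)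

lemma lrun_flat: "lrun run_part F (flat bl) b = lrun run_part F bl b"
  by (induction bl arbitrary: b) (auto simp: lrun_append lrun_io split: bind_split)

lemma lrun_max_imp_part: "lrun run_max F bl b = Some x \<Longrightarrow> lrun run_part F bl b = Some x"
  by (induction bl arbitrary: b) (auto simp: bind_eq_Some_conv dest!: run_max_imp_run_part)

lemma lrun_max_not_Send: "lrun run_max F bl b = Some x \<Longrightarrow> \<not> is_Send b \<Longrightarrow> \<not> is_Send x"
proof (induction bl arbitrary: b)
  case (Cons B bl)
  then show ?case using beh_outs_not_Send by (fastforce simp: bind_eq_Some_conv run_max_Some)
qed simp

lemma lrun_max_nonempty:
  "lrun run_max F bl b = Some x \<Longrightarrow> B \<in> set bl \<Longrightarrow> inputs B \<noteq> [] \<and> outputs B \<noteq> []"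
  by (induction bl arbitrary: b) (auto simp: bind_eq_Some_conv run_max_Some)

text \<open>A block starts with an input, so the state before it is not sending and the preceding
  block has exhausted its outputs. For the last block the assumption on \<open>x\<close> plays the
  same part.\<close>

lemma lrun_part_imp_max:
  "lrun run_part F bl b = Some x \<Longrightarrow> \<not> is_Send x \<Longrightarrow>
   (\<And>B. B \<in> set bl \<Longrightarrow> inputs B \<noteq> [] \<and> outputs B \<noteq> []) \<Longrightarrow> lrun run_max F bl b = Some x"
proof (induction bl arbitrary: b)
  case (Cons B bl)
  from Cons.prems(1) obtain b' b1 where b':
    "beh_ins b (map (recipe_val F) (inputs B)) = Some b'" "beh_send b' (map F (outputs B)) = Some b1"
    "lrun run_part F bl b1 = Some x"
    by (auto simp: bind_eq_Some_conv run_part_Some)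
  have "\<not> is_Send b1"
  proof (cases bl)
    case (Cons B' bl')
    then obtain M Ms where "inputs B' = M # Ms"
      using Cons.prems(3)[of B'] by (auto simp: neq_Nil_conv)
    with b'(3) Cons show ?thesis
      by (auto simp: bind_eq_Some_conv run_part_Some beh_ins_Cons_Some simp del: beh_ins.simps(2))
  qed (use b' Cons.prems in auto)
  then have "run_max (map (recipe_val F) (inputs B)) (map F (outputs B)) b = Some b1"
    using beh_send_maximal[OF b'(2)] b'(1) Cons.prems(3)[of B] by (auto simp: run_max_Some)
  with Cons.IH[OF b'(3)] Cons.prems show ?case by simp
qed simp

text \<open>Stated through projections rather than by induction on the sequence: invariance under
  reordering is then immediate, and \<open>grun_snoc\<close> recovers the reading step by
  step.\<close>

definition grun where
  "grun L s0 bl s \<longleftrightarrow> bscoped (dom (snd s0)) bl \<and> snd s0 \<subseteq>\<^sub>m snd s \<and>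
     dom (snd s) = dom (snd s0) \<union> bouts bl \<and>
     (\<forall>c. lrun L (snd s) (bproj c bl) (fst s0 c) = Some (fst s c))"

definition gstep where
  "gstep L s B s' \<longleftrightarrow> set (inputs B) \<subseteq> terms Sig (dom (snd s)) \<and> distinct (outputs B) \<and>
     set (outputs B) \<inter> dom (snd s) = {} \<and> snd s \<subseteq>\<^sub>m snd s' \<and>
     dom (snd s') = dom (snd s) \<union> set (outputs B) \<and>
     (\<exists>b. L (map (recipe_val (snd s)) (inputs B)) (map (snd s') (outputs B)) (fst s (chan B)) = Some b \<and>
        fst s' = (fst s)(chan B := b))"

lemma grun_Nil: "grun L s0 [] s \<longleftrightarrow> s = s0"
proof
  assume r: "grun L s0 [] s"
  then have le: "snd s0 \<subseteq>\<^sub>m snd s" and "dom (snd s) = dom (snd s0)" and f: "fst s = fst s0"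
    by (auto simp: grun_def)
  then have "snd s \<subseteq>\<^sub>m snd s0" by (simp add: map_le_def)
  with le f show "s = s0" by (simp add: prod_eq_iff map_le_antisym)
qed (simp add: grun_def)

lemma gstep_recipe_val:
  "gstep L s B s' \<Longrightarrow> map (recipe_val (snd s')) (inputs B) = map (recipe_val (snd s)) (inputs B)"
proof (rule map_cong[OF refl])
  fix M assume "gstep L s B s'" "M \<in> set (inputs B)"
  then show "recipe_val (snd s') M = recipe_val (snd s) M"
    by (intro recipe_val_mono) (auto simp: gstep_def)
qed

lemma grun_snoc: "grun L s0 (bl @ [B]) s' \<longleftrightarrow> (\<exists>s. grun L s0 bl s \<and> gstep L s B s')"
proof
  assume r: "grun L s0 (bl @ [B]) s'"
  \<comment> \<open>The frame before \<open>B\<close> is the final frame without the outputs of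
    \<open>B\<close>.\<close>
  define F where "F = snd s' |` (dom (snd s0) \<union> bouts bl)"
  have FF: "F \<subseteq>\<^sub>m snd s'" by (auto simp: F_def map_le_def)
  have domF: "dom F = dom (snd s0) \<union> bouts bl" using r by (auto simp: F_def grun_def)
  have sc: "bscoped (dom (snd s0)) bl" using r by (simp add: grun_def bscoped_append)
  have l: "lrun L (snd s') (bproj c bl) b = lrun L F (bproj c bl) b" for c b
    by (rule lrun_mono[OF FF])
       (use bscoped_inputs[OF sc] set_bproj[of c bl] in \<open>auto simp: domF bouts_def\<close>)
  define \<beta> where "\<beta> = (\<lambda>c. the (lrun L F (bproj c bl) (fst s0 c)))"
  have b: "lrun L F (bproj c bl) (fst s0 c) = Some (\<beta> c)" for c
  proof -
    have "lrun L (snd s') (bproj c (bl @ [B])) (fst s0 c) = Some (fst s' c)"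
      using r by (simp only: grun_def)
    then show ?thesis by (auto simp: lrun_append bind_eq_Some_conv l \<beta>_def)
  qed
  have g: "grun L s0 bl (\<beta>, F)"
    using r sc domF b by (auto simp: grun_def F_def map_le_def)
  moreover have "gstep L (\<beta>, F) B s'"
  proof -
    have i: "set (inputs B) \<subseteq> terms Sig (dom F)"
      using r by (simp add: grun_def bscoped_append domF)
    have rv: "map (recipe_val (snd s')) (inputs B) = map (recipe_val F) (inputs B)"
      using i recipe_val_mono[OF _ FF] by auto
    have "lrun L (snd s') (bproj c (bl @ [B])) (fst s0 c) = Some (fst s' c)" for c
      using r by (simp only: grun_def)
    then have s': "lrun L (snd s') (bproj c [B]) (\<beta> c) = Some (fst s' c)" for c
      by (simp add: lrun_append l b)
    then have "L (map (recipe_val F) (inputs B)) (map (snd s') (outputs B)) (\<beta> (chan B)) = Some (fst s' (chan B))"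
      using s'[of "chan B"] by (simp add: rv del: map_eq_conv)
    moreover have "fst s' = \<beta>(chan B := fst s' (chan B))"
    proof
      show "fst s' c = (\<beta>(chan B := fst s' (chan B))) c" for c using s'[of c] by auto
    qed
    moreover have "distinct (outputs B)" "set (outputs B) \<inter> dom F = {}" "dom (snd s') = dom F \<union> set (outputs B)"
      using r by (auto simp: grun_def bscoped_append domF)
    ultimately show ?thesis using i FF unfolding gstep_def fst_conv snd_conv by blast
  qed
  ultimately show "\<exists>s. grun L s0 bl s \<and> gstep L s B s'" by blast
next
  assume "\<exists>s. grun L s0 bl s \<and> gstep L s B s'"
  then obtain s where g: "grun L s0 bl s" and st: "gstep L s B s'" by blast
  have sc: "bscoped (dom (snd s0)) bl" and domF: "dom (snd s) = dom (snd s0) \<union> bouts bl"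
    using g by (auto simp: grun_def)
  have FF: "snd s \<subseteq>\<^sub>m snd s'" using st by (simp add: gstep_def)
  have l: "lrun L (snd s') (bproj c bl) b = lrun L (snd s) (bproj c bl) b" for c b
    by (rule lrun_mono[OF FF])
       (use bscoped_inputs[OF sc] set_bproj[of c bl] in \<open>auto simp: domF bouts_def\<close>)
  have lb: "lrun L (snd s) (bproj c bl) (fst s0 c) = Some (fst s c)" for c
    using g by (simp only: grun_def)
  have "lrun L (snd s') (bproj c (bl @ [B])) (fst s0 c) = Some (fst s' c)" for c
    using st gstep_recipe_val[OF st]
    by (auto simp: lrun_append l lb gstep_def simp del: map_eq_conv)
  moreover have "bscoped (dom (snd s0)) (bl @ [B])"
    using st sc by (simp add: bscoped_append gstep_def domF)
  moreover have "snd s0 \<subseteq>\<^sub>m snd s'" using g FF map_le_trans by (auto simp: grun_def)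
  moreover have "dom (snd s') = dom (snd s0) \<union> bouts (bl @ [B])"
    using st domF by (auto simp: gstep_def)
  ultimately show "grun L s0 (bl @ [B]) s'" unfolding grun_def by blast
qed

text \<open>Both successors extend the same frame by the same handles, and \<open>L\<close> fixes
  the values stored there.\<close>

lemma gstep_deterministic:
  assumes "deterministic L" "gstep L s B s1" "gstep L s B s2"
  shows "s1 = s2"
proof -
  from assms(2,3) obtain b1 b2 where b:
    "L (map (recipe_val (snd s)) (inputs B)) (map (snd s1) (outputs B)) (fst s (chan B)) = Some b1"
    "fst s1 = (fst s)(chan B := b1)"
    "L (map (recipe_val (snd s)) (inputs B)) (map (snd s2) (outputs B)) (fst s (chan B)) = Some b2"
    "fst s2 = (fst s)(chan B := b2)"
    by (auto simp: gstep_def)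
  then have o: "map (snd s1) (outputs B) = map (snd s2) (outputs B)" "b1 = b2"
    using assms(1) unfolding deterministic_def by (metis length_map)+
  have "snd s1 w = snd s2 w" for w
  proof (cases "w \<in> dom (snd s)")
    case True
    then show ?thesis using assms(2,3) by (auto simp: gstep_def map_le_def)
  next
    case False
    show ?thesis
    proof (cases "w \<in> set (outputs B)")
      case True
      then show ?thesis using o by simp
    next
      case w: False
      then have "w \<notin> dom (snd s1)" "w \<notin> dom (snd s2)" using assms(2,3) False by (auto simp: gstep_def)
      then show ?thesis by (simp add: domIff)
    qed
  qed
  then have "snd s1 = snd s2" by (rule ext)
  then show ?thesis using b o by (simp add: prod_eq_iff)
qed

lemma grun_deterministic:
  "deterministic L \<Longrightarrow> grun L s0 bl s1 \<Longrightarrow> grun L s0 bl s2 \<Longrightarrow> s1 = s2"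
proof (induction bl arbitrary: s1 s2 rule: rev_induct)
  case (snoc B bl)
  from snoc.prems obtain t1 t2 where "grun L s0 bl t1" "gstep L t1 B s1"
    "grun L s0 bl t2" "gstep L t2 B s2"
    by (auto simp only: grun_snoc)
  with snoc.IH[OF snoc.prems(1), of t1 t2] gstep_deterministic[OF snoc.prems(1), of t1 B s1 s2]
  show ?case by simp
qed (simp add: grun_Nil)

text \<open>Serves to return from an extended trace to the original one, and to drop final blocks
  while the state of an unaffected channel is kept.\<close>

lemma grun_append:
  "grun L s0 (bl @ bl') s' \<Longrightarrow> \<exists>s. grun L s0 bl s \<and> snd s \<subseteq>\<^sub>m snd s' \<and>
     (\<forall>c. bproj c bl' = [] \<longrightarrow> fst s c = fst s' c)"
proof (induction bl' arbitrary: s' rule: rev_induct)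
  case (snoc B bl')
  have "grun L s0 ((bl @ bl') @ [B]) s'" using snoc.prems by simp
  then obtain s1 where "grun L s0 (bl @ bl') s1" and s1: "snd s1 \<subseteq>\<^sub>m snd s'"
    and c: "\<And>c. c \<noteq> chan B \<Longrightarrow> fst s1 c = fst s' c"
    unfolding grun_snoc by (auto simp: gstep_def)
  then obtain s where s: "grun L s0 bl s" "snd s \<subseteq>\<^sub>m snd s1"
    "\<And>c. bproj c bl' = [] \<Longrightarrow> fst s c = fst s1 c" using snoc.IH by blast
  have "fst s d = fst s' d" if "bproj d (bl' @ [B]) = []" for d
    using that s(3)[of d] c[of d] by (auto split: if_splits)
  with s s1 show ?case using map_le_trans[of "snd s" "snd s1" "snd s'"] by blast
next
  case Nil
  then show ?case by (intro exI[of _ s']) simp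
qed

lemma grun_flat: "grun run_part s0 (flat bl) s \<longleftrightarrow> grun run_part s0 bl s"
  by (simp add: grun_def bscoped_flat bproj_flat lrun_flat)

lemma grun_max_imp_part: "grun run_max s0 bl s \<Longrightarrow> grun run_part s0 bl s"
  unfolding grun_def using lrun_max_imp_part by blast

lemma grun_frame_agree:
  assumes "grun L s0 (bl @ bl') s'" "grun L s0 bl s" "deterministic L"
  shows "snd s \<subseteq>\<^sub>m snd s'"
  using grun_append[OF assms(1)] grun_deterministic[OF assms(3,2)] by blast

text \<open>The second disjunct is a run whose last block is improper; it has no outputs, so it leaves the
  frame unchanged.\<close>

definition frun where
  "frun s0 bl F \<longleftrightarrow> (\<exists>\<beta>. grun run_max s0 bl (\<beta>, F)) \<or>
     (\<exists>bl' c Ms \<beta>. bl = bl' @ [Block c Ms []] \<and> Ms \<noteq> [] \<and> set Ms \<subseteq> terms Sig (dom F) \<and>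
        grun run_max s0 bl' (\<beta>, F) \<and> beh_ins (\<beta> c) (map (recipe_val F) Ms) = Some Stop)"

text \<open>The first-order satisfaction of the dependency constraints, in terms of values.\<close>

definition depok ::
    "'w set \<Rightarrow> ('f, 'n, 'x, 'w) frame \<Rightarrow> ('c :: linorder, ('f, 'w) recipe, 'w) block list \<Rightarrow> bool" where
  "depok D F bl \<longleftrightarrow> (\<forall>p B r. bl = p @ B # r \<longrightarrow> dep p (chan B) \<noteq> {} \<longrightarrow>
     (\<exists>N \<in> set (inputs B). \<forall>M \<in> terms Sig (D \<union> bouts p).
        recipe_val F M = recipe_val F N \<longrightarrow> atoms M \<inter> dep p (chan B) \<noteq> {}))"

text \<open>Corresponds to \<open>trace_incl\<close>, while \<open>max_incl\<close> corresponds to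
  \<open>reduced_incl1\<close>; the theorem becomes a comparison of these two relations on
  states.\<close>

definition part_incl where
  "part_incl sA sB \<longleftrightarrow> (\<forall>bl s. grun run_part sA bl s \<longrightarrow>
     (\<exists>s'. grun run_part sB bl s' \<and> aeq (snd s) (snd s')))"

definition max_incl ::
    "('c :: linorder \<Rightarrow> ('f, 'n, 'x) msg beh) \<times> ('f, 'n, 'x, 'w) frame \<Rightarrow>
     ('c \<Rightarrow> ('f, 'n, 'x) msg beh) \<times> ('f, 'n, 'x, 'w) frame \<Rightarrow> bool" where
  "max_incl sA sB \<longleftrightarrow> (\<forall>bl F. frun sA bl F \<and> depok (dom (snd sA)) F bl \<longrightarrow>
     (\<exists>F'. frun sB bl F' \<and> depok (dom (snd sB)) F' bl \<and> aeq F F'))"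

lemma grun_dom: "grun L s0 bl s \<Longrightarrow> dom (snd s) = dom (snd s0) \<union> bouts bl"
  by (simp add: grun_def)

text \<open>Outputs are fresh, so the initial handles can be read off the final frame. Statically
  equivalent final frames thus force equal initial domains.\<close>

lemma grun_dom0: "grun L s0 bl s \<Longrightarrow> dom (snd s0) = dom (snd s) - bouts bl"
  using bscoped_disjoint[of "dom (snd s0)" bl] by (auto simp: grun_def)

text \<open>A constraint speaks about all recipes with a given value, so it survives whenever
  \<open>F'\<close> identifies no more recipes than \<open>F\<close>.\<close>

lemma depok_transfer:
  assumes "depok D F bl" "bscoped D bl"
    and eq: "\<And>M N. M \<in> terms Sig (D \<union> bouts bl) \<Longrightarrow> N \<in> terms Sig (D \<union> bouts bl) \<Longrightarrow>
      recipe_val F' M = recipe_val F' N \<Longrightarrow> recipe_val F M = recipe_val F N"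
  shows "depok D F' bl"
  unfolding depok_def
proof (intro allI impI)
  fix p B r assume bl: "bl = p @ B # r" and "dep p (chan B) \<noteq> {}"
  then obtain N where N: "N \<in> set (inputs B)"
    "\<forall>M \<in> terms Sig (D \<union> bouts p). recipe_val F M = recipe_val F N \<longrightarrow> atoms M \<inter> dep p (chan B) \<noteq> {}"
    using assms(1) unfolding depok_def by blast
  have sub: "M \<in> terms Sig (D \<union> bouts bl)" if "M \<in> terms Sig (D \<union> bouts p)" for M
    using terms_mono[OF that, of "D \<union> bouts bl"] by (auto simp: bl)
  have "N \<in> terms Sig (D \<union> bouts p)" using assms(2) N(1) by (auto simp: bl bscoped_append)
  then have "recipe_val F M = recipe_val F N"
    if "M \<in> terms Sig (D \<union> bouts p)" "recipe_val F' M = recipe_val F' N" for M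
    using that sub eq by blast
  with N show "\<exists>N \<in> set (inputs B). \<forall>M \<in> terms Sig (D \<union> bouts p).
        recipe_val F' M = recipe_val F' N \<longrightarrow> atoms M \<inter> dep p (chan B) \<noteq> {}"
    by blast
qed


lemma map_le_dom_eq: "F \<subseteq>\<^sub>m F' \<Longrightarrow> dom F' = dom F \<Longrightarrow> F' = F"
  by (rule map_le_antisym) (auto simp: map_le_def)

section \<open>From inclusion of traces to inclusion of maximal runs\<close>

definition initial_state ::
    "('c \<Rightarrow> ('f, 'n, 'x) msg beh) \<times> ('f, 'n, 'x, 'w) frame \<Rightarrow> bool" where
  "initial_state s \<longleftrightarrow> finite (dom (snd s)) \<and> finite {c. fst s c \<noteq> Stop} \<and> (\<forall>c. \<not> is_Send (fst s c))"

lemma grun_finite: "grun L s0 bl s \<Longrightarrow> finite (dom (snd s0)) \<Longrightarrow> finite (dom (snd s))"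
  by (simp add: grun_def bouts_def)

lemma grun_Send:
  fixes s :: "('c \<Rightarrow> ('f, 'n, 'x) msg beh) \<times> ('f, 'n, 'x, 'w :: infinite) frame"
  assumes "grun run_part s0 bl s" "fst s c = Send v b" "finite (dom (snd s))"
  obtains w where
    "grun run_part s0 (bl @ [Block c [] [w]]) ((fst s)(c := b), (snd s)(w \<mapsto> v))"
proof -
  obtain w where "w \<notin> dom (snd s)" using assms(3) ex_new_if_finite[OF infinite_UNIV] by blast
  then have "gstep run_part s (Block c [] [w]) ((fst s)(c := b), (snd s)(w \<mapsto> v))"
    using assms(2) by (auto simp: gstep_def run_part_def map_le_def)
  then show ?thesis using assms(1) that grun_snoc by blast
qed

lemma grun_Recv:
  assumes "grun run_part s0 bl s" "fst s c = Recv k" "M \<in> terms Sig (dom (snd s))"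
  shows "grun run_part s0 (bl @ [Block c [M] []]) ((fst s)(c := k (recipe_val (snd s) M)), snd s)"
proof -
  have "gstep run_part s (Block c [M] []) ((fst s)(c := k (recipe_val (snd s) M)), snd s)"
    using assms by (auto simp: gstep_def run_part_def)
  then show ?thesis using assms(1) grun_snoc by blast
qed

lemma grun_Send_iff:
  assumes "grun run_part s0 (bl @ [Block c [] [w]]) s'" "grun run_part s0 bl s"
  shows "is_Send (fst s c)"
proof -
  obtain t where t: "grun run_part s0 bl t" "gstep run_part t (Block c [] [w]) s'"
    using assms(1) grun_snoc by blast
  then have "t = s" using grun_deterministic[OF deterministic_run_part _ assms(2)] by blast
  with t(2) show ?thesis
    by (auto simp: gstep_def run_part_def is_Send_def split: beh.splits if_splits)
qed

lemma grun_Recv_iff: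
  assumes "grun run_part s0 (bl @ [Block c [M] []]) s'" "grun run_part s0 bl s"
  shows "\<exists>k. fst s c = Recv k"
proof -
  obtain t where t: "grun run_part s0 bl t" "gstep run_part t (Block c [M] []) s'"
    using assms(1) grun_snoc by blast
  then have "t = s" using grun_deterministic[OF deterministic_run_part _ assms(2)] by blast
  with t(2) show ?thesis
    by (auto simp: gstep_def run_part_def split: beh.splits if_splits)
qed

text \<open>An output of \<open>sB\<close> extends its run; \<open>sA\<close> follows the longer
  sequence, and by determinism it does so from the state \<open>s\<close>.\<close>

lemma part_incl_Send:
  fixes s :: "('c \<Rightarrow> ('f, 'n, 'x) msg beh) \<times> ('f, 'n, 'x, 'w :: infinite) frame"
  assumes "part_incl sB sA" "grun run_part sA bl s" "grun run_part sB bl s'"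
    "finite (dom (snd sB))" "is_Send (fst s' c)"
  shows "is_Send (fst s c)"
proof -
  obtain v b where "fst s' c = Send v b" using assms(5) by (auto simp: is_Send_def)
  then obtain w t where "grun run_part sB (bl @ [Block c [] [w]]) t"
    using grun_Send[OF assms(3)] grun_finite[OF assms(3,4)] by metis
  then obtain t' where "grun run_part sA (bl @ [Block c [] [w]]) t'"
    using assms(1) unfolding part_incl_def by blast
  then show ?thesis using assms(2) by (rule grun_Send_iff)
qed

text \<open>Like the case of outputs, except that an input needs a recipe. Without handles and
  constants there is none, hence the premise on \<open>M\<close>.\<close>

lemma part_incl_Recv:
  assumes "part_incl sB sA" "grun run_part sA bl s" "grun run_part sB bl s'"
    "M \<in> terms Sig (dom (snd s'))" "fst s' c = Recv k"
  shows "\<exists>k. fst s c = Recv k"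
proof -
  obtain t' where "grun run_part sA (bl @ [Block c [M] []]) t'"
    using grun_Recv[OF assms(3,5,4)] assms(1) unfolding part_incl_def by blast
  then show ?thesis using assms(2) by (rule grun_Recv_iff)
qed

text \<open>Only the final states have to be compared: inside the run, maximality follows from the
  inputs that open the next blocks.\<close>

lemma grun_max_transfer:
  fixes s :: "('c \<Rightarrow> ('f, 'n, 'x) msg beh) \<times> ('f, 'n, 'x, 'w :: infinite) frame"
  assumes "initial_state sA" "initial_state sB" "part_incl sA sB" "part_incl sB sA"
    "grun run_max sA bl s"
  shows "\<exists>s'. grun run_max sB bl s' \<and> aeq (snd s) (snd s')"
proof -
  have sp: "grun run_part sA bl s" using assms(5) by (rule grun_max_imp_part)
  then obtain s' where s': "grun run_part sB bl s'" "aeq (snd s) (snd s')"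
    using assms(3) unfolding part_incl_def by blast
  have lA: "lrun run_max (snd s) (bproj c bl) (fst sA c) = Some (fst s c)" for c
    using assms(5) by (simp add: grun_def)
  have "lrun run_max (snd s') (bproj c bl) (fst sB c) = Some (fst s' c)" for c
  proof (rule lrun_part_imp_max)
    show "lrun run_part (snd s') (bproj c bl) (fst sB c) = Some (fst s' c)"
      using s'(1) by (simp add: grun_def)
    show "\<not> is_Send (fst s' c)"
    proof
      assume "is_Send (fst s' c)"
      then have "is_Send (fst s c)"
        using part_incl_Send[OF assms(4) sp s'(1)] assms(2) by (simp add: initial_state_def)
      then show False using lrun_max_not_Send[OF lA] assms(1) by (simp add: initial_state_def)
    qed
    show "inputs B \<noteq> [] \<and> outputs B \<noteq> []" if "B \<in> set (bproj c bl)" for B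
      using lrun_max_nonempty[OF lA that] .
  qed
  then have "grun run_max sB bl s'" using s'(1) by (simp add: grun_def)
  with s' show ?thesis by blast
qed

lemma frun_bscoped: "frun s0 bl F \<Longrightarrow> bscoped (dom (snd s0)) bl \<and> dom F = dom (snd s0) \<union> bouts bl"
  by (auto simp: frun_def grun_def bscoped_append)

lemma frun_dom0: "frun s0 bl F \<Longrightarrow> dom (snd s0) = dom F - bouts bl"
  using frun_bscoped[of s0 bl F] bscoped_disjoint[of "dom (snd s0)" bl] by auto

lemma gstep_improper:
  assumes "grun run_part s0 bl s" "set Ms \<subseteq> terms Sig (dom (snd s))"
    "beh_ins (fst s c) (map (recipe_val (snd s)) Ms) = Some b"
  shows "grun run_part s0 (bl @ [Block c Ms []]) ((fst s)(c := b), snd s)"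
proof -
  have "gstep run_part s (Block c Ms []) ((fst s)(c := b), snd s)"
    using assms by (auto simp: gstep_def run_part_def)
  then show ?thesis using assms(1) grun_snoc by blast
qed

lemma max_incl_of_part_incl:
  fixes sA sB :: "('c :: linorder \<Rightarrow> ('f, 'n, 'x) msg beh) \<times> ('f, 'n, 'x, 'w :: infinite) frame"
  assumes "initial_state sA" "initial_state sB" "part_incl sA sB" "part_incl sB sA"
  shows "max_incl sA sB"
  unfolding max_incl_def
proof (intro allI impI, elim conjE)
  fix bl F assume fr: "frun sA bl F" and dok: "depok (dom (snd sA)) F bl"
  have "\<exists>F'. frun sB bl F' \<and> aeq F F'"
  proof (cases "\<exists>\<beta>. grun run_max sA bl (\<beta>, F)")
    case True
    then obtain \<beta> where "grun run_max sA bl (\<beta>, F)" by blast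
    then obtain s' where "grun run_max sB bl s'" "aeq F (snd s')"
      using grun_max_transfer[OF assms] by fastforce
    then show ?thesis unfolding frun_def by (metis prod.collapse)
  next
    case False
    then obtain p c Ms \<beta> where bl: "bl = p @ [Block c Ms []]" and Ms: "Ms \<noteq> []" "set Ms \<subseteq> terms Sig (dom F)"
      and r: "grun run_max sA p (\<beta>, F)" and i: "beh_ins (\<beta> c) (map (recipe_val F) Ms) = Some Stop"
      using fr unfolding frun_def by blast
    obtain t where t: "grun run_max sB p t" using grun_max_transfer[OF assms r] by blast
    have A: "grun run_part sA bl (\<beta>(c := Stop), F)"
      using gstep_improper[OF grun_max_imp_part[OF r]] Ms i bl by simp
    then obtain s' where s': "grun run_part sB bl s'" "aeq F (snd s')"
      using assms(3) unfolding part_incl_def by fastforce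
    then obtain t' where t': "grun run_part sB p t'" "gstep run_part t' (Block c Ms []) s'"
      using bl grun_snoc by blast
    have [simp]: "t' = t"
      by (rule grun_deterministic[OF deterministic_run_part t'(1) grun_max_imp_part[OF t]])
    have F': "snd s' = snd t"
      using t'(2) by (intro map_le_dom_eq) (auto simp: gstep_def)
    have ins: "beh_ins (fst t c) (map (recipe_val (snd t)) Ms) = Some (fst s' c)"
      using t'(2) by (auto simp: gstep_def run_part_def bind_eq_Some_conv)
    \<comment> \<open>On \<open>c\<close> the other side has stopped, so any action offered here
      would be one that it lacks. An input can be offered with a recipe that the block has already
      used.\<close>
    have "fst s' c = Stop"
    proof (cases "fst s' c")
      case (Send v b)
      then have "is_Send ((\<beta>(c := Stop)) c)"
        using part_incl_Send[OF assms(4) A s'(1), of c] assms(2) by (simp add: initial_state_def)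
      then show ?thesis by simp
    next
      case (Recv k)
      have "hd Ms \<in> terms Sig (dom (snd s'))"
        using Ms s'(2) by (auto simp: aeq_def dest: hd_in_set)
      then show ?thesis using part_incl_Recv[OF assms(4) A s'(1) _ Recv] by auto
    qed
    moreover have "set Ms \<subseteq> terms Sig (dom (snd t))" using t'(2) by (simp add: gstep_def)
    ultimately have "frun sB bl (snd t)"
      unfolding frun_def using bl Ms t ins by (metis prod.collapse)
    then show ?thesis using s'(2) F' by auto
  qed
  then obtain F' where F': "frun sB bl F'" "aeq F F'" by blast
  have b: "bscoped (dom (snd sA)) bl" "dom F = dom (snd sA) \<union> bouts bl"
    using frun_bscoped[OF fr] by auto
  have "dom (snd sA) = dom (snd sB)"
    using frun_dom0[OF fr] frun_dom0[OF F'(1)] F'(2) by (simp add: aeq_def)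
  then have "depok (dom (snd sB)) F' bl"
    using depok_transfer[OF dok b(1), of F'] F'(2) b(2) by (auto simp: aeq_def)
  with F' show "\<exists>F'. frun sB bl F' \<and> depok (dom (snd sB)) F' bl \<and> aeq F F'" by blast
qed

end

section \<open>Reordering of blocks\<close>

lemma terms_subset: "S \<subseteq> S' \<Longrightarrow> terms Sig S \<subseteq> terms Sig S'"
  by (rule subsetI) (rule terms_mono)

lemma dep_nonempty:
  assumes "dep p c \<noteq> {}"
  obtains p1 K q where "p = p1 @ K # q" "c < chan K" "\<And>B. B \<in> set q \<Longrightarrow> chan B < c"
    "dep p c = bouts (K # q)"
proof -
  from assms obtain k where k: "k < length p" "c < chan (p ! k)"
    "\<And>i. k < i \<Longrightarrow> i < length p \<Longrightarrow> chan (p ! i) < c"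
    unfolding dep_def by auto
  \<comment> \<open>Of two candidates, the smaller one puts the channel at the larger one below
    \<open>c\<close>, while the larger one puts it above \<open>c\<close>.\<close>
  have uniq: "k' = k" if "k' < length p" "c < chan (p ! k')"
    "\<forall>i. k' < i \<and> i < length p \<longrightarrow> chan (p ! i) < c" for k'
  proof (rule linorder_cases[of k' k])
    assume "k' < k"
    then show ?thesis using that(3) k(1,2) less_asym by blast
  next
    assume "k < k'"
    then show ?thesis using that(1,2) k(3) less_asym by blast
  qed
  define q where "q = drop (Suc k) p"
  have p: "p = take k p @ p ! k # q" unfolding q_def by (rule id_take_nth_drop[OF k(1)])
  have "chan B < c" if B: "B \<in> set q" for B
  proof -
    from B obtain j where "j < length q" "B = q ! j" unfolding in_set_conv_nth by blast
    then show ?thesis using k(1) k(3)[of "Suc k + j"] by (simp add: q_def)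
  qed
  moreover have "dep p c = bouts (p ! k # q)"
  proof -
    have "w \<in> dep p c \<longleftrightarrow> (\<exists>i. k \<le> i \<and> i < length p \<and> w \<in> set (outputs (p ! i)))" for w
    proof
      assume "w \<in> dep p c"
      then obtain k' where k': "k' < length p" "c < chan (p ! k')"
        "\<forall>i. k' < i \<and> i < length p \<longrightarrow> chan (p ! i) < c"
        "\<exists>i. k' \<le> i \<and> i < length p \<and> w \<in> set (outputs (p ! i))"
        unfolding dep_def by blast
      from uniq[OF k'(1,2,3)] k'(4) show "\<exists>i. k \<le> i \<and> i < length p \<and> w \<in> set (outputs (p ! i))"
        by simp
    qed (use k in \<open>auto simp: dep_def\<close>)
    also have "(\<exists>i. k \<le> i \<and> i < length p \<and> w \<in> set (outputs (p ! i))) \<longleftrightarrow> w \<in> bouts (drop k p)" for w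
    proof -
      have "set (drop k p) = {p ! i |i. k \<le> i \<and> i < length p}"
      proof (intro equalityI subsetI)
        fix B assume "B \<in> set (drop k p)"
        then obtain j where "j < length p - k" "B = p ! (k + j)"
          using k(1) by (auto simp: in_set_conv_nth)
        then show "B \<in> {p ! i |i. k \<le> i \<and> i < length p}" by force
      next
        fix B assume "B \<in> {p ! i |i. k \<le> i \<and> i < length p}"
        then obtain i where "k \<le> i" "i < length p" "B = p ! i" by blast
        then show "B \<in> set (drop k p)"
          using nth_mem[of "i - k" "drop k p"] by simp
      qed
      then show ?thesis by (auto simp: bouts_def)
    qed
    finally have "dep p c = bouts (drop k p)" by (rule set_eqI)
    also have "drop k p = p ! k # q" unfolding q_def by (rule Cons_nth_drop_Suc[OF k(1), symmetric])
    finally show ?thesis .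
  qed
  ultimately show ?thesis using that p k(2) by blast
qed

context equational_setting
begin

section \<open>Equivalent recipes and moves of blocks\<close>

definition block_val where
  "block_val F B = (map (recipe_val F) (inputs B), outputs B)"

lemma lrun_cong:
  "map (block_val F) bl = map (block_val F) bl' \<Longrightarrow> lrun L F bl = lrun L F bl'"
proof (induction bl arbitrary: bl')
  case (Cons B bl)
  then obtain B' bl'' where bl': "bl' = B' # bl''" by (cases bl') auto
  with Cons.prems have "block_val F B = block_val F B'" "map (block_val F) bl = map (block_val F) bl''"
    by simp_all
  then have "map (recipe_val F) (inputs B) = map (recipe_val F) (inputs B')"
    "outputs B = outputs B'"
    by (simp_all add: block_val_def del: map_eq_conv)
  moreover have "lrun L F bl = lrun L F bl''" by (rule Cons.IH) fact
  ultimately show ?case by (intro ext) (simp only: bl' lrun.simps)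
qed simp

lemma map_recipe_val_aeq:
  assumes "aeq F F'" "set Ms \<subseteq> terms Sig (dom F)" "set Ns \<subseteq> terms Sig (dom F)"
    "map (recipe_val F) Ms = map (recipe_val F) Ns"
  shows "map (recipe_val F') Ms = map (recipe_val F') Ns"
proof -
  have len: "length Ms = length Ns" using assms(4) by (rule map_eq_imp_length_eq)
  moreover have "recipe_val F' (Ms ! i) = recipe_val F' (Ns ! i)" if "i < length Ms" for i
  proof -
    have "Ms ! i \<in> terms Sig (dom F)" "Ns ! i \<in> terms Sig (dom F)"
      using assms(2,3) that len nth_mem by auto
    moreover have "recipe_val F (Ms ! i) = recipe_val F (Ns ! i)"
      using arg_cong[OF assms(4), of "\<lambda>xs. xs ! i"] that len by simp
    ultimately show ?thesis using assms(1) by (auto simp: aeq_def)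
  qed
  ultimately show ?thesis by (simp add: list_eq_iff_nth_eq)
qed

lemma map_block_val_aeq:
  assumes "aeq F F'"
  shows "(\<And>B. B \<in> set xs \<union> set ys \<Longrightarrow> set (inputs B) \<subseteq> terms Sig (dom F)) \<Longrightarrow>
    map (block_val F) xs = map (block_val F) ys \<Longrightarrow> map (block_val F') xs = map (block_val F') ys"
proof (induction xs arbitrary: ys)
  case (Cons B xs)
  then obtain B' ys' where ys: "ys = B' # ys'" by (cases ys) auto
  have "block_val F' B = block_val F' B'"
    using Cons.prems map_recipe_val_aeq[OF assms, of "inputs B" "inputs B'"]
    by (auto simp: ys block_val_def simp del: map_eq_conv)
  moreover have "map (block_val F') xs = map (block_val F') ys'"
    by (rule Cons.IH) (use Cons.prems in \<open>auto simp: ys simp del: map_eq_conv\<close>)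
  ultimately show ?case by (simp only: ys list.map)
qed simp

lemma grun_cong:
  assumes "grun L s0 bl s" "bscoped (dom (snd s0)) bl'" "bouts bl' = bouts bl"
    "\<And>c. map (block_val (snd s)) (bproj c bl') = map (block_val (snd s)) (bproj c bl)"
  shows "grun L s0 bl' s"
  using assms(1,2,3) lrun_cong[OF assms(4)] by (simp add: grun_def)

text \<open>Additional handles can only do harm by clashing with later outputs.\<close>

lemma bscoped_weaken:
  "bscoped D bl \<Longrightarrow> D \<subseteq> D' \<Longrightarrow> D' \<inter> bouts bl = {} \<Longrightarrow> bscoped D' bl"
proof (induction bl arbitrary: D D')
  case (Cons B bl)
  have b: "bscoped (D \<union> set (outputs B)) bl" using Cons.prems(1) by simp
  have "bscoped (D' \<union> set (outputs B)) bl"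
  proof (rule Cons.IH[OF b])
    show "D \<union> set (outputs B) \<subseteq> D' \<union> set (outputs B)" using Cons.prems(2) by blast
    show "(D' \<union> set (outputs B)) \<inter> bouts bl = {}"
      using bscoped_disjoint[OF b] Cons.prems(3) by (simp add: Int_Un_distrib2 Int_Un_distrib)
  qed
  moreover have "set (inputs B) \<subseteq> terms Sig D'"
    using Cons.prems(1) terms_subset[OF Cons.prems(2), of Sig] by (meson bscoped.simps(2) order_trans)
  moreover have "set (outputs B) \<inter> D' = {}" using Cons.prems(3) by (simp add: Int_Un_distrib Int_commute)
  ultimately show ?case using Cons.prems(1) by simp
qed simp

lemma bscoped_move:
  assumes "bscoped D (p @ k @ B # r)" "outputs B' = outputs B"
    "set (inputs B') \<subseteq> terms Sig (D \<union> bouts p)"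
  shows "bscoped D (p @ B' # k @ r)"
proof -
  have d: "distinct (outputs B)" "set (outputs B) \<inter> (D \<union> bouts p \<union> bouts k) = {}"
    using assms(1) by (auto simp: bscoped_append)
  have k: "bscoped (D \<union> bouts p) k" using assms(1) by (simp add: bscoped_append)
  have "bscoped (D \<union> bouts p \<union> set (outputs B)) k"
    by (rule bscoped_weaken[OF k]) (use bscoped_disjoint[OF k] d in auto)
  moreover have "bscoped (D \<union> bouts p \<union> bouts k \<union> set (outputs B)) r"
    using assms(1) by (simp add: bscoped_append)
  moreover have "D \<union> bouts p \<union> bouts k \<union> set (outputs B) = D \<union> bouts p \<union> set (outputs B) \<union> bouts k"
    by auto
  ultimately show ?thesis using assms d by (auto simp: bscoped_append)
qed

lemma independent_recipe:
  assumes "M \<in> terms Sig (D \<union> bouts (p @ k))" "atoms M \<inter> bouts k = {}"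
  shows "M \<in> terms Sig (D \<union> bouts p)"
proof (rule terms_atoms_mono[OF assms(1)])
  show "atoms M \<subseteq> D \<union> bouts p" using atoms_terms[OF assms(1)] assms(2) by auto
qed

text \<open>A block that violates its dependency constraint can be moved to the front of the blocks it does
  not depend on, after its recipes have been replaced by equivalent ones. This decreases the
  sequence of channels lexicographically.\<close>

lemma depok_reorder:
  fixes s0 :: "('c :: linorder \<Rightarrow> ('f, 'n, 'x) msg beh) \<times> ('f, 'n, 'x, 'w) frame"
  assumes "grun L s0 bl s"
  shows "\<exists>bl'. grun L s0 bl' s \<and> depok (dom (snd s0)) (snd s) bl' \<and> bouts bl' = bouts bl \<and>
    (\<forall>c. map (block_val (snd s)) (bproj c bl') = map (block_val (snd s)) (bproj c bl))"
proof -
  \<comment> \<open>Moves create no new channels. The order on all channels need not be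
    well-founded, but its restriction to this finite set is.\<close>
  define C where "C = chan ` set bl"
  define r where "r = {(a, b). a < b \<and> a \<in> C \<and> b \<in> C}"
  have "finite r" by (rule finite_subset[of _ "C \<times> C"]) (auto simp: r_def C_def)
  moreover have "acyclic r"
  proof -
    have "trans r" by (auto simp: trans_def r_def)
    then show ?thesis by (simp add: acyclic_def trancl_id) (simp add: r_def)
  qed
  ultimately have wf: "wf (inv_image (lex r) (map chan))"
    by (intro wf_inv_image wf_lex finite_acyclic_wf)
  have "chan ` set bl \<subseteq> C" by (simp add: C_def)
  with wf assms show ?thesis
  proof (induction bl rule: wf_induct_rule)
    case (less bl)
    let ?D = "dom (snd s0)" and ?F = "snd s"
    show ?case
    proof (cases "depok ?D ?F bl")
      case True
      with less.prems show ?thesis by blast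
    next
      case False
      then obtain p B r' where bl: "bl = p @ B # r'" and dep: "dep p (chan B) \<noteq> {}"
        and viol: "\<forall>N \<in> set (inputs B). \<exists>M \<in> terms Sig (?D \<union> bouts p).
          recipe_val ?F M = recipe_val ?F N \<and> atoms M \<inter> dep p (chan B) = {}"
        unfolding depok_def by blast
      from viol obtain f where f: "\<And>N. N \<in> set (inputs B) \<Longrightarrow> f N \<in> terms Sig (?D \<union> bouts p) \<and>
          recipe_val ?F (f N) = recipe_val ?F N \<and> atoms (f N) \<inter> dep p (chan B) = {}"
        by metis
      from dep obtain p1 K q where p: "p = p1 @ K # q" "chan B < chan K"
        "\<And>B'. B' \<in> set q \<Longrightarrow> chan B' < chan B" "dep p (chan B) = bouts (K # q)"
        by (rule dep_nonempty) (rule that; assumption)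
      define B' where "B' = Block (chan B) (map f (inputs B)) (outputs B)"
      define bl' where "bl' = p1 @ B' # (K # q) @ r'"
      have B': "chan B' = chan B" "outputs B' = outputs B" "block_val ?F B' = block_val ?F B"
        using f by (auto simp: B'_def block_val_def)
      have "f N \<in> terms Sig (?D \<union> bouts p1)" if "N \<in> set (inputs B)" for N
        by (rule independent_recipe[of _ _ _ "K # q"]) (use f[OF that] p(1,4) in auto)
      then have sc: "bscoped ?D bl'" unfolding bl'_def
        by (intro bscoped_move[of _ _ _ B])
           (use less.prems(1) in \<open>auto simp: grun_def bl p(1) B'_def\<close>)
      \<comment> \<open>\<open>K\<close> is on a larger channel and the blocks of \<open>q\<close>
        are on smaller ones, so no block of the same channel is overtaken.\<close>
      have none: "bproj (chan B) (K # q) = []"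
        using p(2,3) by (fastforce simp: bproj_empty_iff)
      have proj: "map (block_val ?F) (bproj c bl') = map (block_val ?F) (bproj c bl)" for c
      proof -
        have "bl' = p1 @ [B'] @ (K # q) @ r'" "bl = p1 @ (K # q) @ [B] @ r'"
          by (simp_all add: bl'_def bl p(1))
        then have "bproj c bl' = bproj c p1 @ bproj c [B'] @ bproj c (K # q) @ bproj c r'"
          "bproj c bl = bproj c p1 @ bproj c (K # q) @ bproj c [B] @ bproj c r'"
          by (simp_all only: bproj_simps(3))
        moreover have "bproj c (K # q) = [] \<or> (bproj c [B'] = [] \<and> bproj c [B] = [])"
          using none B' by (cases "c = chan B") auto
        moreover have "map (block_val ?F) (bproj c [B']) = map (block_val ?F) (bproj c [B])"
          using B' by simp
        ultimately show ?thesis by auto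
      qed
      have outs: "bouts bl' = bouts bl" using B' by (auto simp: bl'_def bl p(1))
      have g: "grun L s0 bl' s" using grun_cong[OF less.prems(1) sc outs proj] .
      have C: "chan ` set bl' \<subseteq> C" using less.prems(2) B' by (auto simp: bl'_def bl p(1))
      \<comment> \<open>The channel sequences first differ at the place of \<open>K\<close>, where
        the smaller channel of \<open>B\<close> now stands.\<close>
      have "(bl', bl) \<in> inv_image (lex r) (map chan)"
      proof -
        have "(chan B, chan K) \<in> r" using less.prems(2) p(2) by (auto simp: r_def bl p(1))
        moreover have "map chan bl' = map chan p1 @ chan B # map chan ((K # q) @ r')"
          "map chan bl = map chan p1 @ chan K # map chan (q @ B # r')"
          by (simp_all add: bl'_def B' bl p(1))
        ultimately show ?thesis unfolding inv_image_def lex_conv by force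
      qed
      from less.IH[OF this g C] obtain bl2 where "grun L s0 bl2 s" "depok ?D ?F bl2"
        "bouts bl2 = bouts bl'" "\<forall>c. map (block_val ?F) (bproj c bl2) = map (block_val ?F) (bproj c bl')"
        by blast
      with outs proj show ?thesis by auto
    qed
  qed
qed

lemma depok_prefix: "depok D F (p @ q) \<Longrightarrow> depok D F p"
  unfolding depok_def by (metis append_Cons append_assoc)

lemma depok_snoc:
  "depok D F (bl @ [B]) \<longleftrightarrow> depok D F bl \<and> (dep bl (chan B) \<noteq> {} \<longrightarrow>
     (\<exists>N \<in> set (inputs B). \<forall>M \<in> terms Sig (D \<union> bouts bl).
        recipe_val F M = recipe_val F N \<longrightarrow> atoms M \<inter> dep bl (chan B) \<noteq> {}))"
proof -
  have "bl @ [B] = p @ B' # r \<longleftrightarrow> (p = bl \<and> B' = B \<and> r = []) \<or> (\<exists>r'. r = r' @ [B] \<and> bl = p @ B' # r')"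
    for p B' r
    by (cases r rule: rev_cases) auto
  then show ?thesis unfolding depok_def by (simp only:) blast
qed

text \<open>An improper block that violates its dependency constraint cannot be moved to the front. Instead,
  the blocks it does not depend on are dropped.\<close>

lemma improper_transfer:
  fixes sA sB :: "('c :: linorder \<Rightarrow> ('f, 'n, 'x) msg beh) \<times> ('f, 'n, 'x, 'w) frame"
  assumes incl: "max_incl sA sB"
  shows "grun run_max sA bl s \<Longrightarrow> grun run_max sB bl s' \<Longrightarrow> depok (dom (snd sA)) (snd s) bl \<Longrightarrow>
    aeq (snd s) (snd s') \<Longrightarrow> Ms \<noteq> [] \<Longrightarrow> set Ms \<subseteq> terms Sig (dom (snd s)) \<Longrightarrow>
    beh_ins (fst s c) (map (recipe_val (snd s)) Ms) = Some Stop \<Longrightarrow>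
    beh_ins (fst s' c) (map (recipe_val (snd s')) Ms) = Some Stop"
proof (induction "length bl" arbitrary: bl s s' Ms rule: less_induct)
  case less
  let ?D = "dom (snd sA)" and ?B = "Block c Ms []"
  have dom: "dom (snd s) = ?D \<union> bouts bl" using less.prems(1) by (rule grun_dom)
  have dom': "dom (snd s') = dom (snd s)" using less.prems(4) by (simp add: aeq_def)
  show ?case
  proof (cases "depok ?D (snd s) (bl @ [?B])")
    case True
    have "frun sA (bl @ [?B]) (snd s)"
      unfolding frun_def using less.prems by (metis prod.collapse)
    then obtain F' where "frun sB (bl @ [?B]) F'" using True incl unfolding max_incl_def by blast
    \<comment> \<open>Blocks of a maximal run have outputs, so the run of \<open>sB\<close> must
      also end with an improper block.\<close>
    moreover have "\<not> grun run_max sB (bl @ [?B]) t" for t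
    proof
      assume "grun run_max sB (bl @ [?B]) t"
      then have "lrun run_max (snd t) (bproj c (bl @ [?B])) (fst sB c) = Some (fst t c)"
        by (simp only: grun_def)
      from lrun_max_nonempty[OF this, of ?B] show False by simp
    qed
    ultimately obtain \<beta> where b: "grun run_max sB bl (\<beta>, F')"
      "beh_ins (\<beta> c) (map (recipe_val F') Ms) = Some Stop"
      unfolding frun_def by auto
    have "(\<beta>, F') = s'" by (rule grun_deterministic[OF deterministic_run_max b(1) less.prems(2)])
    with b(2) show ?thesis by auto
  next
    case False
    then have dep: "dep bl c \<noteq> {}" and viol: "\<forall>N \<in> set Ms. \<exists>M \<in> terms Sig (?D \<union> bouts bl).
          recipe_val (snd s) M = recipe_val (snd s) N \<and> atoms M \<inter> dep bl c = {}"
      using less.prems(3) by (auto simp: depok_snoc)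
    from viol obtain f where f: "\<And>N. N \<in> set Ms \<Longrightarrow> f N \<in> terms Sig (?D \<union> bouts bl) \<and>
        recipe_val (snd s) (f N) = recipe_val (snd s) N \<and> atoms (f N) \<inter> dep bl c = {}"
      by metis
    from dep obtain p K q where p: "bl = p @ K # q" "c < chan K" "\<And>B'. B' \<in> set q \<Longrightarrow> chan B' < c"
        "dep bl c = bouts (K # q)"
      by (rule dep_nonempty) (rule that; assumption)
    \<comment> \<open>None of the dropped blocks is on \<open>c\<close>, so both sides are in the
      same state on \<open>c\<close> after the shorter sequence.\<close>
    have none: "bproj c (K # q) = []"
      using p(2,3) by (fastforce simp: bproj_empty_iff)
    obtain t where t: "grun run_max sA p t" "snd t \<subseteq>\<^sub>m snd s" "fst t c = fst s c"
      using grun_append[OF less.prems(1)[unfolded p(1)]] none by blast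
    obtain t' where t': "grun run_max sB p t'" "snd t' \<subseteq>\<^sub>m snd s'" "fst t' c = fst s' c"
      using grun_append[OF less.prems(2)[unfolded p(1)]] none by blast
    have "dom (snd t) = dom (snd t')"
      using grun_dom[OF t(1)] grun_dom[OF t'(1)] grun_dom0[OF less.prems(1)] grun_dom0[OF less.prems(2)] dom'
      by simp
    then have a: "aeq (snd t) (snd t')" by (rule aeq_restrict[OF less.prems(4) t(2) t'(2)])
    have Ms': "set (map f Ms) \<subseteq> terms Sig (dom (snd t))"
    proof -
      have "f N \<in> terms Sig (?D \<union> bouts p)" if "N \<in> set Ms" for N
        by (rule independent_recipe[of _ _ _ "K # q"]) (use f[OF that] p(1,4) in auto)
      then show ?thesis by (auto simp: grun_dom[OF t(1)])
    qed
    have dp: "depok ?D (snd t) p"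
    proof (rule depok_transfer)
      show "depok ?D (snd s) p" using less.prems(3) depok_prefix by (auto simp: p(1))
      show "bscoped ?D p" using t(1) by (simp add: grun_def)
      show "recipe_val (snd s) M = recipe_val (snd s) N"
        if "M \<in> terms Sig (?D \<union> bouts p)" "N \<in> terms Sig (?D \<union> bouts p)"
          "recipe_val (snd t) M = recipe_val (snd t) N" for M N
        using that recipe_val_mono[OF _ t(2)] by (simp add: grun_dom[OF t(1)])
    qed
    have v: "map (recipe_val (snd t)) (map f Ms) = map (recipe_val (snd s)) Ms"
    proof -
      have "recipe_val (snd t) (f N) = recipe_val (snd s) N" if "N \<in> set Ms" for N
        using recipe_val_mono[OF _ t(2), of "f N"] Ms' f[OF that] that by auto
      then show ?thesis by simp
    qed
    have "beh_ins (fst t' c) (map (recipe_val (snd t')) (map f Ms)) = Some Stop"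
    proof (rule less.hyps[OF _ t(1) t'(1) dp a _ Ms'])
      show "length p < length bl" by (simp add: p(1))
      show "map f Ms \<noteq> []" using less.prems(5) by simp
      show "beh_ins (fst t c) (map (recipe_val (snd t)) (map f Ms)) = Some Stop"
        using less.prems(7) by (simp only: v t(3))
    qed
    \<comment> \<open>Recipes with equal values in \<open>s\<close> have equal values in
      \<open>s'\<close> by static equivalence; this leads back from the new recipes to the given
      ones.\<close>
    moreover have "map (recipe_val (snd t')) (map f Ms) = map (recipe_val (snd s')) Ms"
    proof -
      have "map (recipe_val (snd s')) (map f Ms) = map (recipe_val (snd s')) Ms"
      proof (rule map_recipe_val_aeq[OF less.prems(4) _ less.prems(6)])
        show "set (map f Ms) \<subseteq> terms Sig (dom (snd s))" using f by (auto simp: dom)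
        show "map (recipe_val (snd s)) (map f Ms) = map (recipe_val (snd s)) Ms" using f by simp
      qed
      moreover have "map (recipe_val (snd s')) (map f Ms) = map (recipe_val (snd t')) (map f Ms)"
      proof (rule map_cong[OF refl])
        fix N assume "N \<in> set (map f Ms)"
        then have "N \<in> terms Sig (dom (snd t'))" using Ms' \<open>dom (snd t) = dom (snd t')\<close> by auto
        then show "recipe_val (snd s') N = recipe_val (snd t') N" by (rule recipe_val_mono[OF _ t'(2)])
      qed
      ultimately show ?thesis by simp
    qed
    ultimately show ?thesis by (simp only: t'(3))
  qed
qed

end

section \<open>Decomposition of traces into blocks\<close>

definition singles :: "('c, 'r, 'w) act list \<Rightarrow> ('c, 'r, 'w) block list" where
  "singles = map single_block"

lemma singles_simps [simp]:
  "singles [] = []" "singles (a # tr) = single_block a # singles tr"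
  "singles (tr @ tr') = singles tr @ singles tr'"
  by (auto simp: singles_def)

lemma singles_eq_Nil [simp]: "singles tr = [] \<longleftrightarrow> tr = []"
  by (simp add: singles_def)

lemma bproj_singles_Inps [simp]: "bproj c (singles (map (Inp d) Ms)) = (if c = d then singles (map (Inp d) Ms) else [])"
  by (auto simp: bproj_def singles_def filter_empty_conv filter_id_conv)

lemma bouts_singles_Inps [simp]: "bouts (singles (map (Inp d) Ms)) = {}"
  by (auto simp: bouts_def singles_def)

context equational_setting
begin

lemma lrun_singles_Inps:
  "lrun run_part F (singles (map (Inp c) Ms)) b = beh_ins b (map (recipe_val F) Ms)"
  unfolding singles_def by (rule lrun_Inps)

text \<open>An output closes a new block made of the pending inputs of its channel, or else joins
  the last block of that channel. Inputs are thus delayed and outputs advanced, and neither can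
  spoil the scoping. Inputs that no output follows remain in \<open>pend\<close>. As every channel
  starts with an input, an output always has a block to go to.\<close>

lemma decompose_blocks:
  "bscoped D (singles tr) \<Longrightarrow> Tau \<notin> set tr \<Longrightarrow>
   (\<And>c. bproj c (singles tr) \<noteq> [] \<Longrightarrow> inputs (hd (bproj c (singles tr))) \<noteq> []) \<Longrightarrow>
   \<exists>bl pend. bscoped D bl \<and> (\<forall>B\<in>set bl. inputs B \<noteq> [] \<and> outputs B \<noteq> []) \<and>
     bouts bl = bouts (singles tr) \<and>
     (\<forall>c. bproj c (singles tr) = flat (bproj c bl) @ singles (map (Inp c) (pend c)) \<and>
        set (pend c) \<subseteq> terms Sig (D \<union> bouts bl))"
proof (induction tr rule: rev_induct)
  case Nil
  show ?case by (intro exI[of _ "[]"] exI[of _ "\<lambda>_. []"]) simp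
next
  case (snoc a tr)
  have "\<exists>bl pend. bscoped D bl \<and> (\<forall>B\<in>set bl. inputs B \<noteq> [] \<and> outputs B \<noteq> []) \<and>
     bouts bl = bouts (singles tr) \<and>
     (\<forall>c. bproj c (singles tr) = flat (bproj c bl) @ singles (map (Inp c) (pend c)) \<and>
        set (pend c) \<subseteq> terms Sig (D \<union> bouts bl))"
  proof (rule snoc.IH)
    show "bscoped D (singles tr)" using snoc.prems(1) by (simp add: bscoped_append)
    show "Tau \<notin> set tr" using snoc.prems(2) by simp
    show "inputs (hd (bproj c (singles tr))) \<noteq> []" if "bproj c (singles tr) \<noteq> []" for c
      using snoc.prems(3)[of c] that by (simp add: hd_append split: if_splits)
  qed
  then obtain bl pend where bl: "bscoped D bl" "\<And>B. B \<in> set bl \<Longrightarrow> inputs B \<noteq> [] \<and> outputs B \<noteq> []"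
    "bouts bl = bouts (singles tr)"
    and proj: "\<And>c. bproj c (singles tr) = flat (bproj c bl) @ singles (map (Inp c) (pend c))"
    and pend: "\<And>c. set (pend c) \<subseteq> terms Sig (D \<union> bouts bl)"
    by blast
  have sc: "bscoped (D \<union> bouts bl) [single_block a]"
    using snoc.prems(1) bl(3) by (simp add: bscoped_append)
  show ?case
  proof (cases a)
    case (Inp d M)
    let ?pend = "pend(d := pend d @ [M])"
    have "bproj c (singles (tr @ [a])) = flat (bproj c bl) @ singles (map (Inp c) (?pend c))" for c
      using proj[of c] by (simp add: Inp)
    moreover have "set (?pend c) \<subseteq> terms Sig (D \<union> bouts bl)" for c
      using pend[of c] pend[of d] sc by (simp add: Inp)
    moreover have "bouts bl = bouts (singles (tr @ [a]))" using bl(3) by (simp add: Inp)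
    ultimately show ?thesis using bl(1,2) by blast
  next
    case (Outp d w)
    have w: "w \<notin> D" "w \<notin> bouts bl" using sc by (auto simp: Outp)
    show ?thesis
    proof (cases "pend d = []")
      case False
      let ?pend = "pend(d := [])" and ?bl = "bl @ [Block d (pend d) [w]]"
      have "bproj c (singles (tr @ [a])) = flat (bproj c ?bl) @ singles (map (Inp c) (?pend c))" for c
        using proj[of c] by (simp add: Outp singles_def)
      moreover have "set (?pend c) \<subseteq> terms Sig (D \<union> bouts ?bl)" for c
        using pend[of c] terms_subset[of "D \<union> bouts bl" "D \<union> bouts ?bl" Sig] by auto
      moreover have "bouts ?bl = bouts (singles (tr @ [a]))" using bl(3) by (simp add: Outp)
      moreover have "bscoped D ?bl" using bl(1) w pend[of d] by (simp add: bscoped_append)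
      moreover have "\<forall>B\<in>set ?bl. inputs B \<noteq> [] \<and> outputs B \<noteq> []" using bl(2) False by auto
      ultimately show ?thesis by blast
    next
      case True
      \<comment> \<open>Otherwise this output would be the first action on \<open>d\<close>.\<close>
      have "bproj d bl \<noteq> []"
      proof
        assume "bproj d bl = []"
        then have "bproj d (singles (tr @ [a])) = [single_block a]"
          using proj[of d] True by (simp add: Outp)
        then show False using snoc.prems(3)[of d] by (simp add: Outp)
      qed
      then have "\<exists>B \<in> set bl. chan B = d" by (auto simp: bproj_empty_iff)
      then obtain bl1 B bl2 where B: "bl = bl1 @ B # bl2" "chan B = d" "\<forall>B' \<in> set bl2. chan B' \<noteq> d"
        using split_list_last_prop[of bl "\<lambda>B. chan B = d"] by blast
      define B' where "B' = Block d (inputs B) (outputs B @ [w])"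
      then have B': "chan B' = d" "inputs B' = inputs B" "outputs B' = outputs B @ [w]" by simp_all
      let ?bl = "bl1 @ B' # bl2"
      have none: "bproj d bl2 = []" using B(3) by (auto simp: bproj_empty_iff)
      have io: "io B' = io B @ [Outp d w]" using B(2) by (cases B) (simp add: B'_def)
      have "bproj c (singles (tr @ [a])) = flat (bproj c ?bl) @ singles (map (Inp c) (pend c))" for c
      proof (cases "c = d")
        case c: True
        then show ?thesis using proj[of d] none True B(2) B'(1) io by (simp add: B(1) Outp singles_def)
      qed (use proj[of c] B(2) B'(1) in \<open>simp add: B(1) Outp\<close>)
      moreover have outs: "bouts ?bl = bouts bl \<union> {w}" by (auto simp: B(1) B')
      then have "set (pend c) \<subseteq> terms Sig (D \<union> bouts ?bl)" for c
        using pend[of c] terms_subset[of "D \<union> bouts bl" "D \<union> bouts ?bl" Sig] by auto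
      moreover have "bouts ?bl = bouts (singles (tr @ [a]))" using bl(3) outs by (simp add: Outp)
      moreover have "bscoped D ?bl"
      proof -
        have b2: "bscoped (D \<union> bouts bl1 \<union> set (outputs B)) bl2"
          using bl(1) by (simp add: B(1) bscoped_append)
        \<comment> \<open>The blocks in \<open>bl2\<close> now come after \<open>w\<close> as well,
          which is harmless since \<open>w\<close> is none of their outputs.\<close>
        have "bscoped (D \<union> bouts bl1 \<union> set (outputs B')) bl2"
        proof (rule bscoped_weaken[OF b2])
          show "(D \<union> bouts bl1 \<union> set (outputs B')) \<inter> bouts bl2 = {}"
            using bscoped_disjoint[OF b2] w(2) by (simp add: B(1) B' Int_Un_distrib2)
        qed (auto simp: B')
        then show ?thesis using bl(1) w by (auto simp: B(1) B' bscoped_append)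
      qed
      moreover have "\<forall>B\<in>set ?bl. inputs B \<noteq> [] \<and> outputs B \<noteq> []" using bl(2) by (auto simp: B(1) B')
      ultimately show ?thesis by blast
    qed
  qed (use snoc.prems(2) in simp)
qed

text \<open>The channel is at the end of a block. After an input this is only the case at
  \<open>Stop\<close>, where the pending inputs form an improper block.\<close>

definition complete :: "'c \<Rightarrow> ('c, ('f, 'w) recipe, 'w) act list \<Rightarrow> ('f, 'n, 'x) msg beh \<Rightarrow> bool" where
  "complete c tr b \<longleftrightarrow> \<not> is_Send b \<and>
     (bproj c (singles tr) \<noteq> [] \<and> inputs (last (bproj c (singles tr))) \<noteq> [] \<longrightarrow> b = Stop)"

text \<open>Induction on the tree of the channel, which is well-founded even though it branches over
  infinitely many inputs.\<close>

lemma complete_channel: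
  fixes s0 :: "('c \<Rightarrow> ('f, 'n, 'x) msg beh) \<times> ('f, 'n, 'x, 'w :: infinite) frame"
  assumes "finite (dom (snd s0))" "grun run_part s0 (singles tr) s"
  shows "\<exists>tr2 s'. Tau \<notin> set tr2 \<and> grun run_part s0 (singles (tr @ tr2)) s' \<and>
    complete c (tr @ tr2) (fst s' c) \<and>
    (\<forall>c'. c' \<noteq> c \<longrightarrow> bproj c' (singles tr2) = [] \<and> fst s' c' = fst s c')"
  using assms(2)
proof (induction "fst s c" arbitrary: tr s)
  case Stop
  then show ?case
    by (intro exI[of _ "[]"] exI[of _ s]) (simp add: complete_def flip: Stop(1))
next
  case (Send v b)
  obtain w where w: "grun run_part s0 (singles tr @ [Block c [] [w]]) ((fst s)(c := b), (snd s)(w \<mapsto> v))"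
    using grun_Send[OF Send.prems Send.hyps(2)[symmetric]] grun_finite[OF Send.prems assms(1)] by blast
  let ?s = "((fst s)(c := b), (snd s)(w \<mapsto> v))"
  have "\<exists>tr2 s'. Tau \<notin> set tr2 \<and> grun run_part s0 (singles ((tr @ [Outp c w]) @ tr2)) s' \<and>
    complete c ((tr @ [Outp c w]) @ tr2) (fst s' c) \<and>
    (\<forall>c'. c' \<noteq> c \<longrightarrow> bproj c' (singles tr2) = [] \<and> fst s' c' = fst ?s c')"
    by (rule Send.hyps(1)) (use w in simp_all)
  then obtain tr2 s' where "Tau \<notin> set tr2" "grun run_part s0 (singles (tr @ Outp c w # tr2)) s'"
    "complete c (tr @ Outp c w # tr2) (fst s' c)"
    "\<And>c'. c' \<noteq> c \<Longrightarrow> bproj c' (singles tr2) = [] \<and> fst s' c' = fst s c'"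
    by (auto simp: fun_upd_other)
  then show ?case by (intro exI[of _ "Outp c w # tr2"] exI[of _ s']) auto
next
  case (Recv k)
  show ?case
  proof (cases "bproj c (singles tr) \<noteq> [] \<and> inputs (last (bproj c (singles tr))) \<noteq> []")
    case False
    then show ?thesis using Recv
      by (intro exI[of _ "[]"] exI[of _ s]) (auto simp: complete_def simp flip: Recv(2))
  next
    case True
    \<comment> \<open>The last input on the channel is repeated: its recipe is still available, and
      there may be no other one.\<close>
    let ?B = "last (bproj c (singles tr))"
    have "?B \<in> set (singles tr)" using True set_bproj[of c "singles tr"] last_in_set[of "bproj c (singles tr)"] by blast
    then have "set (inputs ?B) \<subseteq> terms Sig (dom (snd s))"
      using bscoped_inputs[of "dom (snd s0)" "singles tr" ?B] Recv.prems by (simp add: grun_def)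
    then have M: "hd (inputs ?B) \<in> terms Sig (dom (snd s))" using True hd_in_set[of "inputs ?B"] by blast
    define M where "M = hd (inputs ?B)"
    let ?s = "((fst s)(c := k (recipe_val (snd s) M)), snd s)"
    have r: "grun run_part s0 (singles tr @ [Block c [M] []]) ?s"
      using grun_Recv[OF Recv.prems Recv.hyps(2)[symmetric]] M by (simp add: M_def)
    have "\<exists>tr2 s'. Tau \<notin> set tr2 \<and> grun run_part s0 (singles ((tr @ [Inp c M]) @ tr2)) s' \<and>
      complete c ((tr @ [Inp c M]) @ tr2) (fst s' c) \<and>
      (\<forall>c'. c' \<noteq> c \<longrightarrow> bproj c' (singles tr2) = [] \<and> fst s' c' = fst ?s c')"
      by (rule Recv.hyps(1)) (use r in simp_all)
    then obtain tr2 s' where "Tau \<notin> set tr2" "grun run_part s0 (singles (tr @ Inp c M # tr2)) s'"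
      "complete c (tr @ Inp c M # tr2) (fst s' c)"
      "\<And>c'. c' \<noteq> c \<Longrightarrow> bproj c' (singles tr2) = [] \<and> fst s' c' = fst s c'"
      by (auto simp: fun_upd_other)
    then show ?thesis by (intro exI[of _ "Inp c M # tr2"] exI[of _ s']) auto
  qed
qed

lemma complete_channels:
  fixes s0 :: "('c \<Rightarrow> ('f, 'n, 'x) msg beh) \<times> ('f, 'n, 'x, 'w :: infinite) frame"
  assumes "finite (dom (snd s0))" "grun run_part s0 (singles tr) s" "finite C"
  shows "\<exists>tr2 s'. Tau \<notin> set tr2 \<and> grun run_part s0 (singles (tr @ tr2)) s' \<and>
    (\<forall>c \<in> C. complete c (tr @ tr2) (fst s' c))"
  using assms(3)
proof induction
  case empty
  show ?case using assms(2) by (intro exI[of _ "[]"] exI[of _ s]) simp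
next
  case (insert c C)
  then obtain tr2 s' where s': "Tau \<notin> set tr2" "grun run_part s0 (singles (tr @ tr2)) s'"
    "\<And>c. c \<in> C \<Longrightarrow> complete c (tr @ tr2) (fst s' c)" by blast
  from complete_channel[OF assms(1) s'(2), of c] obtain tr3 t where
    t: "Tau \<notin> set tr3" "grun run_part s0 (singles ((tr @ tr2) @ tr3)) t"
    "complete c ((tr @ tr2) @ tr3) (fst t c)"
    "\<And>c'. c' \<noteq> c \<Longrightarrow> bproj c' (singles tr3) = [] \<and> fst t c' = fst s' c'" by blast
  have "complete c' (tr @ tr2 @ tr3) (fst t c')" if "c' \<in> insert c C" for c'
  proof (cases "c' = c")
    case False
    then show ?thesis using s'(3)[of c'] t(4)[of c'] that by (simp add: complete_def)
  qed (use t(3) in simp)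
  then show ?case using s'(1) t(1,2) by (intro exI[of _ "tr2 @ tr3"] exI[of _ t]) auto
qed

lemma flat_singles: "flat bl = singles (concat (map io bl))"
  by (simp add: flat_def singles_def)

lemma Tau_notin_io: "Tau \<notin> set (io B)"
  by (cases B) auto

lemma lrun_single_first:
  assumes "lrun run_part F (single_block a # bl) b = Some x" "\<not> is_Send b" "a \<noteq> Tau"
  shows "inputs (single_block a) \<noteq> []" "b \<noteq> Stop"
  using assms by (cases a; cases b; auto simp: run_part_def bind_eq_Some_conv)+

lemma bproj_singles_first:
  assumes "bproj c (singles tr) \<noteq> []" "Tau \<notin> set tr"
  obtains a bl where "bproj c (singles tr) = single_block a # bl" "a \<noteq> Tau"
proof -
  have "hd (bproj c (singles tr)) \<in> single_block ` set tr"
    using hd_in_set[OF assms(1)] set_bproj[of c "singles tr"] by (auto simp: singles_def)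
  then obtain a where "hd (bproj c (singles tr)) = single_block a" "a \<in> set tr" by blast
  with assms that show ?thesis by (metis list.collapse)
qed

section \<open>From inclusion of maximal runs to inclusion of traces\<close>

lemma part_incl_of_max_incl:
  fixes sA sB :: "('c :: linorder \<Rightarrow> ('f, 'n, 'x) msg beh) \<times> ('f, 'n, 'x, 'w :: infinite) frame"
  assumes "initial_state sA" "max_incl sA sB"
  shows "part_incl sA sB"
  unfolding part_incl_def
proof (intro allI impI)
  fix bl s assume "grun run_part sA bl s"
  define tr where "tr = concat (map io bl)"
  have s: "grun run_part sA (singles tr) s"
    using \<open>grun run_part sA bl s\<close> by (simp add: tr_def grun_flat flip: flat_singles)
  have finA: "finite (dom (snd sA))" "finite {c. fst sA c \<noteq> Stop}" and ns: "\<And>c. \<not> is_Send (fst sA c)"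
    using assms(1) by (auto simp: initial_state_def)
  \<comment> \<open>Finitely many channels are active, and the completion of one leaves the others
    as they are.\<close>
  obtain tr2 s2 where tr2: "Tau \<notin> set tr2" and s2: "grun run_part sA (singles (tr @ tr2)) s2"
    and compl0: "\<And>c. c \<in> {c. fst sA c \<noteq> Stop} \<Longrightarrow> complete c (tr @ tr2) (fst s2 c)"
    using complete_channels[OF finA(1) s finA(2)] by blast
  define t where "t = tr @ tr2"
  have tau: "Tau \<notin> set t" using tr2 by (simp add: t_def tr_def Tau_notin_io)
  have lr: "lrun run_part (snd s2) (bproj c (singles t)) (fst sA c) = Some (fst s2 c)" for c
    using s2 by (simp only: grun_def t_def)
  have first: "inputs (hd (bproj c (singles t))) \<noteq> [] \<and> fst sA c \<noteq> Stop"
    if ne: "bproj c (singles t) \<noteq> []" for c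
  proof -
    obtain a bl where a: "bproj c (singles t) = single_block a # bl" "a \<noteq> Tau"
      by (rule bproj_singles_first[OF ne tau])
    show ?thesis using lrun_single_first[OF lr[of c, unfolded a(1)] ns a(2)] a(1) by simp
  qed
  have compl: "complete c t (fst s2 c)" for c
  proof (cases "fst sA c = Stop")
    case True
    then have "bproj c (singles t) = []" using first by blast
    then show ?thesis using lr[of c] True by (simp add: complete_def)
  qed (use compl0 in \<open>simp add: t_def\<close>)
  have sc: "bscoped (dom (snd sA)) (singles t)" using s2 by (simp add: grun_def t_def)
  obtain bl0 pend where bl0: "bscoped (dom (snd sA)) bl0"
    "\<And>B. B \<in> set bl0 \<Longrightarrow> inputs B \<noteq> [] \<and> outputs B \<noteq> []" "bouts bl0 = bouts (singles t)"
    and proj: "\<And>c. bproj c (singles t) = flat (bproj c bl0) @ singles (map (Inp c) (pend c))"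
    and pend: "\<And>c. set (pend c) \<subseteq> terms Sig (dom (snd sA) \<union> bouts bl0)"
    using decompose_blocks[OF sc tau] first by blast
  have dom2: "dom (snd s2) = dom (snd sA) \<union> bouts bl0"
    using s2 bl0(3) by (simp add: grun_def t_def)
  \<comment> \<open>The state of each channel after its blocks and before its pending
    inputs.\<close>
  define \<beta> where "\<beta> = (\<lambda>c. the (lrun run_part (snd s2) (bproj c bl0) (fst sA c)))"
  have b: "lrun run_part (snd s2) (bproj c bl0) (fst sA c) = Some (\<beta> c)"
    and ins: "beh_ins (\<beta> c) (map (recipe_val (snd s2)) (pend c)) = Some (fst s2 c)" for c
    using lr[of c] unfolding proj
    by (auto simp: lrun_append lrun_flat bind_eq_Some_conv \<beta>_def lrun_singles_Inps)
  have nSend: "\<not> is_Send (\<beta> c)" for c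
  proof (cases "pend c")
    case Nil
    then show ?thesis using ins[of c] compl[of c] by (simp add: complete_def)
  next
    case (Cons M Ms)
    then show ?thesis using ins[of c] by (auto split: beh.splits)
  qed
  \<comment> \<open>This is where completeness turns the pending inputs into an improper
    block.\<close>
  have stop: "fst s2 c = Stop" if "pend c \<noteq> []" for c
  proof -
    have "last (bproj c (singles t)) = Block c [last (pend c)] []"
      using that by (simp add: proj) (simp add: singles_def last_map)
    moreover have "bproj c (singles t) \<noteq> []" using that by (simp add: proj)
    ultimately show ?thesis using compl[of c] by (simp add: complete_def)
  qed
  have "lrun run_max (snd s2) (bproj c bl0) (fst sA c) = Some (\<beta> c)" for c
    by (rule lrun_part_imp_max[OF b nSend]) (use bl0(2) set_bproj[of c bl0] in blast)
  then have "grun run_max sA bl0 (\<beta>, snd s2)"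
    using s2 bl0(1,3) by (simp add: grun_def t_def)
  from depok_reorder[OF this] obtain bl1 where bl1: "grun run_max sA bl1 (\<beta>, snd s2)"
    "depok (dom (snd sA)) (snd s2) bl1" "bouts bl1 = bouts bl0"
    "\<And>c. map (block_val (snd s2)) (bproj c bl1) = map (block_val (snd s2)) (bproj c bl0)"
    by auto
  then have "frun sA bl1 (snd s2)" unfolding frun_def by blast
  then obtain F' where F': "frun sB bl1 F'" "aeq (snd s2) F'"
    using assms(2) bl1(2) unfolding max_incl_def by blast
  \<comment> \<open>All these blocks have outputs, so the run of \<open>sB\<close> cannot end with
    an improper block.\<close>
  have ne1: "outputs B \<noteq> []" if "B \<in> set bl1" for B
  proof -
    have "lrun run_max (snd s2) (bproj (chan B) bl1) (fst sA (chan B)) = Some (\<beta> (chan B))"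
      using bl1(1) by (simp add: grun_def)
    from lrun_max_nonempty[OF this, of B] show ?thesis using that by (simp add: bproj_def)
  qed
  from F'(1) obtain \<beta>' where \<beta>': "grun run_max sB bl1 (\<beta>', F')"
    unfolding frun_def using ne1 by fastforce
  have domB: "dom (snd sB) = dom (snd sA)"
    using grun_dom0[OF \<beta>'] grun_dom0[OF bl1(1)] F'(2) by (simp add: aeq_def)
  \<comment> \<open>Combines the improper blocks of all channels, each of which is compared
    separately below. In the concrete semantics a stopped channel leaves the others alone, so this
    is a state that \<open>sB\<close> can reach.\<close>
  define \<gamma> where "\<gamma> = (\<lambda>c. if pend c = [] then \<beta>' c else Stop)"
  have "lrun run_part F' (bproj c (singles t)) (fst sB c) = Some (\<gamma> c)" for c
  proof -
    \<comment> \<open>Leads from the reordered blocks with modified recipes back to the blocks of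
      the trace; static equivalence carries the equality of values over to
      \<open>F'\<close>.\<close>
    have "map (block_val F') (bproj c bl1) = map (block_val F') (bproj c bl0)"
    proof (rule map_block_val_aeq[OF F'(2) _ bl1(4)])
      fix B assume "B \<in> set (bproj c bl1) \<union> set (bproj c bl0)"
      then have "B \<in> set bl1 \<or> B \<in> set bl0" by (auto simp: bproj_def)
      moreover have "bscoped (dom (snd sA)) bl1" using bl1(1) by (simp add: grun_def)
      ultimately show "set (inputs B) \<subseteq> terms Sig (dom (snd s2))"
        using bscoped_inputs[OF bl0(1), of B] bscoped_inputs[of "dom (snd sA)" bl1 B] bl1(3)
        unfolding dom2 by metis
    qed
    then have "lrun run_max F' (bproj c bl0) = lrun run_max F' (bproj c bl1)"
      by (metis lrun_cong)
    then have "lrun run_max F' (bproj c bl0) (fst sB c) = Some (\<beta>' c)"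
      using \<beta>' by (simp add: grun_def)
    then have l: "lrun run_part F' (bproj c bl0) (fst sB c) = Some (\<beta>' c)"
      by (rule lrun_max_imp_part)
    have "beh_ins (\<beta>' c) (map (recipe_val F') (pend c)) = Some (\<gamma> c)"
    proof (cases "pend c = []")
      case False
      have "beh_ins (fst (\<beta>', F') c) (map (recipe_val (snd (\<beta>', F'))) (pend c)) = Some Stop"
        by (rule improper_transfer[OF assms(2) bl1(1) \<beta>'])
           (use bl1(2) F'(2) False pend[of c] ins[of c] stop[OF False] in \<open>simp_all add: dom2\<close>)
      then show ?thesis using False by (simp add: \<gamma>_def)
    qed (simp add: \<gamma>_def)
    with l show ?thesis
      by (simp add: proj lrun_append lrun_flat lrun_singles_Inps)
  qed
  moreover have "dom F' = dom (snd sB) \<union> bouts (singles t)"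
    using F'(2) dom2 domB bl0(3) by (simp add: aeq_def)
  moreover have "snd sB \<subseteq>\<^sub>m F'" using \<beta>' by (simp add: grun_def)
  ultimately have "grun run_part sB (singles t) (\<gamma>, F')" using sc domB by (simp add: grun_def)
  \<comment> \<open>The extension is cut off again, and the frames are restricted
    accordingly.\<close>
  then obtain s' where s': "grun run_part sB (singles tr) s'" "snd s' \<subseteq>\<^sub>m F'"
    using grun_append[of run_part sB "singles tr" "singles tr2" "(\<gamma>, F')"] by (auto simp: t_def)
  have "snd s \<subseteq>\<^sub>m snd s2"
    using grun_frame_agree[OF _ s deterministic_run_part] s2 by simp
  moreover have "dom (snd s) = dom (snd s')" using grun_dom[OF s] grun_dom[OF s'(1)] domB by simp
  ultimately have "aeq (snd s) (snd s')" using aeq_restrict[OF F'(2) _ s'(2)] by blast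
  moreover have "grun run_part sB bl s'"
    using s'(1) by (simp add: tr_def grun_flat flip: flat_singles)
  ultimately show "\<exists>s'. grun run_part sB bl s' \<and> aeq (snd s) (snd s')" by blast
qed

section \<open>Concrete semantics\<close>


text \<open>Indexing by channels, with \<open>PNull\<close> for an absent process, turns a step into
  a function update and gives each channel its tree.\<close>

definition procs_rep :: "('c, 'f, 'n, 'x) proc multiset \<Rightarrow> ('c \<Rightarrow> ('c, 'f, 'n, 'x) proc) \<Rightarrow> bool" where
  "procs_rep \<P> f \<longleftrightarrow> finite {c. f c \<noteq> PNull} \<and> (\<forall>c. basic_on c (f c)) \<and>
     \<P> = image_mset f (mset_set {c. f c \<noteq> PNull})"

lemma procs_rep_split:
  assumes "procs_rep \<P> f" "f c \<noteq> PNull"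
  obtains \<R> where "\<P> = {#f c#} + \<R>" "\<And>Q. basic_on c Q \<Longrightarrow> procs_rep (single Q + \<R>) (f(c := Q))"
proof -
  let ?S = "{c. f c \<noteq> PNull}"
  define \<R> where "\<R> = image_mset f (mset_set (?S - {c}))"
  have fin: "finite ?S" using assms(1) by (simp add: procs_rep_def)
  have S: "?S = insert c (?S - {c})" using assms(2) by auto
  have ins: "mset_set (insert c (?S - {c})) = add_mset c (mset_set (?S - {c}))"
    by (rule mset_set.insert) (use fin in auto)
  then have "mset_set ?S = add_mset c (mset_set (?S - {c}))" unfolding S[symmetric] .
  then have "\<P> = {#f c#} + \<R>" using assms(1) by (simp add: procs_rep_def \<R>_def)
  moreover have "procs_rep (single Q + \<R>) (f(c := Q))" if "basic_on c Q" for Q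
  proof -
    let ?f = "f(c := Q)"
    have \<R>: "\<R> = image_mset ?f (mset_set (?S - {c}))"
      unfolding \<R>_def using fin by (intro image_mset_cong) auto
    have "{c. ?f c \<noteq> PNull} = (if Q = PNull then ?S - {c} else insert c (?S - {c}))" by auto
    then have "single Q + \<R> = image_mset ?f (mset_set {c. ?f c \<noteq> PNull})"
      unfolding \<R> using ins by (simp add: single_def)
    moreover have "finite {c. ?f c \<noteq> PNull}"
      by (rule finite_subset[of _ "insert c ?S"]) (use fin in auto)
    moreover have "\<forall>d. basic_on d (?f d)" using assms(1) \<open>basic_on c Q\<close> by (simp add: procs_rep_def)
    ultimately show ?thesis unfolding procs_rep_def by blast
  qed
  ultimately show ?thesis by (rule that)
qed

text \<open>The channel need not be unique: a test with null branches is a basic process on every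
  channel. Any choice leaves the same remaining multiset.\<close>

lemma procs_rep_member:
  assumes "procs_rep ({#P#} + \<R>) f"
  obtains c where "f c = P" "P \<noteq> PNull" "\<And>Q. basic_on c Q \<Longrightarrow> procs_rep (single Q + \<R>) (f(c := Q))"
proof -
  have eq: "{#P#} + \<R> = image_mset f (mset_set {c. f c \<noteq> PNull})" and fin: "finite {c. f c \<noteq> PNull}"
    using assms by (simp_all only: procs_rep_def)
  have "P \<in># {#P#} + \<R>" by simp
  then obtain c where c: "f c = P" "P \<noteq> PNull"
    unfolding eq using fin by auto
  obtain \<R>' where "{#P#} + \<R> = {#f c#} + \<R>'"
    "\<And>Q. basic_on c Q \<Longrightarrow> procs_rep (single Q + \<R>') (f(c := Q))"
    by (rule procs_rep_split[OF assms, of c]) (simp_all add: c)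
  with c show ?thesis by (intro that[of c]) simp_all
qed

definition closed_rep ::
    "('c, 'f, 'n, 'x, 'w) eproc \<Rightarrow> ('c \<Rightarrow> ('c, 'f, 'n, 'x) proc) \<Rightarrow> bool" where
  "closed_rep A f \<longleftrightarrow> procs_rep (fst A) f \<and> (\<forall>c. fv_proc (f c) = {}) \<and> ran (snd A) \<subseteq> ground_messages"

text \<open>One reading for both semantics: concrete processes are taken with the empty
  substitution, symbolic ones with a first-order solution.\<close>

definition abs_state ::
    "('c \<Rightarrow> ('c, 'f, 'n, 'x) proc) \<Rightarrow> ('f, 'n, 'x) fo_subst \<Rightarrow> ('f, 'n, 'x, 'w) frame \<Rightarrow>
     ('c \<Rightarrow> ('f, 'n, 'x) msg beh) \<times> ('f, 'n, 'x, 'w) frame" where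
  "abs_state f \<mu> \<Phi> = (\<lambda>c. den (f c) \<mu>, val_frame (fsubst \<mu> \<Phi>))"

lemma dom_fsubst [simp]: "dom (fsubst \<mu> \<Phi>) = dom \<Phi>"
  by (auto simp: fsubst_def)

lemma fsubst_ground: "ran \<Phi> \<subseteq> ground_messages \<Longrightarrow> fsubst \<mu> \<Phi> = \<Phi>"
proof
  fix w assume "ran \<Phi> \<subseteq> ground_messages"
  then show "fsubst \<mu> \<Phi> w = \<Phi> w"
    by (cases "\<Phi> w") (auto simp: fsubst_def ran_def ground_messages_iff intro!: msubst_ground)
qed

lemma closed_rep_upd_Tau:
  assumes "closed_rep ({#PIf u v P Q#} + \<R>, \<Phi>) f" "R = (if u =\<^sub>E v then P else Q)"
  obtains c where "f c = PIf u v P Q" "closed_rep (single R + \<R>, \<Phi>) (f(c := R))"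
    "den (f c) Map.empty = den R Map.empty"
proof -
  have "procs_rep ({#PIf u v P Q#} + \<R>) f" using assms(1) by (simp add: closed_rep_def)
  then obtain c where c: "f c = PIf u v P Q"
    "\<And>Q. basic_on c Q \<Longrightarrow> procs_rep (single Q + \<R>) (f(c := Q))"
    by (rule procs_rep_member) (rule that; assumption)
  have "basic_on c (f c)" using assms(1) by (simp add: closed_rep_def procs_rep_def)
  then have b: "basic_on c P" "basic_on c Q" unfolding c(1) by (auto elim: basic_on_PIfE)
  have "fv_proc (f c) = {}" using assms(1) by (simp add: closed_rep_def)
  then have fv: "fv u = {}" "fv v = {}" "fv_proc P = {}" "fv_proc Q = {}" by (auto simp: c(1))
  have "closed_rep (single R + \<R>, \<Phi>) (f(c := R))"
    using assms b fv c(2)[of R] by (simp add: closed_rep_def)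
  moreover have "den (f c) Map.empty = den R Map.empty"
    using fv assms(2) by (simp add: c(1) msubst_ground)
  ultimately show ?thesis using c(1) that by blast
qed

lemma abs_state_upd:
  "den (f c) \<mu> = den R \<mu> \<Longrightarrow> abs_state (f(c := R)) \<mu> \<Phi> = abs_state f \<mu> \<Phi>"
  by (auto simp: abs_state_def fun_eq_iff)

lemma closed_In:
  assumes "closed_rep (\<P>, \<Phi>) f" "f c = PIn d x Q" "M \<in> terms Sig (dom \<Phi>)"
  defines "t \<equiv> recipe_msg \<Phi> M"
  shows "d = c" "basic_on c (psubst x t Q)" "fv_proc (psubst x t Q) = {}"
    "gstep run_part (abs_state f Map.empty \<Phi>) (Block c [M] [])
       (abs_state (f(c := psubst x t Q)) Map.empty \<Phi>)"
proof -
  have "basic_on c (PIn d x Q)" using assms(1,2) by (metis closed_rep_def fst_conv procs_rep_def)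
  then show d: "d = c" by (auto elim: basic_on_PInE)
  have b: "basic_on c Q" using \<open>basic_on c (PIn d x Q)\<close> by (auto elim: basic_on_PInE)
  have g: "ran \<Phi> \<subseteq> ground_messages" using assms(1) by (simp add: closed_rep_def)
  then have t: "t \<in> messages" "fv t = {}"
    using recipe_msg_ground[OF g assms(3)] by (auto simp: t_def ground_messages_iff)
  show "basic_on c (psubst x t Q)" using b t(1) by (rule basic_on_psubst)
  have "fv_proc (f c) = {}" using assms(1) by (simp add: closed_rep_def)
  then show "fv_proc (psubst x t Q) = {}" using fv_proc_psubst[of x t Q] t(2) by (auto simp: assms(2))
  have "den (psubst x t Q) Map.empty = den Q [x \<mapsto> t]"
    using den_psubst[of t Q x Map.empty] t(2) by (simp add: msubst_ground)
  also have "\<dots> = den Q [x \<mapsto> canon t]" using den_canon[OF b t(1), of Map.empty x] by simp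
  finally have den: "den (psubst x t Q) Map.empty = den Q [x \<mapsto> canon t]" .
  have rv: "recipe_val (val_frame \<Phi>) M = canon t"
    using recipe_val_val_frame[of \<Phi> M] g ground_messages_subset assms(3) by (auto simp: t_def)
  have fs: "fsubst Map.empty \<Phi> = \<Phi>" using g by (rule fsubst_ground)
  show "gstep run_part (abs_state f Map.empty \<Phi>) (Block c [M] [])
       (abs_state (f(c := psubst x t Q)) Map.empty \<Phi>)"
    using assms(3) canon_messages[OF t(1)]
    by (auto simp: gstep_def abs_state_def fs assms(2) run_part_def rv den)
qed

lemma closed_Out:
  assumes "closed_rep (\<P>, \<Phi>) f" "f c = POut d u Q" "w \<notin> dom \<Phi>"
  shows "d = c" "basic_on c Q" "fv_proc Q = {}" "ran (\<Phi>(w \<mapsto> u)) \<subseteq> ground_messages"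
    "gstep run_part (abs_state f Map.empty \<Phi>) (Block c [] [w])
       (abs_state (f(c := Q)) Map.empty (\<Phi>(w \<mapsto> u)))"
proof -
  have "basic_on c (POut d u Q)" using assms(1,2) by (metis closed_rep_def fst_conv procs_rep_def)
  then have *: "d = c \<and> basic_on c Q \<and> u \<in> messages" by (auto elim: basic_on_POutE)
  then show "d = c" "basic_on c Q" by simp_all
  from * have u: "u \<in> messages" by simp
  have "fv_proc (f c) = {}" using assms(1) by (simp add: closed_rep_def)
  then show "fv_proc Q = {}" by (simp add: assms(2))
  have fv: "fv u = {}" using \<open>fv_proc (f c) = {}\<close> by (simp add: assms(2))
  have g: "ran \<Phi> \<subseteq> ground_messages" using assms(1) by (simp add: closed_rep_def)
  with u fv assms(3) show g': "ran (\<Phi>(w \<mapsto> u)) \<subseteq> ground_messages"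
    by (auto simp: ground_messages_iff domIff)
  have fs: "fsubst Map.empty \<Phi> = \<Phi>" "fsubst Map.empty (\<Phi>(w \<mapsto> u)) = \<Phi>(w \<mapsto> u)"
    using fsubst_ground g g' by blast+
  have "map_le (val_frame \<Phi>) ((val_frame \<Phi>)(w \<mapsto> canon u))"
    using assms(3) by (auto simp: map_le_def)
  then show "gstep run_part (abs_state f Map.empty \<Phi>) (Block c [] [w])
       (abs_state (f(c := Q)) Map.empty (\<Phi>(w \<mapsto> u)))"
    using assms(3) fv
    by (auto simp: gstep_def abs_state_def fs assms(2) run_part_def val_frame_upd msubst_ground)
qed

lemma step_gstep:
  assumes "step A a B" "closed_rep A f"
  shows "\<exists>f'. closed_rep B f' \<and>
    (if a = Tau then abs_state f' Map.empty (snd B) = abs_state f Map.empty (snd A)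
     else gstep run_part (abs_state f Map.empty (snd A)) (single_block a) (abs_state f' Map.empty (snd B)))"
  using assms
proof cases
  case (step_then u v Q1 Q2 \<P> \<Phi>)
  obtain c where "closed_rep (single Q1 + \<P>, \<Phi>) (f(c := Q1))" "den (f c) Map.empty = den Q1 Map.empty"
    by (rule closed_rep_upd_Tau[of u v Q1 Q2 \<P> \<Phi> f Q1]) (use step_then assms(2) in auto)
  then show ?thesis using step_then abs_state_upd by (intro exI[of _ "f(c := Q1)"]) auto
next
  case (step_else u v Q1 Q2 \<P> \<Phi>)
  obtain c where "closed_rep (single Q2 + \<P>, \<Phi>) (f(c := Q2))" "den (f c) Map.empty = den Q2 Map.empty"
    by (rule closed_rep_upd_Tau[of u v Q1 Q2 \<P> \<Phi> f Q2]) (use step_else assms(2) in auto)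
  then show ?thesis using step_else abs_state_upd by (intro exI[of _ "f(c := Q2)"]) auto
next
  case (step_in M \<Phi> d x Q \<P>)
  have "procs_rep ({#PIn d x Q#} + \<P>) f" using assms(2) step_in by (simp add: closed_rep_def)
  then obtain c where c: "f c = PIn d x Q"
    "\<And>Q. basic_on c Q \<Longrightarrow> procs_rep (single Q + \<P>) (f(c := Q))"
    by (rule procs_rep_member) (rule that; assumption)
  have cl: "closed_rep ({#PIn d x Q#} + \<P>, \<Phi>) f" using assms(2) step_in by simp
  note I = closed_In[OF cl c(1) step_in(4)]
  have "closed_rep B (f(c := psubst x (recipe_msg \<Phi> M) Q))"
    using cl I(3) c(2)[OF I(2)] by (auto simp: step_in closed_rep_def)
  then show ?thesis using I(1,4) by (intro exI[of _ "f(c := psubst x (recipe_msg \<Phi> M) Q)"]) (simp add: step_in)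
next
  case (step_out w \<Phi> d u Q \<P>)
  have "procs_rep ({#POut d u Q#} + \<P>) f" using assms(2) step_out by (simp add: closed_rep_def)
  then obtain c where c: "f c = POut d u Q"
    "\<And>Q. basic_on c Q \<Longrightarrow> procs_rep (single Q + \<P>) (f(c := Q))"
    by (rule procs_rep_member) (rule that; assumption)
  have cl: "closed_rep ({#POut d u Q#} + \<P>, \<Phi>) f" using assms(2) step_out by simp
  note O = closed_Out[OF cl c(1) step_out(4)]
  have "closed_rep B (f(c := Q))"
    using cl O(3,4) c(2)[OF O(2)] by (auto simp: step_out closed_rep_def)
  then show ?thesis using O(1,5) by (intro exI[of _ "f(c := Q)"]) (simp add: step_out)
qed

lemma steps_grun:
  "steps A as B \<Longrightarrow> closed_rep A f \<Longrightarrow> grun run_part s0 tr (abs_state f Map.empty (snd A)) \<Longrightarrow>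
   \<exists>f'. closed_rep B f' \<and>
     grun run_part s0 (tr @ singles (filter (\<lambda>a. a \<noteq> Tau) as)) (abs_state f' Map.empty (snd B))"
proof (induction arbitrary: f tr rule: steps.induct)
  case (1 A)
  then show ?case by (intro exI[of _ f]) simp
next
  case (2 A a B as C)
  from step_gstep[OF 2(1,4)] obtain f' where f': "closed_rep B f'"
    "if a = Tau then abs_state f' Map.empty (snd B) = abs_state f Map.empty (snd A)
     else gstep run_part (abs_state f Map.empty (snd A)) (single_block a) (abs_state f' Map.empty (snd B))"
    by blast
  show ?case
  proof (cases "a = Tau")
    case True
    then show ?thesis using "2.IH"[OF f'(1), of tr] f'(2) "2.prems"(2) by simp
  next
    case False
    then have "grun run_part s0 (tr @ [single_block a]) (abs_state f' Map.empty (snd B))"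
      unfolding grun_snoc using f'(2) "2.prems"(2)
      by (intro exI[of _ "abs_state f Map.empty (snd A)"]) simp
    from "2.IH"[OF f'(1) this] False show ?thesis by simp
  qed
qed

lemma steps_append: "steps A as B \<Longrightarrow> steps B bs C \<Longrightarrow> steps A (as @ bs) C"
  by (induction rule: steps.induct) (auto intro: steps.intros)

text \<open>The next action in the tree may be hidden behind tests of the process. These are
  executed first and do not change the state.\<close>

lemma steps_Tau:
  assumes "closed_rep (\<P>, \<Phi>) f"
  shows "\<exists>n \<P>' f'. steps (\<P>, \<Phi>) (replicate n Tau) (\<P>', \<Phi>) \<and> closed_rep (\<P>', \<Phi>) f' \<and>
    abs_state f' Map.empty \<Phi> = abs_state f Map.empty \<Phi> \<and> (\<forall>u v P Q. f' c \<noteq> PIf u v P Q)"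
  using assms
proof (induction "f c" arbitrary: f \<P>)
  case (PIf u v P Q)
  have rep: "procs_rep \<P> f" using PIf.prems by (simp add: closed_rep_def)
  obtain \<R> where \<R>: "\<P> = {#f c#} + \<R>"
    by (rule procs_rep_split[OF rep, of c]) (simp add: PIf.hyps(3)[symmetric])
  define R where "R = (if u =\<^sub>E v then P else Q)"
  have st: "step (\<P>, \<Phi>) Tau (single R + \<R>, \<Phi>)"
    unfolding \<R> PIf.hyps(3)[symmetric] R_def using step_then step_else by auto
  have bas: "basic_on c (PIf u v P Q)" using rep PIf.hyps(3) by (metis procs_rep_def)
  have fv: "fv_proc (PIf u v P Q) = {}" using PIf.prems PIf.hyps(3) by (metis closed_rep_def)
  have cl: "closed_rep (single R + \<R>, \<Phi>) (f(c := R))"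
  proof -
    obtain \<R>' where "\<P> = {#f c#} + \<R>'" "\<And>Q. basic_on c Q \<Longrightarrow> procs_rep (single Q + \<R>') (f(c := Q))"
      by (rule procs_rep_split[OF rep, of c]) (simp_all add: PIf.hyps(3)[symmetric])
    then show ?thesis using PIf.prems bas fv \<R> by (auto simp: closed_rep_def R_def elim: basic_on_PIfE)
  qed
  have abs: "abs_state (f(c := R)) Map.empty \<Phi> = abs_state f Map.empty \<Phi>"
    using fv by (intro abs_state_upd) (simp add: PIf.hyps(3)[symmetric] R_def msubst_ground)
  have "\<exists>n \<P>' f'. steps (single R + \<R>, \<Phi>) (replicate n Tau) (\<P>', \<Phi>) \<and> closed_rep (\<P>', \<Phi>) f' \<and>
    abs_state f' Map.empty \<Phi> = abs_state (f(c := R)) Map.empty \<Phi> \<and> (\<forall>u v P Q. f' c \<noteq> PIf u v P Q)"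
    using PIf.hyps(1)[of "f(c := R)"] PIf.hyps(2)[of "f(c := R)"] cl by (cases "u =\<^sub>E v") (simp_all add: R_def)
  then obtain n \<P>' f' where "steps (single R + \<R>, \<Phi>) (replicate n Tau) (\<P>', \<Phi>)" "closed_rep (\<P>', \<Phi>) f'"
    "abs_state f' Map.empty \<Phi> = abs_state f Map.empty \<Phi>" "\<forall>u v P Q. f' c \<noteq> PIf u v P Q"
    using abs by auto
  moreover have "steps (\<P>, \<Phi>) (replicate (Suc n) Tau) (\<P>', \<Phi>)"
    using st calculation(1) by (auto intro: steps.intros)
  ultimately show ?case by blast
next
  case PNull
  then show ?case
    by (intro exI[of _ 0] exI[of _ \<P>] exI[of _ f]) (auto intro: steps.intros simp flip: PNull(1))
next
  case (PIn d x P)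
  then show ?case
    by (intro exI[of _ 0] exI[of _ \<P>] exI[of _ f]) (auto intro: steps.intros simp flip: PIn(2))
next
  case (POut d u P)
  then show ?case
    by (intro exI[of _ 0] exI[of _ \<P>] exI[of _ f]) (auto intro: steps.intros simp flip: POut(2))
qed

lemma gstep_step:
  assumes "closed_rep (\<P>, \<Phi>) f" "gstep run_part (abs_state f Map.empty \<Phi>) (single_block a) s'" "a \<noteq> Tau"
  shows "\<exists>as \<P>' \<Phi>' f'. steps (\<P>, \<Phi>) as (\<P>', \<Phi>') \<and> filter (\<lambda>a. a \<noteq> Tau) as = [a] \<and>
    closed_rep (\<P>', \<Phi>') f' \<and> abs_state f' Map.empty \<Phi>' = s'"
proof -
  define c where "c = chan (single_block a)"
  from steps_Tau[OF assms(1), of c] obtain n \<P>1 f1 where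
    tau: "steps (\<P>, \<Phi>) (replicate n Tau) (\<P>1, \<Phi>)" and f1: "closed_rep (\<P>1, \<Phi>) f1"
    "abs_state f1 Map.empty \<Phi> = abs_state f Map.empty \<Phi>" "\<And>u v P Q. f1 c \<noteq> PIf u v P Q" by blast
  have gs: "gstep run_part (abs_state f1 Map.empty \<Phi>) (single_block a) s'" using assms(2) f1(2) by simp
  have rep: "procs_rep \<P>1 f1" using f1(1) by (simp add: closed_rep_def)
  have "\<exists>\<P>' \<Phi>' f'. step (\<P>1, \<Phi>) a (\<P>', \<Phi>') \<and> closed_rep (\<P>', \<Phi>') f' \<and> abs_state f' Map.empty \<Phi>' = s'"
  proof (cases a)
    case (Inp c' M)
    then have [simp]: "c' = c" by (simp add: c_def)
    have M: "M \<in> terms Sig (dom \<Phi>)" using gs by (simp add: Inp gstep_def abs_state_def)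
    have "\<exists>k. den (f1 c) Map.empty = Recv k"
      using gs by (auto simp: Inp gstep_def abs_state_def run_part_def split: beh.splits)
    then obtain d x Q where Q: "f1 c = PIn d x Q" using f1(3) by (cases "f1 c") auto
    note I = closed_In[OF f1(1) Q M]
    obtain \<R> where \<R>: "\<P>1 = {#f1 c#} + \<R>" "\<And>Q. basic_on c Q \<Longrightarrow> procs_rep (single Q + \<R>) (f1(c := Q))"
      by (rule procs_rep_split[OF rep, of c]) (simp_all add: Q)
    have "step (\<P>1, \<Phi>) a (single (psubst x (recipe_msg \<Phi> M) Q) + \<R>, \<Phi>)"
      using step_in[OF M, of c x Q \<R>] I(1) by (simp add: Inp \<R>(1) Q)
    moreover have "closed_rep (single (psubst x (recipe_msg \<Phi> M) Q) + \<R>, \<Phi>) (f1(c := psubst x (recipe_msg \<Phi> M) Q))"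
      using f1(1) I(3) \<R>(2)[OF I(2)] by (simp add: closed_rep_def)
    moreover have "abs_state (f1(c := psubst x (recipe_msg \<Phi> M) Q)) Map.empty \<Phi> = s'"
      using gstep_deterministic[OF deterministic_run_part I(4)] gs by (simp add: Inp)
    ultimately show ?thesis by blast
  next
    case (Outp c' w)
    then have [simp]: "c' = c" by (simp add: c_def)
    have w: "w \<notin> dom \<Phi>" using gs by (auto simp: Outp gstep_def abs_state_def)
    have "\<exists>v b. den (f1 c) Map.empty = Send v b"
      using gs by (auto simp: Outp gstep_def abs_state_def run_part_def split: beh.splits)
    then obtain d u Q where Q: "f1 c = POut d u Q" using f1(3) by (cases "f1 c") auto
    note O = closed_Out[OF f1(1) Q w]
    obtain \<R> where \<R>: "\<P>1 = {#f1 c#} + \<R>" "\<And>Q. basic_on c Q \<Longrightarrow> procs_rep (single Q + \<R>) (f1(c := Q))"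
      by (rule procs_rep_split[OF rep, of c]) (simp_all add: Q)
    have "step (\<P>1, \<Phi>) a (single Q + \<R>, \<Phi>(w \<mapsto> u))"
      using step_out[OF w, of c u Q \<R>] O(1) by (simp add: Outp \<R>(1) Q)
    moreover have "closed_rep (single Q + \<R>, \<Phi>(w \<mapsto> u)) (f1(c := Q))"
      using f1(1) O(3,4) \<R>(2)[OF O(2)] by (simp add: closed_rep_def)
    moreover have "abs_state (f1(c := Q)) Map.empty (\<Phi>(w \<mapsto> u)) = s'"
    proof (rule gstep_deterministic[OF deterministic_run_part O(5)])
      show "gstep run_part (abs_state f1 Map.empty \<Phi>) (Block c [] [w]) s'" using gs by (simp add: Outp)
    qed
    ultimately show ?thesis by blast
  qed (use assms(3) in simp)
  then obtain \<P>' \<Phi>' f' where "step (\<P>1, \<Phi>) a (\<P>', \<Phi>')" "closed_rep (\<P>', \<Phi>') f'"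
    "abs_state f' Map.empty \<Phi>' = s'" by blast
  moreover have "steps (\<P>, \<Phi>) (replicate n Tau @ [a]) (\<P>', \<Phi>')"
    by (rule steps_append[OF tau]) (use calculation(1) in \<open>auto intro: steps.intros\<close>)
  moreover have "filter (\<lambda>a. a \<noteq> Tau) (replicate n Tau @ [a]) = [a]" using assms(3) by simp
  ultimately show ?thesis by blast
qed

lemma grun_trace:
  assumes "closed_rep (\<P>, \<Phi>) f"
  shows "grun run_part (abs_state f Map.empty \<Phi>) (singles tr) s \<Longrightarrow> Tau \<notin> set tr \<Longrightarrow>
    \<exists>\<P>' \<Phi>' f'. trace (\<P>, \<Phi>) tr (\<P>', \<Phi>') \<and> closed_rep (\<P>', \<Phi>') f' \<and> abs_state f' Map.empty \<Phi>' = s"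
proof (induction tr arbitrary: s rule: rev_induct)
  case Nil
  then show ?case using assms
    by (intro exI[of _ \<P>] exI[of _ \<Phi>] exI[of _ f]) (auto simp: grun_Nil trace_def intro: steps.intros exI[of _ "[]"])
next
  case (snoc a tr)
  then obtain s1 where s1: "grun run_part (abs_state f Map.empty \<Phi>) (singles tr) s1"
    "gstep run_part s1 (single_block a) s"
    by (auto simp: grun_snoc)
  obtain \<P>1 \<Phi>1 f1 where
    1: "trace (\<P>, \<Phi>) tr (\<P>1, \<Phi>1)" "closed_rep (\<P>1, \<Phi>1) f1" "abs_state f1 Map.empty \<Phi>1 = s1"
    using snoc.IH[OF s1(1)] snoc.prems(2) by auto
  from 1(1) obtain as where as: "steps (\<P>, \<Phi>) as (\<P>1, \<Phi>1)" "tr = filter (\<lambda>a. a \<noteq> Tau) as"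
    by (auto simp: trace_def)
  from gstep_step[OF 1(2), of a s] s1(2) 1(3) snoc.prems(2) obtain bs \<P>' \<Phi>' f' where
    "steps (\<P>1, \<Phi>1) bs (\<P>', \<Phi>')" "filter (\<lambda>a. a \<noteq> Tau) bs = [a]" "closed_rep (\<P>', \<Phi>') f'"
    "abs_state f' Map.empty \<Phi>' = s" by auto
  moreover have "trace (\<P>, \<Phi>) (tr @ [a]) (\<P>', \<Phi>')"
    unfolding trace_def using steps_append[OF as(1) calculation(1)] as(2) calculation(2)
    by (intro exI[of _ "as @ bs"]) simp
  ultimately show ?case by blast
qed

lemma trace_grun:
  assumes "closed_rep A f" "trace A tr B"
  shows "Tau \<notin> set tr" "\<exists>f'. closed_rep B f' \<and>
    grun run_part (abs_state f Map.empty (snd A)) (singles tr) (abs_state f' Map.empty (snd B))"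
proof -
  obtain as where as: "steps A as B" "tr = filter (\<lambda>a. a \<noteq> Tau) as" using assms(2) by (auto simp: trace_def)
  then show "Tau \<notin> set tr" by auto
  show "\<exists>f'. closed_rep B f' \<and>
    grun run_part (abs_state f Map.empty (snd A)) (singles tr) (abs_state f' Map.empty (snd B))"
    using steps_grun[OF as(1) assms(1), of "abs_state f Map.empty (snd A)" "[]"] as(2)
    by (simp add: grun_Nil)
qed

lemma static_eq_abs:
  assumes "closed_rep (\<P>, \<Phi>) f" "closed_rep (\<Q>, \<Psi>) g"
  shows "\<Phi> \<sim> \<Psi> \<longleftrightarrow> aeq (snd (abs_state f Map.empty \<Phi>)) (snd (abs_state g Map.empty \<Psi>))"
proof -
  have "ran \<Phi> \<subseteq> ground_messages" "ran \<Psi> \<subseteq> ground_messages" using assms by (auto simp: closed_rep_def)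
  then show ?thesis using static_eq_iff_aeq[of \<Phi> \<Psi>] ground_messages_subset
    by (simp add: abs_state_def fsubst_ground order_trans)
qed

text \<open>By \<open>flat\<close>, a sequence of blocks has the same runs as its sequence of
  actions, so it is harmless that \<open>part_incl\<close> ranges over blocks.\<close>

lemma trace_incl_iff:
  assumes A: "closed_rep (\<P>A, \<Phi>A) f" and B: "closed_rep (\<P>B, \<Phi>B) g"
  shows "trace_incl (\<P>A, \<Phi>A) (\<P>B, \<Phi>B) \<longleftrightarrow>
    part_incl (abs_state f Map.empty \<Phi>A) (abs_state g Map.empty \<Phi>B)"
proof
  assume incl: "trace_incl (\<P>A, \<Phi>A) (\<P>B, \<Phi>B)"
  show "part_incl (abs_state f Map.empty \<Phi>A) (abs_state g Map.empty \<Phi>B)"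
    unfolding part_incl_def
  proof (intro allI impI)
    fix bl s assume "grun run_part (abs_state f Map.empty \<Phi>A) bl s"
    then have "grun run_part (abs_state f Map.empty \<Phi>A) (singles (concat (map io bl))) s"
      by (simp add: grun_flat flip: flat_singles)
    moreover have tau: "Tau \<notin> set (concat (map io bl))" by (simp add: Tau_notin_io)
    ultimately obtain \<P> \<Phi> f' where t: "trace (\<P>A, \<Phi>A) (concat (map io bl)) (\<P>, \<Phi>)"
      "closed_rep (\<P>, \<Phi>) f'" "abs_state f' Map.empty \<Phi> = s"
      using grun_trace[OF A] by blast
    then obtain \<Q> \<Psi> where q: "trace (\<P>B, \<Phi>B) (concat (map io bl)) (\<Q>, \<Psi>)" "\<Phi> \<sim> \<Psi>"
      using incl unfolding trace_incl_def by blast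
    from trace_grun(2)[OF B q(1)] obtain g' where g': "closed_rep (\<Q>, \<Psi>) g'"
      "grun run_part (abs_state g Map.empty \<Phi>B) (singles (concat (map io bl))) (abs_state g' Map.empty \<Psi>)"
      by auto
    then show "\<exists>s'. grun run_part (abs_state g Map.empty \<Phi>B) bl s' \<and> aeq (snd s) (snd s')"
      using static_eq_abs[OF t(2) g'(1)] q(2) t(3)
      by (intro exI[of _ "abs_state g' Map.empty \<Psi>"]) (auto simp: grun_flat simp flip: flat_singles)
  qed
next
  assume incl: "part_incl (abs_state f Map.empty \<Phi>A) (abs_state g Map.empty \<Phi>B)"
  show "trace_incl (\<P>A, \<Phi>A) (\<P>B, \<Phi>B)"
    unfolding trace_incl_def
  proof (intro allI impI)
    fix tr \<P> \<Phi> assume t: "trace (\<P>A, \<Phi>A) tr (\<P>, \<Phi>)"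
    from trace_grun(2)[OF A t] obtain f' where f': "closed_rep (\<P>, \<Phi>) f'"
      "grun run_part (abs_state f Map.empty \<Phi>A) (singles tr) (abs_state f' Map.empty \<Phi>)" by auto
    then obtain s' where s': "grun run_part (abs_state g Map.empty \<Phi>B) (singles tr) s'"
      "aeq (snd (abs_state f' Map.empty \<Phi>)) (snd s')"
      using incl unfolding part_incl_def by blast
    from grun_trace[OF B s'(1) trace_grun(1)[OF A t]] obtain \<Q> \<Psi> g' where
      "trace (\<P>B, \<Phi>B) tr (\<Q>, \<Psi>)" "closed_rep (\<Q>, \<Psi>) g'" "abs_state g' Map.empty \<Psi> = s'" by blast
    then show "\<exists>\<P>' \<Phi>'. trace (\<P>B, \<Phi>B) tr (\<P>', \<Phi>') \<and> \<Phi> \<sim> \<Phi>'"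
      using static_eq_abs[OF f'(1)] s'(2) by blast
  qed
qed

text \<open>The form of the processes between two blocks; initial processes have it on every
  channel.\<close>

definition ready :: "('c, 'f, 'n, 'x) proc \<Rightarrow> bool" where
  "ready P \<longleftrightarrow> P = PNull \<or> (\<exists>c x P'. P = PIn c x P')"

lemma extended_simple_rep:
  assumes "extended_simple (\<P>, \<Phi>)" "initial (\<P>, \<Phi>)"
  obtains f where "closed_rep (\<P>, \<Phi>) f" "\<And>c. ready (f c)" "finite (dom \<Phi>)"
    "initial_state (abs_state f Map.empty \<Phi>)"
proof -
  obtain cs Ps where Ps: "\<P> = mset Ps" "distinct cs" "list_all2 basic_on cs Ps" and n: "PNull \<notin># \<P>"
    using assms(1) by (auto simp: extended_simple_def simple_def)
  define f where "f = (\<lambda>c. case map_of (zip cs Ps) c of None \<Rightarrow> PNull | Some P \<Rightarrow> P)"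
  have len: "length cs = length Ps" using Ps(3) by (rule list_all2_lengthD)
  have fi: "f (cs ! i) = Ps ! i" if "i < length cs" for i
    using that len Ps(2) by (simp add: f_def map_of_zip_nth)
  have fc: "f c = PNull" if "c \<notin> set cs" for c
    using that len by (simp add: f_def map_of_zip_is_None[THEN iffD2])
  have map: "map f cs = Ps" using fi len by (simp add: list_eq_iff_nth_eq)
  have mem: "c \<in> set cs \<Longrightarrow> f c \<in># \<P>" for c using map Ps(1) by auto
  have supp: "{c. f c \<noteq> PNull} = set cs" using fc mem n by fastforce
  have "basic_on c (f c)" for c
  proof (cases "c \<in> set cs")
    case True
    then obtain i where "i < length cs" "c = cs ! i" by (auto simp: in_set_conv_nth)
    then show ?thesis using fi Ps(3) by (auto simp: list_all2_conv_all_nth)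
  qed (simp add: fc basic_on.intros)
  moreover have "\<P> = image_mset f (mset_set (set cs))"
    using Ps(2) map by (simp add: mset_set_set Ps(1) flip: mset_map)
  ultimately have rep: "procs_rep \<P> f" by (simp add: procs_rep_def supp)
  have cl: "closed_rep (\<P>, \<Phi>) f"
    using rep assms(1) mem fc by (auto simp: closed_rep_def extended_simple_def) (metis equals0D fv_proc.simps(1))
  have ready: "ready (f c)" for c
    using assms(2) mem[of c] fc[of c] by (auto simp: initial_def ready_def)
  have "finite (dom \<Phi>)" using assms(1) by (auto simp: extended_simple_def)
  moreover have "initial_state (abs_state f Map.empty \<Phi>)"
  proof -
    have "{c. den (f c) Map.empty \<noteq> Stop} \<subseteq> set cs" using fc by fastforce
    then have "finite {c. den (f c) Map.empty \<noteq> Stop}" using finite_subset by blast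
    moreover have "\<not> is_Send (den (f c) Map.empty)" for c using ready[of c] by (auto simp: ready_def)
    ultimately show ?thesis using \<open>finite (dom \<Phi>)\<close> by (simp add: initial_state_def abs_state_def)
  qed
  ultimately show ?thesis using that cl ready by blast
qed

end

section \<open>Symbolic semantics\<close>

definition ded_vars :: "('f, 'n, 'x, 'w, 's) constr set \<Rightarrow> 'x set" where
  "ded_vars S = {x. \<exists>D X. Ded D X x \<in> S}"

text \<open>The first-order variable is dropped, since its name is an arbitrary choice of the
  symbolic step, while handles and second-order variable are determined by the trace.\<close>

definition ded_pairs :: "('f, 'n, 'x, 'w, 's) constr set \<Rightarrow> ('w set \<times> 's) set" where
  "ded_pairs S = {(D, X). \<exists>x. Ded D X x \<in> S}"

definition ded_rel ::
    "('f, 'n, 'x, 'w) frame \<Rightarrow> ('f, 'n, 'x, 'w, 's) constr set \<Rightarrow> ('x \<times> 'x) set" where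
  "ded_rel \<Phi> S = {(x, y). \<exists>D X. Ded D X x \<in> S \<and> (\<exists>w \<in> D. \<exists>u. \<Phi> w = Some u \<and> y \<in> fv u)}"

lemma ded_vars_simps [simp]:
  "ded_vars {} = {}" "ded_vars (insert (Ded D X x) S) = insert x (ded_vars S)"
  "ded_vars (insert (Eq u v) S) = ded_vars S" "ded_vars (insert (Neq u v) S) = ded_vars S"
  "ded_vars (insert (Dep Xs ws) S) = ded_vars S"
  by (auto simp: ded_vars_def)

lemma ded_pairs_simps [simp]:
  "ded_pairs {} = {}" "ded_pairs (insert (Ded D X x) S) = insert (D, X) (ded_pairs S)"
  "ded_pairs (insert (Eq u v) S) = ded_pairs S" "ded_pairs (insert (Neq u v) S) = ded_pairs S"
  "ded_pairs (insert (Dep Xs ws) S) = ded_pairs S"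
  by (auto simp: ded_pairs_def)

lemma ded_vars_mono: "S \<subseteq> S' \<Longrightarrow> ded_vars S \<subseteq> ded_vars S'"
  by (auto simp: ded_vars_def)

lemma ded_pairs_mono: "S \<subseteq> S' \<Longrightarrow> ded_pairs S \<subseteq> ded_pairs S'"
  by (auto simp: ded_pairs_def)

text \<open>For a new input variable: it depends on earlier variables and nothing depends on it, so
  no cycle passes through it.\<close>

lemma acyclic_source:
  assumes "acyclic r" "x \<notin> Range r" "x \<notin> Y"
  shows "acyclic (r \<union> {x} \<times> Y)"
proof -
  have "(a, b) \<in> (r \<union> {x} \<times> Y)\<^sup>+ \<Longrightarrow> b \<noteq> x \<and> (a = x \<or> (a, b) \<in> r\<^sup>+)" for a b
  proof (induction rule: trancl_induct)
    case (base b)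
    then show ?case using assms(2,3) by auto
  next
    case (step b c)
    then have "(b, c) \<in> r" by auto
    with step assms(2) show ?case by (auto intro: trancl_into_trancl)
  qed
  with assms(1) show ?thesis unfolding acyclic_def by blast
qed

lemma finite_fv1_constr: "finite (fv1_constr k)"
  by (cases k) (auto simp: finite_fv)

text \<open>A size that ignores messages and is therefore unchanged by the substitution at an input.
  It is the measure of the induction in \<open>lift_I\<close>, where the induction hypothesis is
  applied to a substituted process.\<close>

primrec depth :: "('c, 'f, 'n, 'x) proc \<Rightarrow> nat" where
  "depth PNull = 0"
| "depth (PIf u v P Q) = Suc (depth P + depth Q)"
| "depth (PIn c x P) = Suc (depth P)"
| "depth (POut c u P) = Suc (depth P)"

lemma depth_psubst [simp]: "depth (psubst y m P) = depth P"
  by (induction P) auto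

context equational_setting
begin

definition winv :: "('f, 'n, 'x, 'w) frame \<Rightarrow> ('f, 'n, 'x, 'w, 's) constr set \<Rightarrow> bool" where
  "winv \<Phi> S \<longleftrightarrow> finite (dom \<Phi>) \<and> finite S \<and> ran \<Phi> \<subseteq> messages \<and>
     (\<forall>u \<in> ran \<Phi>. fv u \<subseteq> ded_vars S) \<and>
     (\<forall>k \<in> S. fv1_constr k \<subseteq> ded_vars S \<and> fv2_constr k \<subseteq> snd ` ded_pairs S \<and>
        (is_Dep k \<or> ordinary_constr k)) \<and>
     (\<forall>D X x D' X'. Ded D X x \<in> S \<longrightarrow> Ded D' X' x \<in> S \<longrightarrow> D = D' \<and> X = X') \<and>
     (\<forall>D X x D' x'. Ded D X x \<in> S \<longrightarrow> Ded D' X x' \<in> S \<longrightarrow> D = D' \<and> x = x') \<and>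
     (\<forall>D X x. Ded D X x \<in> S \<longrightarrow> D \<subseteq> dom \<Phi>) \<and>
     acyclic (ded_rel \<Phi> S)"

lemma winvD:
  assumes "winv \<Phi> S"
  shows "finite (dom \<Phi>)" "finite S" "ran \<Phi> \<subseteq> messages" "u \<in> ran \<Phi> \<Longrightarrow> fv u \<subseteq> ded_vars S"
    "k \<in> S \<Longrightarrow> fv1_constr k \<subseteq> ded_vars S" "k \<in> S \<Longrightarrow> fv2_constr k \<subseteq> snd ` ded_pairs S"
    "k \<in> S \<Longrightarrow> is_Dep k \<or> ordinary_constr k"
    "Ded D X x \<in> S \<Longrightarrow> Ded D' X' x \<in> S \<Longrightarrow> D = D' \<and> X = X'"
    "Ded D X x \<in> S \<Longrightarrow> Ded D' X x' \<in> S \<Longrightarrow> D = D' \<and> x = x'"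
    "Ded D X x \<in> S \<Longrightarrow> D \<subseteq> dom \<Phi>" "acyclic (ded_rel \<Phi> S)"
  using assms unfolding winv_def by simp_all meson

lemma winv_fv1:
  assumes "winv \<Phi> S"
  shows "fv1 (\<Phi>, S) = ded_vars S"
proof
  show "fv1 (\<Phi>, S) \<subseteq> ded_vars S"
    unfolding fv1_def using winvD(4,5)[OF assms] by (simp add: UN_subset_iff)
  show "ded_vars S \<subseteq> fv1 (\<Phi>, S)"
  proof
    fix x assume "x \<in> ded_vars S"
    then obtain D X where "Ded D X x \<in> S" by (auto simp: ded_vars_def)
    then show "x \<in> fv1 (\<Phi>, S)" unfolding fv1_def by (intro UnI2 UN_I[of "Ded D X x"]) simp_all
  qed
qed

lemma winv_fv2:
  assumes "winv \<Phi> S"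
  shows "fv2 (\<Phi>, S) = snd ` ded_pairs S"
proof
  show "fv2 (\<Phi>, S) \<subseteq> snd ` ded_pairs S"
    unfolding fv2_def using winvD(6)[OF assms] by (simp add: UN_subset_iff)
  show "snd ` ded_pairs S \<subseteq> fv2 (\<Phi>, S)"
  proof
    fix X assume "X \<in> snd ` ded_pairs S"
    then obtain D x where "Ded D X x \<in> S" by (auto simp: ded_pairs_def)
    then show "X \<in> fv2 (\<Phi>, S)" unfolding fv2_def by (intro UN_I[of "Ded D X x"]) simp_all
  qed
qed

lemma winv_In:
  fixes S :: "('f, 'n, 'x, 'w, 's) constr set"
  assumes "winv \<Phi> S" "X \<notin> fv2 (\<Phi>, S)" "x \<notin> fv1 (\<Phi>, S)"
  shows "winv \<Phi> (insert (Ded (dom \<Phi>) X x) S)"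
proof -
  note D = winvD[OF assms(1)]
  have X: "X \<notin> snd ` ded_pairs S" using assms(2) winv_fv2[OF assms(1)] by simp
  have x: "x \<notin> ded_vars S" using assms(3) winv_fv1[OF assms(1)] by simp
  let ?Y = "\<Union>u \<in> ran \<Phi>. fv u" and ?S = "insert (Ded (dom \<Phi>) X x) S"
  have Y: "?Y \<subseteq> ded_vars S" using D(4) by (simp add: UN_subset_iff)
  define H where "H D y \<longleftrightarrow> (\<exists>w \<in> D. \<exists>u. \<Phi> w = Some u \<and> y \<in> fv u)" for D y
  have H: "{y. H (dom \<Phi>) y} = ?Y" by (auto simp: H_def ran_def)
  have "ded_rel \<Phi> T = {(a, y). \<exists>D X. Ded D X a \<in> T \<and> H D y}" for T :: "('f, 'n, 'x, 'w, 's) constr set"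
    by (simp add: ded_rel_def H_def)
  then have rel: "ded_rel \<Phi> ?S = ded_rel \<Phi> S \<union> {x} \<times> ?Y"
    unfolding H[symmetric] by auto
  have "Range (ded_rel \<Phi> S) \<subseteq> ?Y" by (auto simp: ded_rel_def ran_def)
  then have acyc: "acyclic (ded_rel \<Phi> ?S)"
    unfolding rel using Y x by (intro acyclic_source[OF D(11)]) auto
  have new: "Ded D X x' \<notin> S" "Ded D X' x \<notin> S" for D X' x'
    using X x by (force simp: ded_pairs_def ded_vars_def)+
  show ?thesis unfolding winv_def
  proof (intro conjI allI ballI impI)
    fix k assume k: "k \<in> ?S"
    show "fv1_constr k \<subseteq> ded_vars ?S" "fv2_constr k \<subseteq> snd ` ded_pairs ?S" "is_Dep k \<or> ordinary_constr k"
      using k D(5)[of k] D(6)[of k] D(7)[of k] by auto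
  next
    fix D X1 x1 D' X'
    assume a: "Ded D X1 x1 \<in> ?S" "Ded D' X' x1 \<in> ?S"
    show "D = D'" "X1 = X'" using a D(8)[of D X1 x1 D' X'] new by auto
  next
    fix D X1 x1 D' x'
    assume a: "Ded D X1 x1 \<in> ?S" "Ded D' X1 x' \<in> ?S"
    show "D = D'" "x1 = x'" using a D(9)[of D X1 x1 D' x'] new by auto
  next
    fix D X1 x1 assume a: "Ded D X1 x1 \<in> ?S"
    show "D \<subseteq> dom \<Phi>" using a D(10)[of D X1 x1] by auto
  next
    fix u assume "u \<in> ran \<Phi>"
    then show "fv u \<subseteq> ded_vars ?S" using D(4) by auto
  qed (use D(1-3) acyc in auto)
qed

lemma winv_Out:
  assumes "winv \<Phi> S" "w \<notin> dom \<Phi>" "u \<in> messages" "fv u \<subseteq> ded_vars S"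
  shows "winv (\<Phi>(w \<mapsto> u)) S"
proof -
  note D = winvD[OF assms(1)]
  have "w \<notin> D" if "Ded D X x \<in> S" for D X x using D(10)[OF that] assms(2) by blast
  then have "(\<exists>w' \<in> D. \<exists>u'. (\<Phi>(w \<mapsto> u)) w' = Some u' \<and> y \<in> fv u') \<longleftrightarrow>
      (\<exists>w' \<in> D. \<exists>u'. \<Phi> w' = Some u' \<and> y \<in> fv u')" if "Ded D X x \<in> S" for D X x y
    using that by (intro bex_cong) auto
  then have rel: "ded_rel (\<Phi>(w \<mapsto> u)) S = ded_rel \<Phi> S"
    unfolding ded_rel_def by blast
  have ran: "ran (\<Phi>(w \<mapsto> u)) = insert u (ran \<Phi>)" using assms(2) by (auto simp: domIff)
  have "D \<subseteq> dom (\<Phi>(w \<mapsto> u))" if "Ded D X x \<in> S" for D X x using D(10)[OF that] by auto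
  then show ?thesis unfolding winv_def ran rel using assms D by auto
qed

lemma winv_test:
  assumes "winv \<Phi> S" "k = Eq u v \<or> k = Neq u v" "u \<in> messages" "v \<in> messages"
    "fv u \<union> fv v \<subseteq> ded_vars S"
  shows "winv \<Phi> (insert k S)"
proof -
  note D = winvD[OF assms(1)]
  have new: "Ded D X x \<in> insert k S \<longleftrightarrow> Ded D X x \<in> S" for D X x using assms(2) by auto
  then have eq: "ded_rel \<Phi> (insert k S) = ded_rel \<Phi> S" "ded_vars (insert k S) = ded_vars S"
    "ded_pairs (insert k S) = ded_pairs S"
    by (simp_all add: ded_rel_def ded_vars_def ded_pairs_def)
  have "fv1_constr k \<subseteq> ded_vars S" "fv2_constr k = {}" "ordinary_constr k" using assms by auto
  then show ?thesis using D(1-7,11) unfolding winv_def eq new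
    by (simp add: D(8-10))
qed

lemma winv_Dep:
  assumes "winv \<Phi> S" "set Xs \<subseteq> snd ` ded_pairs S"
  shows "winv \<Phi> (insert (Dep Xs ws) S)"
proof -
  note D = winvD[OF assms(1)]
  have new: "Ded D X x \<in> insert (Dep Xs ws) S \<longleftrightarrow> Ded D X x \<in> S" for D X x by auto
  then have eq: "ded_rel \<Phi> (insert (Dep Xs ws) S) = ded_rel \<Phi> S"
    by (simp add: ded_rel_def)
  show ?thesis using D(1-7,11) assms(2) unfolding winv_def eq ded_vars_simps ded_pairs_simps new
    by (simp add: D(8-10))
qed

text \<open>In contrast to \<open>first_order_part\<close>, the domain of \<mu> may be too large, so
  that one \<mu> serves all prefixes of an execution. Dependency constraints count as satisfied
  here; they are treated through \<open>depok\<close>.\<close>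

definition sat_sol ::
    "('f, 'w, 's) so_subst \<Rightarrow> ('f, 'n, 'x) fo_subst \<Rightarrow> ('f, 'n, 'x, 'w) frame \<Rightarrow>
     ('f, 'n, 'x, 'w, 's) constr set \<Rightarrow> bool" where
  "sat_sol \<theta> \<mu> \<Phi> S \<longleftrightarrow> ran \<mu> \<subseteq> ground_messages \<and> ded_vars S \<subseteq> dom \<mu> \<and> (\<forall>k \<in> S. sat \<Phi> \<theta> \<mu> k) \<and>
     (\<forall>(D, X) \<in> ded_pairs S. the (\<theta> X) \<in> terms Sig D)"

lemma ran_fsubst:
  assumes "ran \<mu> \<subseteq> messages" "ran \<Phi> \<subseteq> messages"
  shows "ran (fsubst \<mu> \<Phi>) \<subseteq> messages"
  using assms by (auto simp: ran_def fsubst_def intro!: msubst_messages fo_val_messages)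

lemma fsubst_mono: "\<Phi> \<subseteq>\<^sub>m \<Phi>' \<Longrightarrow> fsubst \<mu> \<Phi> \<subseteq>\<^sub>m fsubst \<mu> \<Phi>'"
  unfolding map_le_def dom_fsubst by (simp add: fsubst_def)

lemma val_frame_mono: "\<Phi> \<subseteq>\<^sub>m \<Phi>' \<Longrightarrow> val_frame \<Phi> \<subseteq>\<^sub>m val_frame \<Phi>'"
  unfolding map_le_def dom_val_frame by (simp add: val_frame_def)

lemma sat_frame_mono:
  assumes "winv \<Phi> S" "\<Phi> \<subseteq>\<^sub>m \<Phi>'" "k \<in> S" "\<forall>(D, X) \<in> ded_pairs S. the (\<theta> X) \<in> terms Sig D"
  shows "sat \<Phi>' \<theta> \<mu> k \<longleftrightarrow> sat \<Phi> \<theta> \<mu> k"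
proof (cases k)
  case (Ded D X x)
  then have ded: "Ded D X x \<in> S" using assms(3) by simp
  then have "the (\<theta> X) \<in> terms Sig D" using assms(4) by (auto simp: ded_pairs_def)
  then have "the (\<theta> X) \<in> terms Sig (dom (fsubst \<mu> \<Phi>))"
    using winvD(10)[OF assms(1) ded] by (auto intro: terms_mono)
  from recipe_msg_mono[OF this fsubst_mono[OF assms(2)]] show ?thesis by (simp add: Ded)
qed auto

lemma sat_sol_mono:
  assumes "sat_sol \<theta> \<mu> \<Phi>' S'" "winv \<Phi> S" "\<Phi> \<subseteq>\<^sub>m \<Phi>'" "S \<subseteq> S'"
  shows "sat_sol \<theta> \<mu> \<Phi> S"
proof -
  have p: "\<forall>(D, X) \<in> ded_pairs S. the (\<theta> X) \<in> terms Sig D"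
    using assms(1) ded_pairs_mono[OF assms(4)] unfolding sat_sol_def by blast
  then show ?thesis
    using assms(1,4) sat_frame_mono[OF assms(2,3) _ p] ded_vars_mono[OF assms(4)]
    unfolding sat_sol_def by blast
qed

lemma sat_sol_Out:
  assumes "sat_sol \<theta> \<mu> \<Phi> S" "winv \<Phi> S" "w \<notin> dom \<Phi>"
  shows "sat_sol \<theta> \<mu> (\<Phi>(w \<mapsto> u)) S"
proof -
  have "\<Phi> \<subseteq>\<^sub>m \<Phi>(w \<mapsto> u)" using assms(3) by (auto simp: map_le_def)
  then show ?thesis using assms(1) sat_frame_mono[OF assms(2)] unfolding sat_sol_def by blast
qed

text \<open>The effect of a focused block, apart from its tests. All its deduction constraints have
  the handles known at its start, since inputs precede outputs.\<close>

definition grow ::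
    "('f, 'n, 'x, 'w) frame \<Rightarrow> ('f, 'n, 'x, 'w, 's) constr set \<Rightarrow> 's list \<Rightarrow> 'w list \<Rightarrow>
     ('f, 'n, 'x, 'w) frame \<Rightarrow> ('f, 'n, 'x, 'w, 's) constr set \<Rightarrow> bool" where
  "grow \<Phi> S Xs ws \<Phi>' S' \<longleftrightarrow> winv \<Phi>' S' \<and> S \<subseteq> S' \<and> \<Phi> \<subseteq>\<^sub>m \<Phi>' \<and>
     dom \<Phi>' = dom \<Phi> \<union> set ws \<and> distinct ws \<and> set ws \<inter> dom \<Phi> = {} \<and>
     distinct Xs \<and> set Xs \<inter> snd ` ded_pairs S = {} \<and>
     ded_pairs S' = ded_pairs S \<union> {dom \<Phi>} \<times> set Xs \<and> (\<forall>Ys vs. Dep Ys vs \<in> S' \<longleftrightarrow> Dep Ys vs \<in> S)"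

section \<open>From focused symbolic executions to trees\<close>

inductive_cases sym_step_InpE: "sym_step K (Inp c X) K'"
inductive_cases sym_step_OutpE: "sym_step K (Outp c w) K'"
inductive_cases sym_step_TauE: "sym_step K Tau K'"

lemma sym_Tau:
  assumes "sym_step (P, \<Phi>, S) Tau (P', \<Phi>', S')" "basic_on c P" "fv_proc P \<subseteq> ded_vars S" "winv \<Phi> S"
  shows "basic_on c P'" "fv_proc P' \<subseteq> ded_vars S'" "winv \<Phi>' S'" "\<Phi>' = \<Phi>" "S \<subseteq> S'"
    "ded_pairs S' = ded_pairs S" "Dep Ys vs \<in> S' \<longleftrightarrow> Dep Ys vs \<in> S"
    "S' \<subseteq> T \<Longrightarrow> \<forall>k \<in> T. sat \<Psi> \<theta> \<mu> k \<Longrightarrow> den P \<mu> = den P' \<mu>"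
proof -
  obtain u v P1 P2 k where P: "P = PIf u v P1 P2" and S': "S' = insert k S" "\<Phi>' = \<Phi>"
    and k: "k = Eq u v \<and> P' = P1 \<or> k = Neq u v \<and> P' = P2"
    using assms(1) by (auto elim!: sym_step_TauE)
  have b: "u \<in> messages" "v \<in> messages" "basic_on c P1" "basic_on c P2"
    using assms(2) by (auto simp: P elim: basic_on_PIfE)
  have fv: "fv u \<union> fv v \<subseteq> ded_vars S" "fv_proc P1 \<subseteq> ded_vars S" "fv_proc P2 \<subseteq> ded_vars S"
    using assms(3) by (auto simp: P)
  show "winv \<Phi>' S'" unfolding S' by (rule winv_test[OF assms(4) _ b(1,2) fv(1)]) (use k in auto)
  show "basic_on c P'" "fv_proc P' \<subseteq> ded_vars S'" "\<Phi>' = \<Phi>" "S \<subseteq> S'" "ded_pairs S' = ded_pairs S"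
    "Dep Ys vs \<in> S' \<longleftrightarrow> Dep Ys vs \<in> S"
    using k b fv S' by auto
  show "den P \<mu> = den P' \<mu>" if "S' \<subseteq> T" "\<forall>k \<in> T. sat \<Psi> \<theta> \<mu> k"
  proof -
    have "sat \<Psi> \<theta> \<mu> k" using that S'(1) by blast
    then show ?thesis using k by (auto simp: P)
  qed
qed

text \<open>The output phase can only end at a null process or at an input, so it contains
  everything that the tree sends.\<close>

lemma focused_O:
  assumes "focused l K acts K'" "l = OStar" "K = (P, \<Phi>, S)" "K' = (R, \<Phi>', S')"
    "basic_on c P" "fv_proc P \<subseteq> ded_vars S" "winv \<Phi> S"
  shows "\<exists>Q ws. R = Some Q \<and> acts = map (Outp c) ws \<and> ready Q \<and> basic_on c Q \<and>
    fv_proc Q \<subseteq> ded_vars S' \<and> grow \<Phi> S [] ws \<Phi>' S' \<and>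
    (\<forall>\<theta> \<mu>. (\<forall>k \<in> S'. sat \<Phi>' \<theta> \<mu> k) \<longrightarrow>
       beh_outs (den P \<mu>) = (map (\<lambda>w. the (val_frame (fsubst \<mu> \<Phi>') w)) ws, den Q \<mu>))"
  using assms
proof (induction arbitrary: P \<Phi> S rule: focused.induct)
  case (foc_out K d w K1 tr K'' l)
  from foc_out.hyps(1) foc_out.prems(2) obtain u P1 where P: "P = POut d u P1" "w \<notin> dom \<Phi>"
    and K1: "K1 = (P1, \<Phi>(w \<mapsto> u), S)" by (auto elim!: sym_step_OutpE)
  have d: "d = c" "basic_on c P1" "u \<in> messages" using foc_out.prems(4) by (auto simp: P elim: basic_on_POutE)
  have fv: "fv u \<subseteq> ded_vars S" "fv_proc P1 \<subseteq> ded_vars S" using foc_out.prems(5) by (auto simp: P)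
  have w: "winv (\<Phi>(w \<mapsto> u)) S" by (rule winv_Out[OF foc_out.prems(6) P(2) d(3) fv(1)])
  obtain Q ws where IH: "R = Some Q" "tr = map (Outp c) ws" "ready Q" "basic_on c Q"
    "fv_proc Q \<subseteq> ded_vars S'" "grow (\<Phi>(w \<mapsto> u)) S [] ws \<Phi>' S'"
    "\<And>\<theta> \<mu>. (\<forall>k \<in> S'. sat \<Phi>' \<theta> \<mu> k) \<Longrightarrow>
       beh_outs (den P1 \<mu>) = (map (\<lambda>w. the (val_frame (fsubst \<mu> \<Phi>') w)) ws, den Q \<mu>)"
    using foc_out.IH[OF refl K1 foc_out.prems(3) d(2) fv(2) w] by blast
  have le1: "\<Phi>(w \<mapsto> u) \<subseteq>\<^sub>m \<Phi>'" using IH(6) by (simp add: grow_def)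
  then have fw: "\<Phi>' w = Some u" by (simp add: map_le_def)
  have "\<Phi> \<subseteq>\<^sub>m \<Phi>(w \<mapsto> u)" using P(2) by (auto simp: map_le_def)
  then have le: "\<Phi> \<subseteq>\<^sub>m \<Phi>'" using le1 by (rule map_le_trans)
  have "grow \<Phi> S [] (w # ws) \<Phi>' S'" using IH(6) P(2) le unfolding grow_def by auto
  moreover have "the (val_frame (fsubst \<mu> \<Phi>') w) = canon (msubst \<mu> u)" for \<mu>
    using fw by (simp add: val_frame_def fsubst_def)
  ultimately show ?case using IH d(1) by (intro exI[of _ Q] exI[of _ "w # ws"]) (auto simp: P(1))
next
  case (foc_tau K K1 l tr K'')
  obtain P1 \<Phi>1 S1 where K1: "K1 = (P1, \<Phi>1, S1)" by (cases K1)
  have st: "sym_step (P, \<Phi>, S) Tau (P1, \<Phi>1, S1)" using foc_tau.hyps(1) by (simp add: K1 foc_tau.prems(2))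
  note T = sym_Tau[OF st foc_tau.prems(4-6)]
  obtain Q ws where IH: "R = Some Q" "tr = map (Outp c) ws" "ready Q" "basic_on c Q"
    "fv_proc Q \<subseteq> ded_vars S'" "grow \<Phi>1 S1 [] ws \<Phi>' S'"
    "\<And>\<theta> \<mu>. (\<forall>k \<in> S'. sat \<Phi>' \<theta> \<mu> k) \<Longrightarrow>
       beh_outs (den P1 \<mu>) = (map (\<lambda>w. the (val_frame (fsubst \<mu> \<Phi>') w)) ws, den Q \<mu>)"
    using foc_tau.IH[OF foc_tau.prems(1) K1 foc_tau.prems(3) T(1-3)] by blast
  have "grow \<Phi> S [] ws \<Phi>' S'" using IH(6) T(4-7) unfolding grow_def by auto
  moreover have "den P \<mu> = den P1 \<mu>" if "\<forall>k \<in> S'. sat \<Phi>' \<theta> \<mu> k" for \<theta> \<mu>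
    using T(8)[OF _ that] IH(6) by (simp add: grow_def)
  ultimately show ?case using IH by (intro exI[of _ Q] exI[of _ ws]) metis
next
  case (foc_proper P1 \<Phi>1 S1)
  then show ?case
    by (intro exI[of _ P] exI[of _ "[]"]) (auto simp: ready_def grow_def)
qed simp_all

text \<open>The deduction constraint gives the new variable the value of its recipe, so a symbolic
  input is the reception of that value. The values may be taken in the final frame because it
  extends the frame at the input.\<close>

lemma focused_I:
  assumes "focused l K acts K'" "l \<noteq> OStar" "K = (P, \<Phi>, S)" "K' = (R, \<Phi>', S')"
    "basic_on c P" "fv_proc P \<subseteq> ded_vars S" "winv \<Phi> S"
  shows "\<exists>Xs ws. acts = map (Inp c) Xs @ map (Outp c) ws \<and> (l = IPlus \<longrightarrow> Xs \<noteq> []) \<and>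
    grow \<Phi> S Xs ws \<Phi>' S' \<and> (R = None \<longleftrightarrow> ws = []) \<and>
    (\<forall>Q. R = Some Q \<longrightarrow> ready Q \<and> basic_on c Q \<and> fv_proc Q \<subseteq> ded_vars S') \<and>
    (\<forall>\<theta> \<mu>. sat_sol \<theta> \<mu> \<Phi>' S' \<longrightarrow> (let F = val_frame (fsubst \<mu> \<Phi>') in
       \<exists>b. beh_ins (den P \<mu>) (map (\<lambda>X. recipe_val F (the (\<theta> X))) Xs) = Some b \<and>
         (R = None \<longrightarrow> b = Stop) \<and>
         (\<forall>Q. R = Some Q \<longrightarrow> beh_outs b = (map (\<lambda>w. the (F w)) ws, den Q \<mu>))))"
  using assms
proof (induction arbitrary: P \<Phi> S rule: focused.induct)
  case (foc_in K d X K1 tr K'' l)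
  from foc_in.hyps(1) foc_in.prems(2) obtain y P1 x where P: "P = PIn d y P1"
    and fresh: "X \<notin> fv2 (\<Phi>, S)" "x \<notin> fv1 (\<Phi>, S)" "x \<notin> vars_proc (PIn d y P1)"
    and K1: "K1 = (psubst y (Atom (Var x)) P1, \<Phi>, insert (Ded (dom \<Phi>) X x) S)"
    by (auto elim!: sym_step_InpE)
  let ?P = "psubst y (Atom (Var x)) P1" and ?S = "insert (Ded (dom \<Phi>) X x) S"
  have d: "d = c" and b1: "basic_on c P1" using foc_in.prems(4) by (auto simp: P elim: basic_on_PInE)
  have b: "basic_on c ?P" by (rule basic_on_psubst[OF b1]) simp
  have fv: "fv_proc ?P \<subseteq> ded_vars ?S"
    using foc_in.prems(5) fv_proc_psubst[of y "Atom (Var x)" P1] by (auto simp: P)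
  have w: "winv \<Phi> ?S" by (rule winv_In[OF foc_in.prems(6) fresh(1,2)])
  obtain Xs ws where IH: "tr = map (Inp c) Xs @ map (Outp c) ws" "grow \<Phi> ?S Xs ws \<Phi>' S'"
    "R = None \<longleftrightarrow> ws = []"
    "\<And>Q. R = Some Q \<Longrightarrow> ready Q \<and> basic_on c Q \<and> fv_proc Q \<subseteq> ded_vars S'"
    and sem: "\<And>\<theta> \<mu>. sat_sol \<theta> \<mu> \<Phi>' S' \<Longrightarrow> (let F = val_frame (fsubst \<mu> \<Phi>') in
       \<exists>b. beh_ins (den ?P \<mu>) (map (\<lambda>X. recipe_val F (the (\<theta> X))) Xs) = Some b \<and>
         (R = None \<longrightarrow> b = Stop) \<and>
         (\<forall>Q. R = Some Q \<longrightarrow> beh_outs b = (map (\<lambda>w. the (F w)) ws, den Q \<mu>)))"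
    using foc_in.IH[OF _ K1 foc_in.prems(3) b fv w] by blast
  have X: "X \<notin> snd ` ded_pairs S" using fresh(1) winv_fv2[OF foc_in.prems(6)] by simp
  have grow: "grow \<Phi> S (X # Xs) ws \<Phi>' S'" using IH(2) X unfolding grow_def by auto
  have "beh_ins (den P \<mu>) (recipe_val (val_frame (fsubst \<mu> \<Phi>')) (the (\<theta> X)) # vs) = beh_ins (den ?P \<mu>) vs"
    if s: "sat_sol \<theta> \<mu> \<Phi>' S'" for \<theta> \<mu> vs
  proof -
    have ded: "Ded (dom \<Phi>) X x \<in> S'" using IH(2) by (auto simp: grow_def)
    have w': "winv \<Phi>' S'" using IH(2) by (simp add: grow_def)
    have rm: "ran \<mu> \<subseteq> messages" using s ground_messages_subset by (auto simp: sat_sol_def)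
    have "x \<in> ded_vars S'" using ded by (auto simp: ded_vars_def)
    then have "x \<in> dom \<mu>" using s by (auto simp: sat_sol_def)
    then obtain t where t: "\<mu> x = Some t" by blast
    have tm: "t \<in> messages" using t rm by (auto simp: ran_def)
    have "recipe_msg (fsubst \<mu> \<Phi>') (the (\<theta> X)) =\<^sub>E t"
      using s ded t unfolding sat_sol_def by (metis option.sel sat.simps(1))
    moreover have "the (\<theta> X) \<in> terms Sig (dom (fsubst \<mu> \<Phi>'))"
    proof -
      have "(dom \<Phi>, X) \<in> ded_pairs S'" using ded by (auto simp: ded_pairs_def)
      then have "the (\<theta> X) \<in> terms Sig (dom \<Phi>)" using s by (auto simp: sat_sol_def)
      then show ?thesis by (rule terms_mono) (use IH(2) in \<open>auto simp: grow_def\<close>)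
    qed
    ultimately have rv: "recipe_val (val_frame (fsubst \<mu> \<Phi>')) (the (\<theta> X)) = canon t"
      using recipe_val_val_frame[OF ran_fsubst[OF rm winvD(3)[OF w']]] by (simp add: canon_cong)
    have "den ?P \<mu> = den P1 (\<mu>(y \<mapsto> t))"
      using den_psubst[of "Atom (Var x)" P1 y \<mu>] fresh(3) t by simp
    also have "\<dots> = den P1 (\<mu>(y \<mapsto> canon t))"
      using den_canon[OF b1 tm, of \<mu> y] fo_val_messages[OF rm] by simp
    finally show ?thesis using canon_messages[OF tm] by (simp add: P rv)
  qed
  then have "\<forall>\<theta> \<mu>. sat_sol \<theta> \<mu> \<Phi>' S' \<longrightarrow> (let F = val_frame (fsubst \<mu> \<Phi>') in
       \<exists>b. beh_ins (den P \<mu>) (map (\<lambda>X. recipe_val F (the (\<theta> X))) (X # Xs)) = Some b \<and>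
         (R = None \<longrightarrow> b = Stop) \<and>
         (\<forall>Q. R = Some Q \<longrightarrow> beh_outs b = (map (\<lambda>w. the (F w)) ws, den Q \<mu>)))"
    using sem by (simp only: Let_def list.map) simp
  with IH grow d show ?case by (intro exI[of _ "X # Xs"] exI[of _ ws]) auto
next
  case (foc_out K d w K1 tr K'' l)
  \<comment> \<open>The other modes are excluded, and what follows is a pure output phase, to which
    \<open>focused_O\<close> applies.\<close>
  from foc_out have l: "l = IStar" by auto
  have f: "focused OStar K (Outp d w # tr) K''" by (rule focused.foc_out[OF foc_out.hyps(1,2)]) simp
  from focused_O[OF f refl foc_out.prems(2-6)] obtain Q ws where
    O: "R = Some Q" "Outp d w # tr = map (Outp c) ws" "ready Q" "basic_on c Q"
    "fv_proc Q \<subseteq> ded_vars S'" "grow \<Phi> S [] ws \<Phi>' S'"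
    "\<And>\<theta> \<mu>. (\<forall>k \<in> S'. sat \<Phi>' \<theta> \<mu> k) \<Longrightarrow>
       beh_outs (den P \<mu>) = (map (\<lambda>w. the (val_frame (fsubst \<mu> \<Phi>') w)) ws, den Q \<mu>)"
    by (elim exE conjE, intro that) (assumption | blast)+
  then have "ws \<noteq> []" by auto
  with O l show ?case
    by (intro exI[of _ "[]"] exI[of _ ws]) (auto simp: sat_sol_def Let_def)
next
  case (foc_tau K K1 l tr K'')
  obtain P1 \<Phi>1 S1 where K1: "K1 = (P1, \<Phi>1, S1)" by (cases K1)
  have st: "sym_step (P, \<Phi>, S) Tau (P1, \<Phi>1, S1)" using foc_tau.hyps(1) by (simp add: K1 foc_tau.prems(2))
  note T = sym_Tau[OF st foc_tau.prems(4-6)]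
  obtain Xs ws where IH: "tr = map (Inp c) Xs @ map (Outp c) ws" "l = IPlus \<longrightarrow> Xs \<noteq> []"
    "grow \<Phi>1 S1 Xs ws \<Phi>' S'" "R = None \<longleftrightarrow> ws = []"
    "\<forall>Q. R = Some Q \<longrightarrow> ready Q \<and> basic_on c Q \<and> fv_proc Q \<subseteq> ded_vars S'"
    and sem: "\<forall>\<theta> \<mu>. sat_sol \<theta> \<mu> \<Phi>' S' \<longrightarrow> (let F = val_frame (fsubst \<mu> \<Phi>') in
       \<exists>b. beh_ins (den P1 \<mu>) (map (\<lambda>X. recipe_val F (the (\<theta> X))) Xs) = Some b \<and>
         (R = None \<longrightarrow> b = Stop) \<and>
         (\<forall>Q. R = Some Q \<longrightarrow> beh_outs b = (map (\<lambda>w. the (F w)) ws, den Q \<mu>)))"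
    using foc_tau.IH[OF foc_tau.prems(1) K1 foc_tau.prems(3) T(1-3)] by blast
  have g: "grow \<Phi> S Xs ws \<Phi>' S'" using IH(3) T(4-7) unfolding grow_def by auto
  have den: "den P \<mu> = den P1 \<mu>" if "sat_sol \<theta> \<mu> \<Phi>' S'" for \<theta> \<mu>
    using T(8)[of S' \<Phi>' \<theta> \<mu>] IH(3) that by (simp add: grow_def sat_sol_def)
  have "\<forall>\<theta> \<mu>. sat_sol \<theta> \<mu> \<Phi>' S' \<longrightarrow> (let F = val_frame (fsubst \<mu> \<Phi>') in
       \<exists>b. beh_ins (den P \<mu>) (map (\<lambda>X. recipe_val F (the (\<theta> X))) Xs) = Some b \<and>
         (R = None \<longrightarrow> b = Stop) \<and>
         (\<forall>Q. R = Some Q \<longrightarrow> beh_outs b = (map (\<lambda>w. the (F w)) ws, den Q \<mu>)))"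
  proof (intro allI impI)
    fix \<theta> \<mu> assume s: "sat_sol \<theta> \<mu> \<Phi>' S'"
    show "let F = val_frame (fsubst \<mu> \<Phi>') in
       \<exists>b. beh_ins (den P \<mu>) (map (\<lambda>X. recipe_val F (the (\<theta> X))) Xs) = Some b \<and>
         (R = None \<longrightarrow> b = Stop) \<and>
         (\<forall>Q. R = Some Q \<longrightarrow> beh_outs b = (map (\<lambda>w. the (F w)) ws, den Q \<mu>))"
      unfolding den[OF s] using sem s by blast
  qed
  with IH g show ?case by (intro exI[of _ Xs] exI[of _ ws]) blast
next
  case (foc_improper \<Phi>1 S1)
  then show ?case
    by (intro exI[of _ "[]"] exI[of _ "[]"]) (auto simp: grow_def)
qed simp_all


section \<open>From trees to focused symbolic executions\<close>

lemma ran_fsubst_ground: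
  assumes "ran \<mu> \<subseteq> ground_messages" "ded_vars S \<subseteq> dom \<mu>" "winv \<Phi> S"
  shows "ran (fsubst \<mu> \<Phi>) \<subseteq> ground_messages"
proof
  fix t assume "t \<in> ran (fsubst \<mu> \<Phi>)"
  then obtain u where u: "u \<in> ran \<Phi>" "t = msubst \<mu> u" by (auto simp: ran_def fsubst_def)
  have "fo_val \<mu> x \<in> ground_messages" if "x \<in> fv u" for x
  proof -
    have "x \<in> dom \<mu>" using winvD(4)[OF assms(3) u(1)] that assms(2) by blast
    then show ?thesis using assms(1) by (auto simp: ran_def)
  qed
  then show "t \<in> ground_messages"
    using winvD(3)[OF assms(3)] u by (auto simp: ground_messages_iff fv_msubst intro!: msubst_messages)
qed

lemma fsubst_cong:
  assumes "\<And>u x. u \<in> ran \<Phi> \<Longrightarrow> x \<in> fv u \<Longrightarrow> fo_val \<mu> x = fo_val \<nu> x"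
  shows "fsubst \<mu> \<Phi> = fsubst \<nu> \<Phi>"
proof
  fix w
  have "msubst \<mu> u = msubst \<nu> u" if "\<Phi> w = Some u" for u
    by (rule msubst_cong, rule assms[of u]) (use that in \<open>auto simp: ran_def\<close>)
  then show "fsubst \<mu> \<Phi> w = fsubst \<nu> \<Phi> w" by (cases "\<Phi> w") (simp_all add: fsubst_def)
qed

lemma sat_sol_cong:
  assumes "sat_sol \<theta> \<mu> \<Phi> S" "winv \<Phi> S" "\<And>x. x \<in> ded_vars S \<Longrightarrow> \<nu> x = \<mu> x" "ran \<nu> \<subseteq> ground_messages"
  shows "sat_sol \<theta> \<nu> \<Phi> S"
proof -
  have v: "fo_val \<nu> x = fo_val \<mu> x" if "x \<in> ded_vars S" for x
    using assms(3)[OF that] by (simp add: fo_val_def)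
  have f: "fsubst \<nu> \<Phi> = fsubst \<mu> \<Phi>"
    by (rule fsubst_cong, rule v) (use winvD(4)[OF assms(2)] in blast)
  have m: "msubst \<nu> u = msubst \<mu> u" if "fv u \<subseteq> ded_vars S" for u
    by (rule msubst_cong, rule v) (use that in blast)
  have "sat \<Phi> \<theta> \<nu> k \<longleftrightarrow> sat \<Phi> \<theta> \<mu> k" if "k \<in> S" for k
    using winvD(5)[OF assms(2) that] assms(3) by (cases k) (simp_all add: f m)
  moreover have "ded_vars S \<subseteq> dom \<nu>"
  proof
    fix x assume "x \<in> ded_vars S"
    moreover then have "x \<in> dom \<mu>" using assms(1) by (auto simp: sat_sol_def)
    ultimately show "x \<in> dom \<nu>" using assms(3)[of x] by (simp add: domIff)
  qed
  ultimately show ?thesis using assms(1,4) by (auto simp: sat_sol_def)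
qed

lemma sat_sol_test:
  assumes "sat_sol \<theta> \<mu> \<Phi> S" "if msubst \<mu> u =\<^sub>E msubst \<mu> v then k = Eq u v else k = Neq u v"
  shows "sat_sol \<theta> \<mu> \<Phi> (insert k S)"
  using assms by (auto simp: sat_sol_def split: if_splits)

lemma sym_test:
  fixes S :: "('f, 'n, 'x, 'w, 's) constr set"
  assumes "basic_on c (PIf u v P Q)" "fv_proc (PIf u v P Q) \<subseteq> ded_vars S" "winv \<Phi> S"
    "sat_sol \<theta> \<mu> \<Phi> S"
  obtains R S' where "sym_step (PIf u v P Q, \<Phi>, S) Tau (R, \<Phi>, S')" "basic_on c R"
    "fv_proc R \<subseteq> ded_vars S'" "winv \<Phi> S'" "sat_sol \<theta> \<mu> \<Phi> S'" "den R \<mu> = den (PIf u v P Q) \<mu>"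
    "ded_vars S' = ded_vars S" "ded_pairs S' = ded_pairs S" "R = P \<or> R = Q"
proof -
  define R where "R = (if msubst \<mu> u =\<^sub>E msubst \<mu> v then P else Q)"
  define k :: "('f, 'n, 'x, 'w, 's) constr"
    where "k = (if msubst \<mu> u =\<^sub>E msubst \<mu> v then Eq u v else Neq u v)"
  have st: "sym_step (PIf u v P Q, \<Phi>, S) Tau (R, \<Phi>, insert k S)"
    using sym_then[of u v P Q \<Phi> S] sym_else[of u v P Q \<Phi> S] by (simp add: R_def k_def)
  note T = sym_Tau[OF st assms(1-3)]
  have "sat_sol \<theta> \<mu> \<Phi> (insert k S)" by (rule sat_sol_test[OF assms(4), of u v]) (simp add: k_def)
  moreover have "ded_vars (insert k S) = ded_vars S" by (simp add: k_def)
  moreover have "den R \<mu> = den (PIf u v P Q) \<mu>" "R = P \<or> R = Q" by (simp_all add: R_def)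
  ultimately show ?thesis using that[OF st T(1-3)] T(6) by blast
qed

text \<open>Each test takes the branch that \<mu> decides, so \<mu> satisfies the added constraint;
  outputs introduce no variables, so \<mu> never has to be extended.\<close>

lemma lift_O:
  assumes "basic_on c P" "fv_proc P \<subseteq> ded_vars S" "winv \<Phi> S" "sat_sol \<theta> \<mu> \<Phi> S"
    "length ws = length (fst (beh_outs (den P \<mu>)))" "distinct ws" "set ws \<inter> dom \<Phi> = {}"
  shows "\<exists>R \<Phi>' S'. focused OStar (P, \<Phi>, S) (map (Outp c) ws) (Some R, \<Phi>', S') \<and>
    sat_sol \<theta> \<mu> \<Phi>' S' \<and> ded_vars S' = ded_vars S"
  using assms
proof (induction P arbitrary: \<Phi> S ws rule: proc.induct)
  case PNull
  then show ?case by (auto intro!: foc_proper exI)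
next
  case (PIn d x P)
  then show ?case by (auto intro!: foc_proper exI)
next
  case (PIf u v P Q)
  obtain R S1 where R: "sym_step (PIf u v P Q, \<Phi>, S) Tau (R, \<Phi>, S1)" "basic_on c R"
    "fv_proc R \<subseteq> ded_vars S1" "winv \<Phi> S1" "sat_sol \<theta> \<mu> \<Phi> S1" "den R \<mu> = den (PIf u v P Q) \<mu>"
    "ded_vars S1 = ded_vars S" "R = P \<or> R = Q"
    by (rule sym_test[OF PIf.prems(1-4)])
  have "\<exists>R' \<Phi>' S'. focused OStar (R, \<Phi>, S1) (map (Outp c) ws) (Some R', \<Phi>', S') \<and>
    sat_sol \<theta> \<mu> \<Phi>' S' \<and> ded_vars S' = ded_vars S1"
    using R(8)
  proof
    assume "R = P"
    then show ?thesis using PIf.IH(1)[of S1 \<Phi> ws] R(2-6) PIf.prems(5-7) by simp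
  next
    assume "R = Q"
    then show ?thesis using PIf.IH(2)[of S1 \<Phi> ws] R(2-6) PIf.prems(5-7) by simp
  qed
  with R(1,7) show ?case using foc_tau by metis
next
  case (POut d u P)
  then obtain w ws' where ws: "ws = w # ws'" by (cases ws) auto
  have d: "d = c" "u \<in> messages" "basic_on c P" using POut.prems(1) by (auto elim: basic_on_POutE)
  have w: "w \<notin> dom \<Phi>" using POut.prems(7) by (simp add: ws)
  have fv: "fv u \<subseteq> ded_vars S" "fv_proc P \<subseteq> ded_vars S" using POut.prems(2) by auto
  have "\<exists>R' \<Phi>' S'. focused OStar (P, \<Phi>(w \<mapsto> u), S) (map (Outp c) ws') (Some R', \<Phi>', S') \<and>
    sat_sol \<theta> \<mu> \<Phi>' S' \<and> ded_vars S' = ded_vars S"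
  proof (rule POut.IH[OF d(3) fv(2) winv_Out[OF POut.prems(3) w d(2) fv(1)] sat_sol_Out[OF POut.prems(4,3) w]])
    have "dom (\<Phi>(w \<mapsto> u)) = insert w (dom \<Phi>)" by (rule dom_fun_upd[THEN trans]) simp
    then show "set ws' \<inter> dom (\<Phi>(w \<mapsto> u)) = {}" using POut.prems(6,7) by (simp only: ws) auto
  qed (use POut.prems(5,6) ws in simp_all)
  moreover have "sym_step (POut c u P, \<Phi>, S) (Outp c w) (P, \<Phi>(w \<mapsto> u), S)" by (rule sym_out[OF w])
  ultimately show ?case using foc_out[of _ c w _ _ _ OStar] d(1) by (fastforce simp: ws)
qed

text \<open>The new variable takes exactly the message that its recipe computes; as it is fresh, no
  other constraint is disturbed.\<close>

lemma sat_sol_In: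
  assumes "sat_sol \<theta> \<mu> \<Phi> S" "winv \<Phi> S" "x \<notin> ded_vars S" "the (\<theta> X) \<in> terms Sig (dom \<Phi>)"
  defines "t \<equiv> recipe_msg (fsubst \<mu> \<Phi>) (the (\<theta> X))"
  shows "t \<in> ground_messages" "sat_sol \<theta> (\<mu>(x \<mapsto> t)) \<Phi> (insert (Ded (dom \<Phi>) X x) S)"
    "fsubst (\<mu>(x \<mapsto> t)) \<Phi> = fsubst \<mu> \<Phi>"
proof -
  have "ran (fsubst \<mu> \<Phi>) \<subseteq> ground_messages"
    by (rule ran_fsubst_ground) (use assms(1,2) in \<open>auto simp: sat_sol_def\<close>)
  then show t: "t \<in> ground_messages"
    unfolding t_def by (rule recipe_msg_ground) (use assms(4) in simp)
  show f: "fsubst (\<mu>(x \<mapsto> t)) \<Phi> = fsubst \<mu> \<Phi>"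
  proof (rule fsubst_cong)
    fix u y assume "u \<in> ran \<Phi>" "y \<in> fv u"
    then have "y \<noteq> x" using winvD(4)[OF assms(2)] assms(3) by blast
    then show "fo_val (\<mu>(x \<mapsto> t)) y = fo_val \<mu> y" by (simp add: fo_val_upd)
  qed
  have ran: "ran (\<mu>(x \<mapsto> t)) \<subseteq> ground_messages"
    using assms(1) t unfolding sat_sol_def by (auto simp: ran_def)
  have s: "sat_sol \<theta> (\<mu>(x \<mapsto> t)) \<Phi> S"
    by (rule sat_sol_cong[OF assms(1,2) _ ran]) (use assms(3) in auto)
  have "t =\<^sub>E t" using t ground_messages_subset by (intro eqE_refl) blast
  then have "sat \<Phi> \<theta> (\<mu>(x \<mapsto> t)) (Ded (dom \<Phi>) X x)" by (simp add: f flip: t_def)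
  with s assms(4) show "sat_sol \<theta> (\<mu>(x \<mapsto> t)) \<Phi> (insert (Ded (dom \<Phi>) X x) S)"
    by (auto simp: sat_sol_def)
qed

text \<open>A converse of \<open>focused_I\<close> that builds the symbolic block along with its
  first-order solution. The case \<open>ws = []\<close> is an improper block, which exists only if
  the inputs lead to \<open>Stop\<close>.\<close>

lemma lift_I:
  fixes S :: "('f, 'n, 'x, 'w, 's) constr set" and P :: "('c, 'f, 'n, 'x) proc"
  assumes inf: "infinite (UNIV :: 'x set)"
  assumes "basic_on c P" "fv_proc P \<subseteq> ded_vars S" "winv \<Phi> S" "sat_sol \<theta> \<mu> \<Phi> S" "dom \<mu> = ded_vars S"
    "distinct Xs" "set Xs \<inter> snd ` ded_pairs S = {}" "\<forall>X \<in> set Xs. the (\<theta> X) \<in> terms Sig (dom \<Phi>)"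
    "beh_ins (den P \<mu>) (map (\<lambda>X. recipe_val (val_frame (fsubst \<mu> \<Phi>)) (the (\<theta> X))) Xs) = Some b"
    "if ws = [] then b = Stop else length ws = length (fst (beh_outs b))"
    "distinct ws" "set ws \<inter> dom \<Phi> = {}" "l = IStar \<or> l = IPlus \<and> Xs \<noteq> []"
  shows "\<exists>R \<Phi>' S' \<mu>'. focused l (P, \<Phi>, S) (map (Inp c) Xs @ map (Outp c) ws) (R, \<Phi>', S') \<and>
    sat_sol \<theta> \<mu>' \<Phi>' S' \<and> dom \<mu>' = ded_vars S'"
  using assms(2-)
proof (induction "depth P" arbitrary: P S \<mu> Xs l rule: less_induct)
  case less
  note prems = less.prems
  show ?case
  proof (cases P)
    case PNull
    then have "Xs = []" "ws = []" using prems(9,10) by (cases Xs; auto split: if_splits)+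
    then show ?thesis using foc_improper[of \<Phi> S] prems(4,5,13) PNull
      by (intro exI[of _ None] exI[of _ \<Phi>] exI[of _ S] exI[of _ \<mu>]) simp
  next
    case (PIf u v P1 P2)
    obtain R S1 where R: "sym_step (PIf u v P1 P2, \<Phi>, S) Tau (R, \<Phi>, S1)" "basic_on c R"
      "fv_proc R \<subseteq> ded_vars S1" "winv \<Phi> S1" "sat_sol \<theta> \<mu> \<Phi> S1" "den R \<mu> = den (PIf u v P1 P2) \<mu>"
      "ded_vars S1 = ded_vars S" "ded_pairs S1 = ded_pairs S" "R = P1 \<or> R = P2"
      using prems(1-4) unfolding PIf by (rule sym_test)
    have "\<exists>R' \<Phi>' S' \<mu>'. focused l (R, \<Phi>, S1) (map (Inp c) Xs @ map (Outp c) ws) (R', \<Phi>', S') \<and>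
      sat_sol \<theta> \<mu>' \<Phi>' S' \<and> dom \<mu>' = ded_vars S'"
      by (rule less.hyps[OF _ R(2-5)]) (use prems(5-) R(6-9) in \<open>auto simp: PIf\<close>)
    then show ?thesis using foc_tau[OF R(1)] unfolding PIf by blast
  next
    case (POut d u P1)
    then have Xs: "Xs = []" using prems(9) by (cases Xs) auto
    then have b: "b = den P \<mu>" using prems(9) by simp
    then have "ws \<noteq> []" using prems(10) POut by (auto split: if_splits)
    then obtain w ws' where ws: "ws = w # ws'" by (cases ws) auto
    have l: "l = IStar" using prems(13) Xs by simp
    have "length ws = length (fst (beh_outs (den P \<mu>)))" using prems(10) b ws by simp
    from lift_O[OF prems(1-4) this prems(11,12)] obtain R \<Phi>' S' where
      R: "focused OStar (P, \<Phi>, S) (map (Outp c) ws) (Some R, \<Phi>', S')" "sat_sol \<theta> \<mu> \<Phi>' S'"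
      "ded_vars S' = ded_vars S" by blast
    \<comment> \<open>The first output may open the output phase in mode \<open>IStar\<close> just
      as it continues it in mode \<open>OStar\<close>.\<close>
    from R(1) have "focused IStar (P, \<Phi>, S) (map (Outp c) ws) (Some R, \<Phi>', S')"
      unfolding ws POut by cases (auto intro: foc_out elim: sym_step_TauE)
    then show ?thesis using R(2,3) prems(5) l Xs
      by (intro exI[of _ "Some R"] exI[of _ \<Phi>'] exI[of _ S'] exI[of _ \<mu>]) simp
  next
    case (PIn d y Q)
    have d: "d = c" and bQ: "basic_on c Q" using prems(1) by (auto simp: PIn elim: basic_on_PInE)
    \<comment> \<open>With no input left, \<open>b\<close> would be a \<open>Recv\<close>, which is
      neither \<open>Stop\<close> nor has anything to send.\<close>
    have "Xs \<noteq> []"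
    proof
      assume "Xs = []"
      then have "b = den P \<mu>" using prems(9) by simp
      then show False using prems(10) by (auto simp: PIn split: if_splits)
    qed
    then obtain X Xs' where Xs: "Xs = X # Xs'" by (cases Xs) auto
    have "finite (ded_vars S \<union> vars_proc P)"
    proof -
      have "ded_vars S \<subseteq> (\<Union>k \<in> S. fv1_constr k)" by (force simp: ded_vars_def)
      then have "finite (ded_vars S)"
        using winvD(2)[OF prems(3)] finite_fv1_constr by (meson finite_UN finite_subset)
      then show ?thesis by (simp add: finite_vars_proc)
    qed
    then obtain x where x: "x \<notin> ded_vars S" "x \<notin> vars_proc P"
      using ex_new_if_finite[OF inf] by blast
    define t where "t = recipe_msg (fsubst \<mu> \<Phi>) (the (\<theta> X))"
    let ?\<mu> = "\<mu>(x \<mapsto> t)" and ?S = "insert (Ded (dom \<Phi>) X x) S" and ?Q = "psubst y (Atom (Var x)) Q"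
    have tX: "the (\<theta> X) \<in> terms Sig (dom \<Phi>)" using prems(8) by (simp add: Xs)
    note I = sat_sol_In[OF prems(4,3) x(1) tX, folded t_def]
    have tm: "t \<in> messages" using I(1) ground_messages_subset by blast
    have \<mu>m: "ran \<mu> \<subseteq> messages" using prems(4) ground_messages_subset by (auto simp: sat_sol_def)
    have fresh: "X \<notin> fv2 (\<Phi>, S)" "x \<notin> fv1 (\<Phi>, S)"
      using prems(7) x(1) winv_fv1[OF prems(3)] winv_fv2[OF prems(3)] by (auto simp: Xs)
    have st: "sym_step (P, \<Phi>, S) (Inp c X) (?Q, \<Phi>, ?S)"
      using sym_in[OF fresh, of c y Q] x(2) by (simp add: PIn d)
    have w: "winv \<Phi> ?S" by (rule winv_In[OF prems(3) fresh])
    have "den ?Q ?\<mu> = den Q (?\<mu>(y \<mapsto> t))"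
      using den_psubst[of "Atom (Var x)" Q y ?\<mu>] x(2) by (simp add: PIn)
    \<comment> \<open>Once \<open>y\<close> carries the value, the fresh variable \<open>x\<close>
      can be forgotten.\<close>
    also have "\<dots> = den Q (\<mu>(y \<mapsto> t))"
    proof (rule den_cong[OF bQ])
      fix z assume "z \<in> fv_proc Q"
      then have "z \<noteq> x" using x(2) fv_proc_subset_vars[of Q] by (auto simp: PIn)
      then show "fo_val (?\<mu>(y \<mapsto> t)) z =\<^sub>E fo_val (\<mu>(y \<mapsto> t)) z"
        using tm fo_val_messages[OF \<mu>m] by (simp add: fo_val_upd eqE_refl)
    qed
    also have "\<dots> = den Q (\<mu>(y \<mapsto> canon t))" using den_canon[OF bQ tm, of \<mu> y] fo_val_messages[OF \<mu>m] by simp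
    finally have den: "den ?Q ?\<mu> = den Q (\<mu>(y \<mapsto> canon t))" .
    have rv: "recipe_val (val_frame (fsubst \<mu> \<Phi>)) (the (\<theta> X)) = canon t"
      unfolding t_def by (rule recipe_val_val_frame[OF ran_fsubst[OF \<mu>m winvD(3)[OF prems(3)]]]) (simp add: tX)
    have ins: "beh_ins (den ?Q ?\<mu>) (map (\<lambda>X. recipe_val (val_frame (fsubst ?\<mu> \<Phi>)) (the (\<theta> X))) Xs') = Some b"
      using prems(9) canon_messages[OF tm] by (simp add: Xs PIn rv den I(3))
    have "\<exists>R \<Phi>' S' \<mu>'. focused IStar (?Q, \<Phi>, ?S) (map (Inp c) Xs' @ map (Outp c) ws) (R, \<Phi>', S') \<and>
      sat_sol \<theta> \<mu>' \<Phi>' S' \<and> dom \<mu>' = ded_vars S'"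
    proof (rule less.hyps[OF _ _ _ w I(2) _ _ _ _ ins prems(10-12)])
      show "depth ?Q < depth P" by (simp add: PIn)
      show "basic_on c ?Q" by (rule basic_on_psubst[OF bQ]) simp
      show "fv_proc ?Q \<subseteq> ded_vars ?S"
        using prems(2) fv_proc_psubst[of y "Atom (Var x)" Q] by (auto simp: PIn)
      show "dom ?\<mu> = ded_vars ?S" using prems(5) by simp
      show "distinct Xs'" "\<forall>X \<in> set Xs'. the (\<theta> X) \<in> terms Sig (dom \<Phi>)" using prems(6,8) by (auto simp: Xs)
      show "set Xs' \<inter> snd ` ded_pairs ?S = {}" using prems(6,7) by (auto simp: Xs)
    qed simp
    then obtain R \<Phi>' S' \<mu>' where
      "focused IStar (?Q, \<Phi>, ?S) (map (Inp c) Xs' @ map (Outp c) ws) (R, \<Phi>', S')"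
      "sat_sol \<theta> \<mu>' \<Phi>' S'" "dom \<mu>' = ded_vars S'" by blast
    moreover from foc_in[OF st this(1), of l]
    have "focused l (P, \<Phi>, S) (map (Inp c) Xs @ map (Outp c) ws) (R, \<Phi>', S')"
      using prems(13) by (auto simp: Xs)
    ultimately show ?thesis by blast
  qed
qed

end

text \<open>A single use of the generating rules of \<open>compressed\<close>, without reflexivity
  and transitivity.\<close>

definition comp_step ::
    "('c, 'f, 'n, 'x, 'w, 's) sproc \<Rightarrow> ('c, 's, 'w) act list \<Rightarrow> ('c, 'f, 'n, 'x, 'w, 's) sproc \<Rightarrow> bool" where
  "comp_step K tr K' \<longleftrightarrow> (\<exists>Q \<R> \<Phi> S R \<Phi>' S'. K = ({#Q#} + \<R>, \<Phi>, S) \<and>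
     focused IPlus (Q, \<Phi>, S) tr (R, \<Phi>', S') \<and>
     K' = (case R of None \<Rightarrow> ({#}, \<Phi>', S') | Some Q' \<Rightarrow> (single Q' + \<R>, \<Phi>', S')))"

lemma comp_step_compressed: "comp_step K tr K' \<Longrightarrow> compressed K tr K'"
proof -
  assume "comp_step K tr K'"
  then obtain Q \<R> \<Phi> S R \<Phi>' S' where *: "K = ({#Q#} + \<R>, \<Phi>, S)" "focused IPlus (Q, \<Phi>, S) tr (R, \<Phi>', S')"
    "K' = (case R of None \<Rightarrow> ({#}, \<Phi>', S') | Some Q' \<Rightarrow> (single Q' + \<R>, \<Phi>', S'))"
    unfolding comp_step_def by blast
  show ?thesis
  proof (cases R)
    case None
    show ?thesis using comp_improper[of Q \<Phi> S tr \<Phi>' S' \<R>] * None by simp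
  next
    case (Some Q')
    show ?thesis using comp_proper[of Q \<Phi> S tr Q' \<Phi>' S' \<R>] * Some by simp
  qed
qed

lemma compressed_cases:
  "compressed K tr K' \<Longrightarrow> (tr = [] \<and> K' = K) \<or>
     (\<exists>K1 t1 t2. tr = t1 @ t2 \<and> comp_step K t1 K1 \<and> compressed K1 t2 K')"
proof (induction rule: compressed.induct)
  case (comp_trans K tr K' tr' K'')
  then show ?case using compressed.comp_trans by (metis append.assoc append_Nil)
next
  case (comp_proper Q \<Phi> S tr Q' \<Phi>' S' \<P>)
  then have "comp_step ({#Q#} + \<P>, \<Phi>, S) tr (single Q' + \<P>, \<Phi>', S')"
    unfolding comp_step_def by (intro exI conjI) (rule refl, assumption, simp)
  then show ?case using comp_refl by (metis append_Nil2)
next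
  case (comp_improper Q \<Phi> S tr \<Phi>' S' \<P>)
  then have "comp_step ({#Q#} + \<P>, \<Phi>, S) tr ({#}, \<Phi>', S')"
    unfolding comp_step_def by (intro exI conjI) (rule refl, assumption, simp)
  then show ?case using comp_refl by (metis append_Nil2)
qed simp

text \<open>Makes block boundaries visible in the trace: a focused block begins with an input and,
  unless it is improper, ends with an output.\<close>

lemma focused_shape:
  "focused l K tr K' \<Longrightarrow> \<exists>is os. tr = is @ os \<and> (\<forall>a \<in> set is. \<exists>c X. a = Inp c X) \<and>
     (\<forall>a \<in> set os. \<exists>c w. a = Outp c w) \<and> (l = OStar \<longrightarrow> is = []) \<and> (l = IPlus \<longrightarrow> is \<noteq> []) \<and>
     (fst K' \<noteq> None \<and> l \<noteq> OStar \<longrightarrow> os \<noteq> [])"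
proof (induction rule: focused.induct)
  case (foc_in K c X K' tr K'' l)
  then obtain "is" os where "tr = is @ os" "\<forall>a \<in> set is. \<exists>c X. a = Inp c X"
    "\<forall>a \<in> set os. \<exists>c w. a = Outp c w" "fst K'' \<noteq> None \<longrightarrow> os \<noteq> []" by auto
  then show ?case using foc_in.hyps(3) by (intro exI[of _ "Inp c X # is"] exI[of _ os]) auto
next
  case (foc_out K c w K' tr K'' l)
  then show ?case by (intro exI[of _ "[]"] exI[of _ "Outp c w # tr"]) auto
next
  case (foc_tau K K' l tr K'')
  then show ?case by blast
qed auto

text \<open>Transitivity cannot split a block. After a first part either no process is left, or an
  output would be followed by the input that opens the second part, and a block contains no such
  place.\<close>

lemma compressed_block:
  assumes "compressed K (io (Block c Xs ws)) K'" "Xs \<noteq> []"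
  shows "comp_step K (io (Block c Xs ws)) K'"
proof -
  from compressed_cases[OF assms(1)] assms(2) obtain K1 t1 t2 where
    t: "io (Block c Xs ws) = t1 @ t2" "comp_step K t1 K1" "compressed K1 t2 K'"
    by auto
  from t(2) obtain Q \<R> \<Phi> S R \<Phi>' S' where foc: "focused IPlus (Q, \<Phi>, S) t1 (R, \<Phi>', S')" and
    K1: "K1 = (case R of None \<Rightarrow> ({#}, \<Phi>', S') | Some Q' \<Rightarrow> (single Q' + \<R>, \<Phi>', S'))"
    by (auto simp: comp_step_def)
  from focused_shape[OF foc] obtain is1 os1 where s1: "t1 = is1 @ os1"
    "\<forall>a \<in> set os1. \<exists>c w. a = Outp c w" "R \<noteq> None \<Longrightarrow> os1 \<noteq> []" by auto
  have "t2 = [] \<and> K' = K1"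
  proof (rule ccontr)
    assume "\<not> (t2 = [] \<and> K' = K1)"
    with compressed_cases[OF t(3)] obtain K2 t3 t4 where t3: "t2 = t3 @ t4" "comp_step K1 t3 K2" by blast
    from t3(2) obtain Q2 \<R>2 \<Phi>2 S2 R2 \<Phi>3 S3 where foc2: "focused IPlus (Q2, \<Phi>2, S2) t3 (R2, \<Phi>3, S3)"
      and K1': "K1 = ({#Q2#} + \<R>2, \<Phi>2, S2)" by (auto simp: comp_step_def)
    have "R \<noteq> None"
    proof
      assume "R = None"
      then show False using K1 K1' by simp
    qed
    then obtain d w os' where os: "os1 = os' @ [Outp d w]"
      using s1(2,3) by (cases os1 rule: rev_cases) auto
    from focused_shape[OF foc2] obtain is2 os2 where "t3 = is2 @ os2" "\<forall>a \<in> set is2. \<exists>c X. a = Inp c X"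
      "is2 \<noteq> []" by auto
    then obtain e X r where r: "t3 = Inp e X # r" by (cases is2) auto
    define p where "p = is1 @ os'"
    have eq: "map (Inp c) Xs @ map (Outp c) ws = p @ Outp d w # Inp e X # (r @ t4)"
      using t(1) by (simp add: s1(1) os t3(1) r p_def)
    have "length p + 1 < length Xs + length ws"
      using arg_cong[OF eq, of length] by simp
    moreover have "(map (Inp c) Xs @ map (Outp c) ws) ! length p = Outp d w"
      "(map (Inp c) Xs @ map (Outp c) ws) ! Suc (length p) = Inp e X"
      unfolding eq by (simp_all add: nth_append)
    ultimately show False by (auto simp: nth_append split: if_splits)
  qed
  with t show ?thesis by simp
qed

section \<open>Reduced semantics and solutions\<close>

definition conc :: "('f, 'w, 's) so_subst \<Rightarrow> ('c, 's, 'w) block \<Rightarrow> ('c, ('f, 'w) recipe, 'w) block" where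
  "conc \<theta> B = Block (chan B) (map (\<lambda>X. the (\<theta> X)) (inputs B)) (outputs B)"

lemma conc_simps [simp]:
  "chan (conc \<theta> B) = chan B" "inputs (conc \<theta> B) = map (\<lambda>X. the (\<theta> X)) (inputs B)"
  "outputs (conc \<theta> B) = outputs B"
  by (simp_all add: conc_def)

lemma dep_conc [simp]: "dep (map (conc \<theta>) tr) c = dep tr c"
proof -
  have "k < length tr \<Longrightarrow> chan (map (conc \<theta>) tr ! k) = chan (tr ! k)"
    "k < length tr \<Longrightarrow> outputs (map (conc \<theta>) tr ! k) = outputs (tr ! k)" for k
    by simp_all
  then show ?thesis unfolding dep_def length_map by (intro Collect_cong ex_cong) (auto cong: conj_cong)
qed

lemma bouts_conc [simp]: "bouts (map (conc \<theta>) tr) = bouts tr"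
  by (simp add: bouts_def)

text \<open>A block is kept together with what precedes it, since this determines its available
  handles and its dependency.\<close>

definition blocks_at :: "'b list \<Rightarrow> ('b list \<times> 'b) set" where
  "blocks_at tr = {(p, B). \<exists>r. tr = p @ B # r}"

lemma blocks_at_Nil [simp]: "blocks_at [] = {}"
  by (simp add: blocks_at_def)

lemma blocks_at_snoc: "blocks_at (tr @ [B]) = insert (tr, B) (blocks_at tr)"
proof -
  have "tr @ [B] = p @ B' # r \<longleftrightarrow> (p = tr \<and> B' = B \<and> r = []) \<or> (\<exists>r'. r = r' @ [B] \<and> tr = p @ B' # r')"
    for p B' r
    by (cases r rule: rev_cases) auto
  then show ?thesis unfolding blocks_at_def by auto
qed

lemma blocks_at_Ball:
  "(\<forall>(p, B) \<in> blocks_at tr. \<phi> p B) \<longleftrightarrow> (\<forall>p B r. tr = p @ B # r \<longrightarrow> \<phi> p B)"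
  by (auto simp: blocks_at_def)

lemma blocks_at_map: "blocks_at (map f tr) = (\<lambda>(p, B). (map f p, f B)) ` blocks_at tr"
  by (induction tr rule: rev_induct) (simp_all add: blocks_at_snoc)

definition dep_pairs :: "('f, 'n, 'x, 'w, 's) constr set \<Rightarrow> ('s list \<times> 'w set) set" where
  "dep_pairs S = {(Xs, ws). Dep Xs ws \<in> S}"

context equational_setting
begin

lemma depok_blocks_at:
  "depok D F bl \<longleftrightarrow> (\<forall>(p, B) \<in> blocks_at bl. dep p (chan B) \<noteq> {} \<longrightarrow>
     (\<exists>N \<in> set (inputs B). \<forall>M \<in> terms Sig (D \<union> bouts p).
        recipe_val F M = recipe_val F N \<longrightarrow> atoms M \<inter> dep p (chan B) \<noteq> {}))"
  unfolding depok_def blocks_at_Ball ..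

text \<open>Apart from the tests and the names of first-order variables, the constraint system is
  read off from the blocks and the initial handles \<open>D0\<close>.\<close>

definition sym_inv ::
    "'w set \<Rightarrow> ('c :: linorder, 's, 'w) block list \<Rightarrow> ('c \<Rightarrow> ('c, 'f, 'n, 'x) proc) \<Rightarrow>
     ('f, 'n, 'x, 'w) frame \<Rightarrow> ('f, 'n, 'x, 'w, 's) constr set \<Rightarrow> bool" where
  "sym_inv D0 tr f \<Phi> S \<longleftrightarrow> winv \<Phi> S \<and> (\<forall>c. ready (f c) \<and> fv_proc (f c) \<subseteq> ded_vars S) \<and>
     distinct (concat (map inputs tr)) \<and> dom \<Phi> = D0 \<union> bouts tr \<and>
     ded_pairs S = (\<Union>(p, B) \<in> blocks_at tr. {D0 \<union> bouts p} \<times> set (inputs B)) \<and>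
     dep_pairs S = (\<lambda>(p, B). (inputs B, dep p (chan B))) ` blocks_at tr"

lemma sym_inv_vars:
  assumes "sym_inv D0 tr f \<Phi> S"
  shows "snd ` ded_pairs S = set (concat (map inputs tr))"
proof -
  have "ded_pairs S = (\<Union>(p, B) \<in> blocks_at tr. {D0 \<union> bouts p} \<times> set (inputs B))"
    using assms by (simp only: sym_inv_def)
  then have "snd ` ded_pairs S = (\<Union>(p, B) \<in> blocks_at tr. set (inputs B))"
    by (simp add: image_UN case_prod_unfold)
  also have "\<dots> = set (concat (map inputs tr))"
    by (induction tr rule: rev_induct) (simp_all add: blocks_at_snoc Un_commute)
  finally show ?thesis .
qed

text \<open>After an improper block the multiset is empty, which the constant function
  \<open>PNull\<close> represents. Together with \<open>f c \<noteq> PNull\<close> this excludes any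
  later block.\<close>

lemma comp_step_block:
  fixes c :: "'c :: linorder" and Xs :: "'s list" and ws :: "'w list"
  assumes "comp_step (\<P>, \<Phi>, S) (io (Block c Xs ws)) (\<P>', \<Phi>', S')" "procs_rep \<P> f" "sym_inv D0 tr f \<Phi> S"
    "Xs \<noteq> []"
  obtains f' where "procs_rep \<P>' f'" "f c \<noteq> PNull"
    "sym_inv D0 (tr @ [Block c Xs ws]) f' \<Phi>' (insert (Dep Xs (dep tr c)) S')"
    "winv \<Phi> S" "S \<subseteq> S'" "\<Phi> \<subseteq>\<^sub>m \<Phi>'" "winv \<Phi>' S'"
    "\<And>\<theta> \<mu>. sat_sol \<theta> \<mu> \<Phi>' S' \<Longrightarrow> set ws \<inter> dom \<Phi> = {} \<and> distinct ws \<and> dom \<Phi>' = dom \<Phi> \<union> set ws \<and>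
       (\<forall>X \<in> set Xs. the (\<theta> X) \<in> terms Sig (dom \<Phi>)) \<and>
       (\<exists>b. beh_ins (den (f c) \<mu>) (map (\<lambda>X. recipe_val (val_frame (fsubst \<mu> \<Phi>)) (the (\<theta> X))) Xs) = Some b \<and>
         (if ws = [] then b = Stop \<and> f' = (\<lambda>_. PNull) else \<exists>Q. f' = f(c := Q) \<and>
            beh_outs b = (map (\<lambda>w. the (val_frame (fsubst \<mu> \<Phi>') w)) ws, den Q \<mu>)))"
proof -
  from assms(1) obtain P \<R> R where P: "\<P> = {#P#} + \<R>" and
    foc: "focused IPlus (P, \<Phi>, S) (io (Block c Xs ws)) (R, \<Phi>', S')" and
    \<P>': "\<P>' = (case R of None \<Rightarrow> {#} | Some Q' \<Rightarrow> single Q' + \<R>)"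
    unfolding comp_step_def by (auto split: option.splits)
  obtain d where d: "f d = P" "P \<noteq> PNull" "\<And>Q. basic_on d Q \<Longrightarrow> procs_rep (single Q + \<R>) (f(d := Q))"
    using assms(2) unfolding P by (rule procs_rep_member) (rule that; assumption)
  note si = assms(3)[unfolded sym_inv_def]
  have bP: "basic_on d P" using assms(2) d(1) by (auto simp: procs_rep_def)
  have fvP: "fv_proc P \<subseteq> ded_vars S" using si d(1) by auto
  have w: "winv \<Phi> S" using si by blast
  obtain Xs' ws' where foc': "io (Block c Xs ws) = map (Inp d) Xs' @ map (Outp d) ws'"
    "grow \<Phi> S Xs' ws' \<Phi>' S'" "R = None \<longleftrightarrow> ws' = []"
    "\<And>Q. R = Some Q \<Longrightarrow> ready Q \<and> basic_on d Q \<and> fv_proc Q \<subseteq> ded_vars S'"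
    and sem: "\<And>\<theta> \<mu>. sat_sol \<theta> \<mu> \<Phi>' S' \<Longrightarrow> (let F = val_frame (fsubst \<mu> \<Phi>') in
       \<exists>b. beh_ins (den P \<mu>) (map (\<lambda>X. recipe_val F (the (\<theta> X))) Xs') = Some b \<and>
         (R = None \<longrightarrow> b = Stop) \<and>
         (\<forall>Q. R = Some Q \<longrightarrow> beh_outs b = (map (\<lambda>w. the (F w)) ws', den Q \<mu>)))"
    using focused_I[OF foc _ refl refl bP fvP w] by blast
  \<comment> \<open>The inputs and outputs of the block are separated by filters; the first input
    then identifies the channel.\<close>
  have eq: "d = c" "Xs' = Xs" "ws' = ws"
  proof -
    have fi: "filter (\<lambda>a. \<exists>c X. a = Inp c X) (map (Inp c) Xs @ map (Outp c) ws) = map (Inp c) Xs"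
      and fo: "filter (\<lambda>a. \<exists>c w. a = Outp c w) (map (Inp c) Xs @ map (Outp c) ws) = map (Outp c) ws"
      for c :: 'c and Xs and ws
      by (auto simp: filter_empty_conv filter_id_conv)
    have "(map (Inp c) Xs :: ('c, 's, 'w) act list) = map (Inp d) Xs'"
      using arg_cong[OF foc'(1), of "filter (\<lambda>a. \<exists>c X. a = Inp c X)"] unfolding io.simps fi .
    moreover have "(map (Outp c) ws :: ('c, 's, 'w) act list) = map (Outp d) ws'"
      using arg_cong[OF foc'(1), of "filter (\<lambda>a. \<exists>c w. a = Outp c w)"] unfolding io.simps fo .
    moreover obtain X Ys where "Xs = X # Ys" using assms(4) by (cases Xs) auto
    ultimately have d: "d = c" and i: "(map (Inp c) Xs :: ('c, 's, 'w) act list) = map (Inp c) Xs'"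
      "(map (Outp c) ws :: ('c, 's, 'w) act list) = map (Outp c) ws'"
      by (cases Xs'; simp)+
    show "d = c" by (rule d)
    show "Xs' = Xs" using i(1) by (auto dest!: map_injective simp: inj_def)
    show "ws' = ws" using i(2) by (auto dest!: map_injective simp: inj_def)
  qed
  note grow = foc'(2)[unfolded eq grow_def]
  from grow have SS: "S \<subseteq> S'" and FF: "\<Phi> \<subseteq>\<^sub>m \<Phi>'" and w': "winv \<Phi>' S'"
    and dom': "dom \<Phi>' = dom \<Phi> \<union> set ws" "distinct ws" "set ws \<inter> dom \<Phi> = {}"
    and dXs: "distinct Xs" and Xs: "set Xs \<inter> snd ` ded_pairs S = {}"
    and pairs: "ded_pairs S' = ded_pairs S \<union> {dom \<Phi>} \<times> set Xs"
    and deps: "\<And>Ys vs. Dep Ys vs \<in> S' \<longleftrightarrow> Dep Ys vs \<in> S"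
    by simp_all
  from si have si': "distinct (concat (map inputs tr))" "dom \<Phi> = D0 \<union> bouts tr"
     "ded_pairs S = (\<Union>(p, B) \<in> blocks_at tr. {D0 \<union> bouts p} \<times> set (inputs B))"
     "dep_pairs S = (\<lambda>(p, B). (inputs B, dep p (chan B))) ` blocks_at tr"
    by simp_all
  have pairs': "ded_pairs S' = ded_pairs S \<union> {D0 \<union> bouts tr} \<times> set Xs" by (simp only: pairs si'(2))
  have D: "dep_pairs (insert (Dep Xs (dep tr c)) S') = insert (Xs, dep tr c) (dep_pairs S)"
    using deps by (auto simp: dep_pairs_def)
  have "set Xs \<subseteq> snd ` ded_pairs S'" unfolding pairs by (simp add: image_Un)
  then have wD: "winv \<Phi>' (insert (Dep Xs (dep tr c)) S')" by (rule winv_Dep[OF w'])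
  have disj: "set Xs \<inter> set (concat (map inputs tr)) = {}" using Xs by (simp only: sym_inv_vars[OF assms(3)])
  have inv: "sym_inv D0 (tr @ [Block c Xs ws]) f' \<Phi>' (insert (Dep Xs (dep tr c)) S')"
    if "\<And>c. ready (f' c) \<and> fv_proc (f' c) \<subseteq> ded_vars S'" for f'
    unfolding sym_inv_def
  proof (intro conjI wD)
    show "\<forall>d. ready (f' d) \<and> fv_proc (f' d) \<subseteq> ded_vars (insert (Dep Xs (dep tr c)) S')"
      using that by simp
    show "distinct (concat (map inputs (tr @ [Block c Xs ws])))"
      using si'(1) dXs disj by (simp add: Int_commute)
    show "dom \<Phi>' = D0 \<union> bouts (tr @ [Block c Xs ws])" by (simp add: dom' si'(2) Un_assoc)
    show "ded_pairs (insert (Dep Xs (dep tr c)) S') =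
        (\<Union>(p, B) \<in> blocks_at (tr @ [Block c Xs ws]). {D0 \<union> bouts p} \<times> set (inputs B))"
      by (simp add: pairs' si'(3) blocks_at_snoc Un_commute)
    show "dep_pairs (insert (Dep Xs (dep tr c)) S') =
        (\<lambda>(p, B). (inputs B, dep p (chan B))) ` blocks_at (tr @ [Block c Xs ws])"
      by (simp add: D si'(4) blocks_at_snoc)
  qed
  have sem2: "set ws \<inter> dom \<Phi> = {} \<and> distinct ws \<and> dom \<Phi>' = dom \<Phi> \<union> set ws \<and>
       (\<forall>X \<in> set Xs. the (\<theta> X) \<in> terms Sig (dom \<Phi>)) \<and>
       (\<exists>b. beh_ins (den (f c) \<mu>) (map (\<lambda>X. recipe_val (val_frame (fsubst \<mu> \<Phi>)) (the (\<theta> X))) Xs) = Some b \<and>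
         (R = None \<longrightarrow> b = Stop) \<and>
         (\<forall>Q. R = Some Q \<longrightarrow> beh_outs b = (map (\<lambda>w. the (val_frame (fsubst \<mu> \<Phi>') w)) ws, den Q \<mu>)))"
    if s: "sat_sol \<theta> \<mu> \<Phi>' S'" for \<theta> \<mu>
  proof -
    have X: "the (\<theta> X) \<in> terms Sig (dom \<Phi>)" if "X \<in> set Xs" for X
      using s that unfolding sat_sol_def pairs by auto
    have "val_frame (fsubst \<mu> \<Phi>) \<subseteq>\<^sub>m val_frame (fsubst \<mu> \<Phi>')"
      by (intro val_frame_mono fsubst_mono FF)
    then have m: "map (\<lambda>X. recipe_val (val_frame (fsubst \<mu> \<Phi>')) (the (\<theta> X))) Xs =
        map (\<lambda>X. recipe_val (val_frame (fsubst \<mu> \<Phi>)) (the (\<theta> X))) Xs"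
      using X by (intro map_cong refl recipe_val_mono) simp_all
    show ?thesis unfolding d(1)[unfolded eq(1)]
      using sem[OF s, unfolded Let_def eq m] X dom' by blast
  qed
  show ?thesis
  proof (cases R)
    case None
    let ?f = "\<lambda>_. PNull"
    have "procs_rep \<P>' ?f" by (simp add: procs_rep_def \<P>' None basic_on.intros)
    moreover have "sym_inv D0 (tr @ [Block c Xs ws]) ?f \<Phi>' (insert (Dep Xs (dep tr c)) S')"
      by (rule inv) (simp add: ready_def)
    moreover have "ws = []" using foc'(3) None eq by simp
    moreover have "f c \<noteq> PNull" using d eq by auto
    ultimately show ?thesis using that[of ?f] w SS FF w' sem2 None by simp
  next
    case (Some Q)
    let ?f = "f(c := Q)"
    have Q: "ready Q" "basic_on c Q" "fv_proc Q \<subseteq> ded_vars S'" using foc'(4)[OF Some] eq by auto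
    have 1: "procs_rep \<P>' ?f" using d(3) Q(2) eq by (simp add: \<P>' Some)
    have 2: "sym_inv D0 (tr @ [Block c Xs ws]) ?f \<Phi>' (insert (Dep Xs (dep tr c)) S')"
      by (rule inv) (use Q si ded_vars_mono[OF SS] in auto)
    have ne: "ws \<noteq> []" using foc'(3) Some eq by simp
    have 3: "f c \<noteq> PNull" using d eq by auto
    have 4: "set ws \<inter> dom \<Phi> = {} \<and> distinct ws \<and> dom \<Phi>' = dom \<Phi> \<union> set ws \<and>
       (\<forall>X \<in> set Xs. the (\<theta> X) \<in> terms Sig (dom \<Phi>)) \<and>
       (\<exists>b. beh_ins (den (f c) \<mu>) (map (\<lambda>X. recipe_val (val_frame (fsubst \<mu> \<Phi>)) (the (\<theta> X))) Xs) = Some b \<and>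
         (if ws = [] then b = Stop \<and> ?f = (\<lambda>_. PNull) else \<exists>Q'. ?f = f(c := Q') \<and>
            beh_outs b = (map (\<lambda>w. the (val_frame (fsubst \<mu> \<Phi>') w)) ws, den Q' \<mu>)))"
      if s: "sat_sol \<theta> \<mu> \<Phi>' S'" for \<theta> \<mu>
    proof -
      from sem2[OF s] obtain b where
        "beh_ins (den (f c) \<mu>) (map (\<lambda>X. recipe_val (val_frame (fsubst \<mu> \<Phi>)) (the (\<theta> X))) Xs) = Some b"
        "beh_outs b = (map (\<lambda>w. the (val_frame (fsubst \<mu> \<Phi>') w)) ws, den Q \<mu>)"
        using Some by blast
      then have "\<exists>b. beh_ins (den (f c) \<mu>) (map (\<lambda>X. recipe_val (val_frame (fsubst \<mu> \<Phi>)) (the (\<theta> X))) Xs) = Some b \<and>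
         (if ws = [] then b = Stop \<and> ?f = (\<lambda>_. PNull) else \<exists>Q'. ?f = f(c := Q') \<and>
            beh_outs b = (map (\<lambda>w. the (val_frame (fsubst \<mu> \<Phi>') w)) ws, den Q' \<mu>))"
        using ne by (intro exI[of _ b]) (simp only: if_False, blast)
      then show ?thesis using sem2[OF s] by blast
    qed
    show ?thesis by (rule that[OF 1 3 2 w SS FF w' 4])
  qed
qed

end

section \<open>Second-order variables as names of recipes\<close>

lemma fresh_list:
  assumes "infinite (UNIV :: 's set)" "finite A"
  shows "\<exists>Xs :: 's list. length Xs = n \<and> distinct Xs \<and> set Xs \<inter> A = {}"
proof (induction n)
  case (Suc n)
  then obtain Xs where Xs: "length Xs = n" "distinct Xs" "set Xs \<inter> A = {}" by blast
  have "finite (A \<union> set Xs)" using assms(2) by simp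
  from ex_new_if_finite[OF assms(1) this] obtain X where "X \<notin> A \<union> set Xs" by blast
  with Xs show ?case by (intro exI[of _ "X # Xs"]) auto
qed simp

text \<open>Each input receives a variable of its own, even if recipes coincide; the symbolic
  semantics demands fresh variables.\<close>

lemma symbolic_blocks:
  fixes bl :: "('c, ('f, 'w) recipe, 'w) block list"
  assumes "infinite (UNIV :: 's set)"
  shows "\<exists>(tr :: ('c, 's, 'w) block list) \<theta>. map (conc \<theta>) tr = bl \<and>
    distinct (concat (map inputs tr)) \<and> dom \<theta> = set (concat (map inputs tr))"
proof (induction bl)
  case Nil
  show ?case by (intro exI[of _ "[]"] exI[of _ Map.empty]) simp
next
  case (Cons B bl)
  then obtain tr :: "('c, 's, 'w) block list" and \<theta> where tr: "map (conc \<theta>) tr = bl"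
    "distinct (concat (map inputs tr))" "dom \<theta> = set (concat (map inputs tr))" by blast
  obtain Xs :: "'s list" where Xs: "length Xs = length (inputs B)" "distinct Xs"
    "set Xs \<inter> set (concat (map inputs tr)) = {}"
    using fresh_list[OF assms, of "set (concat (map inputs tr))" "length (inputs B)"] by auto
  define \<theta>' where "\<theta>' = \<theta> ++ map_of (zip Xs (inputs B))"
  have dm: "dom (map_of (zip Xs (inputs B))) = set Xs" using Xs(1) by (simp add: dom_map_of_zip)
  have old: "\<theta>' X = \<theta> X" if "X \<in> set (concat (map inputs tr))" for X
  proof -
    have "X \<notin> dom (map_of (zip Xs (inputs B)))" using that Xs(3) unfolding dm by blast
    then show ?thesis by (simp add: \<theta>'_def map_add_dom_app_simps(3))
  qed
  have new: "map (\<lambda>X. the (\<theta>' X)) Xs = inputs B"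
  proof (rule nth_equalityI)
    fix i assume i: "i < length (map (\<lambda>X. the (\<theta>' X)) Xs)"
    then have "map_of (zip Xs (inputs B)) (Xs ! i) = Some (inputs B ! i)"
      using Xs by (simp add: map_of_zip_nth)
    then show "map (\<lambda>X. the (\<theta>' X)) Xs ! i = inputs B ! i" using i by (simp add: \<theta>'_def)
  qed (simp add: Xs)
  have "map (conc \<theta>') tr = map (conc \<theta>) tr"
  proof (rule map_cong[OF refl])
    fix B' assume "B' \<in> set tr"
    then have "\<theta>' X = \<theta> X" if "X \<in> set (inputs B')" for X using that by (intro old) auto
    then show "conc \<theta>' B' = conc \<theta> B'" by (simp add: conc_def)
  qed
  moreover have "conc \<theta>' (Block (chan B) Xs (outputs B)) = B" using new by (cases B) (simp add: conc_def)
  moreover have "dom \<theta>' = set (concat (map inputs (Block (chan B) Xs (outputs B) # tr)))"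
    unfolding \<theta>'_def dom_map_add dm tr(3) by simp
  ultimately show ?case using tr Xs
    by (intro exI[of _ "Block (chan B) Xs (outputs B) # tr"] exI[of _ \<theta>']) simp
qed

section \<open>Reduced executions as maximal runs\<close>

context equational_setting
begin

definition improper_run where
  "improper_run s0 bl F \<longleftrightarrow> (\<exists>bl' c Ms \<beta>. bl = bl' @ [Block c Ms []] \<and> Ms \<noteq> [] \<and>
     set Ms \<subseteq> terms Sig (dom F) \<and> grun run_max s0 bl' (\<beta>, F) \<and>
     beh_ins (\<beta> c) (map (recipe_val F) Ms) = Some Stop)"

lemma frun_iff: "frun s0 bl F \<longleftrightarrow> (\<exists>\<beta>. grun run_max s0 bl (\<beta>, F)) \<or> improper_run s0 bl F"
  by (simp only: frun_def improper_run_def)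

lemma improper_run_not_max: "improper_run s0 bl F \<Longrightarrow> \<not> grun run_max s0 bl s"
proof
  assume "improper_run s0 bl F" and r: "grun run_max s0 bl s"
  then obtain bl' c Ms where bl: "bl = bl' @ [Block c Ms []]" unfolding improper_run_def by blast
  have "lrun run_max (snd s) (bproj c bl) (fst s0 c) = Some (fst s c)" using r by (simp only: grun_def)
  from lrun_max_nonempty[OF this, of "Block c Ms []"] show False by (simp add: bl)
qed

lemma frun_deterministic: "frun s0 bl F \<Longrightarrow> frun s0 bl F' \<Longrightarrow> F = F'"
proof -
  have det: "F = F'" if "grun run_max s0 bl (\<beta>, F)" "grun run_max s0 bl (\<beta>', F')" for bl \<beta> \<beta>' F F'
    using grun_deterministic[OF deterministic_run_max that] by simp
  assume "frun s0 bl F" "frun s0 bl F'"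
  then consider "\<exists>\<beta> \<beta>'. grun run_max s0 bl (\<beta>, F) \<and> grun run_max s0 bl (\<beta>', F')"
    | "improper_run s0 bl F" "improper_run s0 bl F'"
    unfolding frun_iff using improper_run_not_max by blast
  then show "F = F'"
  proof cases
    case 1
    then show ?thesis using det by blast
  next
    case 2
    then show ?thesis using det unfolding improper_run_def by blast
  qed
qed

lemma winv_initial: "ran \<Phi> \<subseteq> ground_messages \<Longrightarrow> finite (dom \<Phi>) \<Longrightarrow> winv \<Phi> {}"
  using ground_messages_subset by (auto simp: winv_def ground_messages_iff ded_rel_def acyclic_def)

lemma abs_state_initial:
  assumes "closed_rep (\<P>, \<Phi>) f"
  shows "abs_state f \<mu> \<Phi> = abs_state f Map.empty \<Phi>"
proof -
  have "den (f c) \<mu> = den (f c) Map.empty" for c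
    by (rule den_cong[of c]) (use assms in \<open>auto simp: closed_rep_def procs_rep_def\<close>)
  then show ?thesis using assms by (simp add: abs_state_def closed_rep_def fsubst_ground)
qed

text \<open>The same \<open>f'\<close> works for all solutions: the processes reached are determined
  by the symbolic execution, and a solution only evaluates them.\<close>

lemma reduced_proj:
  fixes S' :: "('f, 'n, 'x, 'w, 's) constr set"
  assumes "reduced (\<P>0, \<Phi>0, {}) tr (\<P>', \<Phi>', S')" "closed_rep (\<P>0, \<Phi>0) f0" "\<And>c. ready (f0 c)"
    "finite (dom \<Phi>0)"
  defines "s0 \<equiv> abs_state f0 Map.empty \<Phi>0"
  shows "\<exists>f'. procs_rep \<P>' f' \<and> sym_inv (dom \<Phi>0) tr f' \<Phi>' S' \<and>
    (\<forall>\<theta> \<mu>. sat_sol \<theta> \<mu> \<Phi>' S' \<longrightarrow> grun run_max s0 (map (conc \<theta>) tr) (abs_state f' \<mu> \<Phi>') \<or>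
       f' = (\<lambda>_. PNull) \<and> improper_run s0 (map (conc \<theta>) tr) (val_frame (fsubst \<mu> \<Phi>')))"
  using assms(1)
proof (induction "(\<P>0, \<Phi>0, {} :: ('f, 'n, 'x, 'w, 's) constr set)" tr "(\<P>', \<Phi>', S')" arbitrary: \<P>' \<Phi>' S' rule: reduced.induct)
  case red_refl
  have "procs_rep \<P>0 f0" "\<And>c. fv_proc (f0 c) = {}" "ran \<Phi>0 \<subseteq> ground_messages"
    using assms(2) by (auto simp: closed_rep_def)
  then show ?case using assms(3) winv_initial[of \<Phi>0] assms(4) abs_state_initial[OF assms(2)]
    by (intro exI[of _ f0]) (auto simp: sym_inv_def grun_Nil s0_def dep_pairs_def)
next
  case (red_block tr \<P>1 \<Phi>1 S1 c Xs ws \<P>2 \<Phi>2 S2)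
  obtain f1 where f1: "procs_rep \<P>1 f1" "sym_inv (dom \<Phi>0) tr f1 \<Phi>1 S1"
    and IH: "\<And>\<theta> \<mu>. sat_sol \<theta> \<mu> \<Phi>1 S1 \<Longrightarrow> grun run_max s0 (map (conc \<theta>) tr) (abs_state f1 \<mu> \<Phi>1) \<or>
       f1 = (\<lambda>_. PNull) \<and> improper_run s0 (map (conc \<theta>) tr) (val_frame (fsubst \<mu> \<Phi>1))"
    using red_block.hyps(2) by blast
  have cs: "comp_step (\<P>1, \<Phi>1, S1) (io (Block c Xs ws)) (\<P>2, \<Phi>2, S2)"
    by (rule compressed_block[OF red_block.hyps(3,4)])
  obtain f' where f': "procs_rep \<P>2 f'" "f1 c \<noteq> PNull"
    "sym_inv (dom \<Phi>0) (tr @ [Block c Xs ws]) f' \<Phi>2 (insert (Dep Xs (dep tr c)) S2)"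
    and w: "winv \<Phi>1 S1" "S1 \<subseteq> S2" "\<Phi>1 \<subseteq>\<^sub>m \<Phi>2" "winv \<Phi>2 S2"
    and sem: "\<And>\<theta> \<mu>. sat_sol \<theta> \<mu> \<Phi>2 S2 \<Longrightarrow> set ws \<inter> dom \<Phi>1 = {} \<and> distinct ws \<and> dom \<Phi>2 = dom \<Phi>1 \<union> set ws \<and>
       (\<forall>X \<in> set Xs. the (\<theta> X) \<in> terms Sig (dom \<Phi>1)) \<and>
       (\<exists>b. beh_ins (den (f1 c) \<mu>) (map (\<lambda>X. recipe_val (val_frame (fsubst \<mu> \<Phi>1)) (the (\<theta> X))) Xs) = Some b \<and>
         (if ws = [] then b = Stop \<and> f' = (\<lambda>_. PNull) else \<exists>Q. f' = f1(c := Q) \<and>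
            beh_outs b = (map (\<lambda>w. the (val_frame (fsubst \<mu> \<Phi>2) w)) ws, den Q \<mu>)))"
    by (rule comp_step_block[OF cs f1 red_block.hyps(4)]) (rule that; assumption)
  have "grun run_max s0 (map (conc \<theta>) (tr @ [Block c Xs ws])) (abs_state f' \<mu> \<Phi>2) \<or>
       f' = (\<lambda>_. PNull) \<and> improper_run s0 (map (conc \<theta>) (tr @ [Block c Xs ws])) (val_frame (fsubst \<mu> \<Phi>2))"
    if s: "sat_sol \<theta> \<mu> \<Phi>2 (S2 \<union> {Dep Xs (dep tr c)})" for \<theta> \<mu>
  proof -
    have s2: "sat_sol \<theta> \<mu> \<Phi>2 S2" by (rule sat_sol_mono[OF s w(4)]) auto
    have s1: "sat_sol \<theta> \<mu> \<Phi>1 S1" by (rule sat_sol_mono[OF s2 w(1,3,2)])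
    \<comment> \<open>The next block needs a process on \<open>c\<close>, so the run up to here is
      not improper.\<close>
    have r: "grun run_max s0 (map (conc \<theta>) tr) (abs_state f1 \<mu> \<Phi>1)" using IH[OF s1] f'(2) by auto
    let ?F1 = "val_frame (fsubst \<mu> \<Phi>1)" and ?F2 = "val_frame (fsubst \<mu> \<Phi>2)"
    have le: "?F1 \<subseteq>\<^sub>m ?F2" by (intro val_frame_mono fsubst_mono w(3))
    from sem[OF s2] obtain b where o: "set ws \<inter> dom \<Phi>1 = {}" "distinct ws" "dom \<Phi>2 = dom \<Phi>1 \<union> set ws"
      and X: "\<forall>X \<in> set Xs. the (\<theta> X) \<in> terms Sig (dom \<Phi>1)"
      and b: "beh_ins (den (f1 c) \<mu>) (map (\<lambda>X. recipe_val ?F1 (the (\<theta> X))) Xs) = Some b"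
      and res: "if ws = [] then b = Stop \<and> f' = (\<lambda>_. PNull) else \<exists>Q. f' = f1(c := Q) \<and>
            beh_outs b = (map (\<lambda>w. the (?F2 w)) ws, den Q \<mu>)"
      by blast
    have b': "beh_ins (den (f1 c) \<mu>) (map (recipe_val ?F1) (map (\<lambda>X. the (\<theta> X)) Xs)) = Some b"
      using b by (simp add: o_def)
    have X': "set (map (\<lambda>X. the (\<theta> X)) Xs) \<subseteq> terms Sig (dom ?F1)" using X by auto
    have B: "conc \<theta> (Block c Xs ws) = Block c (map (\<lambda>X. the (\<theta> X)) Xs) ws" by (simp add: conc_def)
    show ?thesis
    proof (cases "ws = []")
      case True
      have "?F2 = ?F1" by (rule map_le_dom_eq[OF le]) (simp add: o(3) True)
      then have "improper_run s0 (map (conc \<theta>) (tr @ [Block c Xs ws])) ?F2"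
        unfolding improper_run_def using r b' X' red_block.hyps(4) res True
        by (intro exI[of _ "map (conc \<theta>) tr"] exI[of _ c] exI[of _ "map (\<lambda>X. the (\<theta> X)) Xs"]
            exI[of _ "\<lambda>c. den (f1 c) \<mu>"]) (simp add: conc_def abs_state_def)
      with res True show ?thesis by simp
    next
      case False
      with res obtain Q where Q: "f' = f1(c := Q)" "beh_outs b = (map (\<lambda>w. the (?F2 w)) ws, den Q \<mu>)"
        by auto
      have "map ?F2 ws = map Some (map (\<lambda>w. the (?F2 w)) ws)"
      proof -
        have "?F2 w = Some (the (?F2 w))" if "w \<in> set ws" for w
        proof -
          have "w \<in> dom ?F2" using that o(3) by simp
          then obtain v where "?F2 w = Some v" unfolding dom_def by blast
          then show ?thesis by simp
        qed
        then show ?thesis by simp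
      qed
      then have run: "run_max (map (recipe_val ?F1) (map (\<lambda>X. the (\<theta> X)) Xs)) (map ?F2 ws) (den (f1 c) \<mu>) = Some (den Q \<mu>)"
        unfolding run_max_Some using b' Q(2) False red_block.hyps(4) by (intro exI[of _ b]) simp
      have "gstep run_max (abs_state f1 \<mu> \<Phi>1) (conc \<theta> (Block c Xs ws)) (abs_state f' \<mu> \<Phi>2)"
        unfolding gstep_def abs_state_def B fst_conv snd_conv block.sel
      proof (intro conjI exI[of _ "den Q \<mu>"])
        show "(\<lambda>c. den (f' c) \<mu>) = (\<lambda>c. den (f1 c) \<mu>)(c := den Q \<mu>)" by (auto simp: Q(1))
        show "set (map (\<lambda>X. the (\<theta> X)) Xs) \<subseteq> terms Sig (dom ?F1)" by (rule X')
        show "set ws \<inter> dom ?F1 = {}" using o(1) by simp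
        show "dom ?F2 = dom ?F1 \<union> set ws" using o(3) by simp
      qed (rule o(2) le run)+
      with r have "grun run_max s0 (map (conc \<theta>) tr @ [conc \<theta> (Block c Xs ws)]) (abs_state f' \<mu> \<Phi>2)"
        unfolding grun_snoc by blast
      then show ?thesis by simp
    qed
  qed
  then show ?case using f' by (intro exI[of _ f']) simp
qed

lemma lift_block:
  assumes inf: "infinite (UNIV :: 'x set)"
    and red: "reduced (\<P>0, \<Phi>0, {}) tr (\<P>1, \<Phi>1, S1)" and f1: "procs_rep \<P>1 f1" "sym_inv D0 tr f1 \<Phi>1 S1"
    and s: "sat_sol \<theta> \<mu> \<Phi>1 S1" "dom \<mu> = ded_vars S1"
    and Xs: "Xs \<noteq> []" "distinct Xs" "set Xs \<inter> set (concat (map inputs tr)) = {}"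
      "\<forall>X \<in> set Xs. the (\<theta> X) \<in> terms Sig (dom \<Phi>1)"
    and b: "beh_ins (den (f1 c) \<mu>) (map (\<lambda>X. recipe_val (val_frame (fsubst \<mu> \<Phi>1)) (the (\<theta> X))) Xs) = Some b"
      "if ws = [] then b = Stop else length ws = length (fst (beh_outs b))"
    and ws: "distinct ws" "set ws \<inter> dom \<Phi>1 = {}"
  shows "\<exists>\<P>' \<Phi>' S' \<mu>'. reduced (\<P>0, \<Phi>0, {}) (tr @ [Block c Xs ws]) (\<P>', \<Phi>', S') \<and>
    sat_sol \<theta> \<mu>' \<Phi>' S' \<and> dom \<mu>' = ded_vars S'"
proof -
  have bas: "basic_on c (f1 c)" using f1(1) by (simp add: procs_rep_def)
  have fv: "fv_proc (f1 c) \<subseteq> ded_vars S1" and w: "winv \<Phi>1 S1" using f1(2) by (simp_all add: sym_inv_def)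
  have Xf: "set Xs \<inter> snd ` ded_pairs S1 = {}" using Xs(3) by (simp only: sym_inv_vars[OF f1(2)])
  have l: "IPlus = IStar \<or> IPlus = IPlus \<and> Xs \<noteq> []" using Xs(1) by simp
  from lift_I[OF inf bas fv w s Xs(2) Xf Xs(4) b ws l] obtain R \<Phi>' S' \<mu>' where
    foc: "focused IPlus (f1 c, \<Phi>1, S1) (map (Inp c) Xs @ map (Outp c) ws) (R, \<Phi>', S')"
    and s': "sat_sol \<theta> \<mu>' \<Phi>' S'" "dom \<mu>' = ded_vars S'" by blast
  have "f1 c \<noteq> PNull" using b(1) Xs(1) by (cases Xs) auto
  then obtain \<R> where \<R>: "\<P>1 = {#f1 c#} + \<R>" using procs_rep_split[OF f1(1)] by blast
  define K' where "K' = (case R of None \<Rightarrow> ({#}, \<Phi>', S') | Some Q' \<Rightarrow> (single Q' + \<R>, \<Phi>', S'))"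
  have "comp_step (\<P>1, \<Phi>1, S1) (io (Block c Xs ws)) K'"
    unfolding comp_step_def K'_def \<R>
    by (rule exI[of _ "f1 c"], rule exI[of _ \<R>], rule exI[of _ \<Phi>1], rule exI[of _ S1], rule exI[of _ R],
        rule exI[of _ \<Phi>'], rule exI[of _ S']) (simp add: foc)
  then have comp: "compressed (\<P>1, \<Phi>1, S1) (io (Block c Xs ws)) K'" by (rule comp_step_compressed)
  obtain \<P>' where K': "K' = (\<P>', \<Phi>', S')" unfolding K'_def by (cases R) auto
  have "reduced (\<P>0, \<Phi>0, {}) (tr @ [Block c Xs ws]) (\<P>', \<Phi>', S' \<union> {Dep Xs (dep tr c)})"
    by (rule red_block[OF red comp[unfolded K'] Xs(1)])
  moreover have "sat_sol \<theta> \<mu>' \<Phi>' (S' \<union> {Dep Xs (dep tr c)})" using s'(1) by (simp add: sat_sol_def)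
  moreover have "dom \<mu>' = ded_vars (S' \<union> {Dep Xs (dep tr c)})" using s'(2) by simp
  ultimately show ?thesis by blast
qed

lemma lift_max:
  fixes tr :: "('c :: linorder, 's, 'w) block list"
  assumes inf: "infinite (UNIV :: 'x set)" and cl: "closed_rep (\<P>0, \<Phi>0) f0" "\<And>c. ready (f0 c)" "finite (dom \<Phi>0)"
  defines "s0 \<equiv> abs_state f0 Map.empty \<Phi>0"
  shows "grun run_max s0 (map (conc \<theta>) tr) s \<Longrightarrow> distinct (concat (map inputs tr)) \<Longrightarrow>
    \<exists>\<P>' \<Phi>' S' \<mu>. reduced (\<P>0, \<Phi>0, {}) tr (\<P>', \<Phi>', S') \<and> sat_sol \<theta> \<mu> \<Phi>' S' \<and> dom \<mu> = ded_vars S'"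
proof (induction tr arbitrary: s rule: rev_induct)
  case Nil
  show ?case
    by (intro exI[of _ \<P>0] exI[of _ \<Phi>0] exI[of _ "{}"] exI[of _ Map.empty])
       (simp add: red_refl sat_sol_def)
next
  case (snoc B tr)
  obtain c Xs ws where B: "B = Block c Xs ws" by (cases B)
  from snoc.prems(1) obtain s1 where s1: "grun run_max s0 (map (conc \<theta>) tr) s1" "gstep run_max s1 (conc \<theta> B) s"
    unfolding map_append list.map grun_snoc by blast
  have d: "distinct (concat (map inputs tr))" "distinct Xs" "set Xs \<inter> set (concat (map inputs tr)) = {}"
    using snoc.prems(2) by (auto simp: B)
  from snoc.IH[OF s1(1) d(1)] obtain \<P>1 \<Phi>1 S1 \<mu> where
    red: "reduced (\<P>0, \<Phi>0, {}) tr (\<P>1, \<Phi>1, S1)" and sat: "sat_sol \<theta> \<mu> \<Phi>1 S1" "dom \<mu> = ded_vars S1" by blast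
  from reduced_proj[OF red cl] obtain f1 where f1: "procs_rep \<P>1 f1" "sym_inv (dom \<Phi>0) tr f1 \<Phi>1 S1"
    and p: "grun run_max s0 (map (conc \<theta>) tr) (abs_state f1 \<mu> \<Phi>1) \<or>
       f1 = (\<lambda>_. PNull) \<and> improper_run s0 (map (conc \<theta>) tr) (val_frame (fsubst \<mu> \<Phi>1))"
    using sat(1) unfolding s0_def by blast
  have "grun run_max s0 (map (conc \<theta>) tr) (abs_state f1 \<mu> \<Phi>1)" using p improper_run_not_max s1(1) by blast
  \<comment> \<open>The symbolic execution built so far projects to a run of the same blocks, which
    by determinism ends in \<open>s1\<close>.\<close>
  then have s1': "s1 = abs_state f1 \<mu> \<Phi>1" by (rule grun_deterministic[OF deterministic_run_max s1(1)])
  have g: "set (map (\<lambda>X. the (\<theta> X)) Xs) \<subseteq> terms Sig (dom \<Phi>1)" "distinct ws" "set ws \<inter> dom \<Phi>1 = {}"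
    "\<exists>b. run_max (map (recipe_val (val_frame (fsubst \<mu> \<Phi>1))) (map (\<lambda>X. the (\<theta> X)) Xs)) (map (snd s) ws) (den (f1 c) \<mu>) = Some b"
    using s1(2) unfolding s1' gstep_def abs_state_def B conc_def block.sel fst_conv snd_conv
    by (simp_all only: dom_val_frame dom_fsubst) blast
  from g(4) obtain b where b: "beh_ins (den (f1 c) \<mu>) (map (recipe_val (val_frame (fsubst \<mu> \<Phi>1))) (map (\<lambda>X. the (\<theta> X)) Xs)) = Some b"
    "Xs \<noteq> []" "ws \<noteq> []" "map (snd s) ws = map Some (fst (beh_outs b))"
    unfolding run_max_Some by auto
  have len: "length ws = length (fst (beh_outs b))" using arg_cong[OF b(4), of length] by simp
  show ?case unfolding B
    by (rule lift_block[OF inf red f1 sat b(2) d(2,3) _ _ _ g(2,3), where b = b])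
       (use g(1) b(1,3) len in \<open>auto simp: o_def\<close>)
qed

lemma lift_frun:
  fixes tr :: "('c :: linorder, 's, 'w) block list"
  assumes inf: "infinite (UNIV :: 'x set)" and cl: "closed_rep (\<P>0, \<Phi>0) f0" "\<And>c. ready (f0 c)" "finite (dom \<Phi>0)"
    and fr: "frun (abs_state f0 Map.empty \<Phi>0) (map (conc \<theta>) tr) F" and dis: "distinct (concat (map inputs tr))"
  shows "\<exists>\<P>' \<Phi>' S' \<mu>. reduced (\<P>0, \<Phi>0, {}) tr (\<P>', \<Phi>', S') \<and> sat_sol \<theta> \<mu> \<Phi>' S' \<and> dom \<mu> = ded_vars S'"
  using fr unfolding frun_iff
proof
  assume "\<exists>\<beta>. grun run_max (abs_state f0 Map.empty \<Phi>0) (map (conc \<theta>) tr) (\<beta>, F)"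
  then show ?thesis using lift_max[OF inf cl _ dis] by blast
next
  let ?s0 = "abs_state f0 Map.empty \<Phi>0"
  assume "improper_run ?s0 (map (conc \<theta>) tr) F"
  then obtain bl' c Ms \<beta> where bl: "map (conc \<theta>) tr = bl' @ [Block c Ms []]" and Ms: "Ms \<noteq> []"
    "set Ms \<subseteq> terms Sig (dom F)" and r: "grun run_max ?s0 bl' (\<beta>, F)"
    and i: "beh_ins (\<beta> c) (map (recipe_val F) Ms) = Some Stop"
    unfolding improper_run_def by blast
  from bl obtain tr1 B where tr: "tr = tr1 @ [B]" "bl' = map (conc \<theta>) tr1" "conc \<theta> B = Block c Ms []"
    by (auto simp: map_eq_append_conv)
  obtain Xs where B: "B = Block c Xs []" "Ms = map (\<lambda>X. the (\<theta> X)) Xs"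
    using tr(3) by (cases B) (auto simp: conc_def)
  have d: "distinct (concat (map inputs tr1))" "distinct Xs" "set Xs \<inter> set (concat (map inputs tr1)) = {}"
    using dis by (auto simp: tr B)
  from lift_max[OF inf cl r[unfolded tr(2)] d(1)] obtain \<P>1 \<Phi>1 S1 \<mu> where
    red: "reduced (\<P>0, \<Phi>0, {}) tr1 (\<P>1, \<Phi>1, S1)" and sat: "sat_sol \<theta> \<mu> \<Phi>1 S1" "dom \<mu> = ded_vars S1" by blast
  from reduced_proj[OF red cl] obtain f1 where f1: "procs_rep \<P>1 f1" "sym_inv (dom \<Phi>0) tr1 f1 \<Phi>1 S1"
    and p: "grun run_max ?s0 (map (conc \<theta>) tr1) (abs_state f1 \<mu> \<Phi>1) \<or>
       f1 = (\<lambda>_. PNull) \<and> improper_run ?s0 (map (conc \<theta>) tr1) (val_frame (fsubst \<mu> \<Phi>1))"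
    using sat(1) by blast
  have "grun run_max ?s0 (map (conc \<theta>) tr1) (abs_state f1 \<mu> \<Phi>1)"
    using p improper_run_not_max r[unfolded tr(2)] by blast
  then have "(\<beta>, F) = abs_state f1 \<mu> \<Phi>1"
    by (rule grun_deterministic[OF deterministic_run_max r[unfolded tr(2)]])
  then have F: "\<beta> = (\<lambda>c. den (f1 c) \<mu>)" "F = val_frame (fsubst \<mu> \<Phi>1)" by (simp_all add: abs_state_def)
  show ?thesis unfolding tr B
    by (rule lift_block[OF inf red f1 sat _ d(2,3), where b = Stop])
       (use Ms i in \<open>auto simp: B(2) F o_def\<close>)
qed

section \<open>Solutions of the constraint systems of reduced executions\<close>

lemma strip_facts:
  assumes "sym_inv D0 tr f \<Phi> S"
  shows "constraint_system (strip (\<Phi>, S))" "fv1 (strip (\<Phi>, S)) = ded_vars S"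
    "fv2 (strip (\<Phi>, S)) = snd ` ded_pairs S"
    "(D, X) \<in> ded_pairs S \<Longrightarrow> handles_of (strip (\<Phi>, S)) X = D"
    "first_order_part (strip (\<Phi>, S)) \<theta> \<mu> \<longleftrightarrow> dom \<mu> = ded_vars S \<and> ran \<mu> \<subseteq> ground_messages \<and> (\<forall>k \<in> S. sat \<Phi> \<theta> \<mu> k)"
proof -
  let ?T = "{k \<in> S. \<not> is_Dep k}"
  have st: "strip (\<Phi>, S) = (\<Phi>, ?T)" by (simp add: strip_def)
  have w: "winv \<Phi> S" using assms by (simp add: sym_inv_def)
  note W = winvD[OF w]
  have T: "Ded D X x \<in> ?T \<longleftrightarrow> Ded D X x \<in> S" for D X x by simp
  then have eq: "ded_vars ?T = ded_vars S" "ded_pairs ?T = ded_pairs S" "ded_rel \<Phi> ?T = ded_rel \<Phi> S"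
    by (simp_all add: ded_vars_def ded_pairs_def ded_rel_def)
  have wT: "winv \<Phi> ?T"
  proof -
    have k: "\<forall>k \<in> ?T. fv1_constr k \<subseteq> ded_vars S \<and> fv2_constr k \<subseteq> snd ` ded_pairs S \<and>
        (is_Dep k \<or> ordinary_constr k)"
    proof
      fix k assume "k \<in> ?T"
      then have "k \<in> S" by simp
      then show "fv1_constr k \<subseteq> ded_vars S \<and> fv2_constr k \<subseteq> snd ` ded_pairs S \<and>
        (is_Dep k \<or> ordinary_constr k)"
        using W(5)[of k] W(6)[of k] W(7)[of k] by simp
    qed
    have "finite ?T" using W(2) by simp
    with k w show ?thesis unfolding winv_def eq T by (elim conjE, intro conjI) assumption+
  qed
  show 1: "fv1 (strip (\<Phi>, S)) = ded_vars S" "fv2 (strip (\<Phi>, S)) = snd ` ded_pairs S"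
    using winv_fv1[OF wT] winv_fv2[OF wT] by (simp_all add: st eq)
  have "well_formed (\<Phi>, ?T)"
    unfolding well_formed_def
  proof (intro conjI ballI)
    fix x assume "x \<in> fv1 (\<Phi>, ?T)"
    then have "x \<in> ded_vars S" using 1(1) by (simp add: st)
    then obtain D X where DX: "Ded D X x \<in> S" by (auto simp: ded_vars_def)
    show "\<exists>!k. k \<in> snd (\<Phi>, ?T) \<and> (\<exists>D X. k = Ded D X x)"
    proof (rule ex1I[of _ "Ded D X x"])
      show "k = Ded D X x" if "k \<in> snd (\<Phi>, ?T) \<and> (\<exists>D X. k = Ded D X x)" for k
        using that W(8)[OF DX] by auto
    qed (use DX in auto)
  next
    fix X assume "X \<in> fv2 (\<Phi>, ?T)"
    then have "X \<in> snd ` ded_pairs S" using 1(2) by (simp add: st)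
    then obtain D x where DX: "Ded D X x \<in> S" by (auto simp: ded_pairs_def)
    show "\<exists>!k. k \<in> snd (\<Phi>, ?T) \<and> (\<exists>D x. k = Ded D X x)"
    proof (rule ex1I[of _ "Ded D X x"])
      show "k = Ded D X x" if "k \<in> snd (\<Phi>, ?T) \<and> (\<exists>D x. k = Ded D X x)" for k
        using that W(9)[OF DX] by auto
    qed (use DX in auto)
  next
    show "acyclic {(x, y). \<exists>D X. Ded D X x \<in> snd (\<Phi>, ?T) \<and>
        (\<exists>w \<in> D. \<exists>u. fst (\<Phi>, ?T) w = Some u \<and> y \<in> fv u)}"
      using W(11) by (simp add: ded_rel_def)
  qed
  then show "constraint_system (strip (\<Phi>, S))"
    unfolding constraint_system_def st using W(1,3,7) by auto
  show "handles_of (strip (\<Phi>, S)) X = D" if DX: "(D, X) \<in> ded_pairs S"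
  proof -
    obtain x where x: "Ded D X x \<in> S" using DX by (auto simp: ded_pairs_def)
    show ?thesis unfolding handles_of_def st
    proof (rule the_equality)
      show "\<exists>x. Ded D X x \<in> snd (\<Phi>, ?T)" using x by auto
      fix D' assume "\<exists>x. Ded D' X x \<in> snd (\<Phi>, ?T)"
      then obtain x' where x': "Ded D' X x' \<in> S" by auto
      from W(9)[OF x x'] show "D' = D" by simp
    qed
  qed
  have "(\<forall>k \<in> ?T. sat \<Phi> \<theta> \<mu> k) \<longleftrightarrow> (\<forall>k \<in> S. sat \<Phi> \<theta> \<mu> k)"
  proof -
    have "sat \<Phi> \<theta> \<mu> k" if "is_Dep k" for k using that by (cases k) auto
    then show ?thesis by blast
  qed
  then show "first_order_part (strip (\<Phi>, S)) \<theta> \<mu> \<longleftrightarrow>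
      dom \<mu> = ded_vars S \<and> ran \<mu> \<subseteq> ground_messages \<and> (\<forall>k \<in> S. sat \<Phi> \<theta> \<mu> k)"
    using 1(1) unfolding first_order_part_def by (simp add: st)
qed

text \<open>By \<open>sym_inv\<close>, the handles of an input variable are those known before its
  block, which is the range of recipes in \<open>depok\<close>.\<close>

lemma Sol1_dep_iff:
  fixes S :: "('f, 'n, 'x, 'w, 's) constr set"
  assumes inv: "sym_inv D0 tr f \<Phi> S" and G: "ran G \<subseteq> messages" "dom G = dom \<Phi>"
    and \<theta>: "\<forall>(D, X) \<in> ded_pairs S. the (\<theta> X) \<in> terms Sig D"
  shows "(\<forall>Xs ws. Dep Xs ws \<in> S \<and> ws \<noteq> {} \<longrightarrow> (\<exists>X \<in> set Xs. \<forall>M \<in> terms Sig (handles_of (strip (\<Phi>, S)) X).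
      recipe_msg G M =\<^sub>E recipe_msg G (the (\<theta> X)) \<longrightarrow> atoms M \<inter> ws \<noteq> {})) \<longleftrightarrow>
    depok D0 (val_frame G) (map (conc \<theta>) tr)"
proof -
  define \<phi> where "\<phi> Xs ws \<longleftrightarrow> (ws \<noteq> {} \<longrightarrow> (\<exists>X \<in> set Xs. \<forall>M \<in> terms Sig (handles_of (strip (\<Phi>, S)) X).
      recipe_msg G M =\<^sub>E recipe_msg G (the (\<theta> X)) \<longrightarrow> atoms M \<inter> ws \<noteq> {}))" for Xs and ws :: "'w set"
  have "(\<forall>Xs ws. Dep Xs ws \<in> S \<longrightarrow> \<phi> Xs ws) \<longleftrightarrow> (\<forall>(Xs, ws) \<in> dep_pairs S. \<phi> Xs ws)"
    by (simp add: dep_pairs_def)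
  also have "\<dots> \<longleftrightarrow> (\<forall>(p, B) \<in> blocks_at tr. \<phi> (inputs B) (dep p (chan B)))"
    using inv unfolding sym_inv_def by (auto simp: case_prod_unfold)
  also have "\<dots> \<longleftrightarrow> (\<forall>(p, B) \<in> blocks_at tr. dep p (chan B) \<noteq> {} \<longrightarrow>
     (\<exists>N \<in> set (inputs (conc \<theta> B)). \<forall>M \<in> terms Sig (D0 \<union> bouts p).
        recipe_val (val_frame G) M = recipe_val (val_frame G) N \<longrightarrow> atoms M \<inter> dep p (chan B) \<noteq> {}))"
  proof (rule ball_cong[OF refl], clarify)
    fix p B assume pB: "(p, B) \<in> blocks_at tr"
    have pairs: "(D0 \<union> bouts p, X) \<in> ded_pairs S" if "X \<in> set (inputs B)" for X
    proof -
      have "ded_pairs S = (\<Union>(p, B) \<in> blocks_at tr. {D0 \<union> bouts p} \<times> set (inputs B))"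
        using inv by (simp only: sym_inv_def)
      then show ?thesis using pB that by auto
    qed
    have sub: "D0 \<union> bouts p \<subseteq> dom G"
      using pB inv G(2) by (auto simp: sym_inv_def blocks_at_def)
    have "(\<forall>M \<in> terms Sig (handles_of (strip (\<Phi>, S)) X).
        recipe_msg G M =\<^sub>E recipe_msg G (the (\<theta> X)) \<longrightarrow> atoms M \<inter> dep p (chan B) \<noteq> {}) \<longleftrightarrow>
      (\<forall>M \<in> terms Sig (D0 \<union> bouts p). recipe_val (val_frame G) M = recipe_val (val_frame G) (the (\<theta> X)) \<longrightarrow>
        atoms M \<inter> dep p (chan B) \<noteq> {})" if X: "X \<in> set (inputs B)" for X
      unfolding strip_facts(4)[OF inv pairs[OF X]]
    proof (rule ball_cong[OF refl])
      fix M assume "M \<in> terms Sig (D0 \<union> bouts p)"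
      then have M: "M \<in> terms Sig (dom G)" using sub by (rule terms_mono)
      have "the (\<theta> X) \<in> terms Sig (D0 \<union> bouts p)" using \<theta> pairs[OF X] by blast
      then have N: "the (\<theta> X) \<in> terms Sig (dom G)" using sub by (rule terms_mono)
      have "recipe_msg G M =\<^sub>E recipe_msg G (the (\<theta> X)) \<longleftrightarrow>
          recipe_val (val_frame G) M = recipe_val (val_frame G) (the (\<theta> X))"
        using recipe_val_val_frame[OF G(1) M] recipe_val_val_frame[OF G(1) N]
          canon_eq_iff[OF recipe_msg_messages[OF G(1) M] recipe_msg_messages[OF G(1) N]] by simp
      then show "(recipe_msg G M =\<^sub>E recipe_msg G (the (\<theta> X)) \<longrightarrow> atoms M \<inter> dep p (chan B) \<noteq> {}) \<longleftrightarrow>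
         (recipe_val (val_frame G) M = recipe_val (val_frame G) (the (\<theta> X)) \<longrightarrow> atoms M \<inter> dep p (chan B) \<noteq> {})"
        by (simp only:)
    qed
    then show "\<phi> (inputs B) (dep p (chan B)) \<longleftrightarrow> (dep p (chan B) \<noteq> {} \<longrightarrow>
     (\<exists>N \<in> set (inputs (conc \<theta> B)). \<forall>M \<in> terms Sig (D0 \<union> bouts p).
        recipe_val (val_frame G) M = recipe_val (val_frame G) N \<longrightarrow> atoms M \<inter> dep p (chan B) \<noteq> {}))"
      unfolding \<phi>_def by simp
  qed
  also have "\<dots> \<longleftrightarrow> depok D0 (val_frame G) (map (conc \<theta>) tr)"
    unfolding depok_blocks_at blocks_at_map by (simp add: case_prod_unfold)
  finally show ?thesis unfolding \<phi>_def by (simp add: imp_conjL)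
qed


lemma Sol1_D:
  assumes inv: "sym_inv D0 tr f \<Phi> S" and sol: "\<theta> \<in> Sol1 (\<Phi>, S)"
  defines "\<mu> \<equiv> lam (strip (\<Phi>, S)) \<theta>"
  shows "sat_sol \<theta> \<mu> \<Phi> S" "dom \<theta> = set (concat (map inputs tr))"
    "inst_frame (\<Phi>, S) \<theta> = fsubst \<mu> \<Phi>" "ran (fsubst \<mu> \<Phi>) \<subseteq> messages"
    "depok D0 (val_frame (fsubst \<mu> \<Phi>)) (map (conc \<theta>) tr)"
proof -
  note F = strip_facts[OF inv]
  have "\<theta> \<in> Sol (strip (\<Phi>, S))" and dep: "\<forall>Xs ws. Dep Xs ws \<in> snd (\<Phi>, S) \<and> ws \<noteq> {} \<longrightarrow>
     (\<exists>X \<in> set Xs. \<forall>M \<in> terms Sig (handles_of (strip (\<Phi>, S)) X).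
        recipe_msg (inst_frame (\<Phi>, S) \<theta>) M =\<^sub>E recipe_msg (inst_frame (\<Phi>, S) \<theta>) (the (\<theta> X)) \<longrightarrow>
        atoms M \<inter> ws \<noteq> {})"
    using sol unfolding Sol1_def by blast+
  then have d: "dom \<theta> = snd ` ded_pairs S"
    and t: "\<And>X. X \<in> snd ` ded_pairs S \<Longrightarrow> the (\<theta> X) \<in> terms Sig (handles_of (strip (\<Phi>, S)) X)"
    and ex: "\<exists>\<mu>. first_order_part (strip (\<Phi>, S)) \<theta> \<mu>"
    unfolding Sol_def F(3) by blast+
  from d show "dom \<theta> = set (concat (map inputs tr))" by (simp only: sym_inv_vars[OF inv])
  have "first_order_part (strip (\<Phi>, S)) \<theta> \<mu>" unfolding \<mu>_def lam_def by (rule someI_ex[OF ex])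
  then have \<mu>: "dom \<mu> = ded_vars S" "ran \<mu> \<subseteq> ground_messages" "\<forall>k \<in> S. sat \<Phi> \<theta> \<mu> k"
    unfolding F(5) by blast+
  have \<theta>: "\<forall>(D, X) \<in> ded_pairs S. the (\<theta> X) \<in> terms Sig D"
  proof clarify
    fix D X assume DX: "(D, X) \<in> ded_pairs S"
    then have "X \<in> snd ` ded_pairs S" by force
    from t[OF this] show "the (\<theta> X) \<in> terms Sig D" unfolding F(4)[OF DX] .
  qed
  show "sat_sol \<theta> \<mu> \<Phi> S" using \<mu> \<theta> by (simp add: sat_sol_def)
  show i: "inst_frame (\<Phi>, S) \<theta> = fsubst \<mu> \<Phi>" by (simp add: inst_frame_def \<mu>_def)
  have w: "winv \<Phi> S" using inv by (simp add: sym_inv_def)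
  have "ran (fsubst \<mu> \<Phi>) \<subseteq> ground_messages" by (rule ran_fsubst_ground[OF \<mu>(2) _ w]) (simp add: \<mu>(1))
  then show r: "ran (fsubst \<mu> \<Phi>) \<subseteq> messages" using ground_messages_subset by (rule order_trans)
  show "depok D0 (val_frame (fsubst \<mu> \<Phi>)) (map (conc \<theta>) tr)"
    using dep unfolding i snd_conv Sol1_dep_iff[OF inv r dom_fsubst \<theta>] .
qed

text \<open>The dependency premise ranges over all first-order solutions because \<open>lam\<close>
  may choose another one than \<mu>.\<close>

lemma Sol1_I:
  assumes inv: "sym_inv D0 tr f \<Phi> S" and sat: "sat_sol \<theta> \<mu> \<Phi> S" "dom \<mu> = ded_vars S"
    and dom: "dom \<theta> = set (concat (map inputs tr))"
    and dep: "\<And>\<nu>. sat_sol \<theta> \<nu> \<Phi> S \<Longrightarrow> depok D0 (val_frame (fsubst \<nu> \<Phi>)) (map (conc \<theta>) tr)"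
  shows "\<theta> \<in> Sol1 (\<Phi>, S)"
proof -
  note F = strip_facts[OF inv]
  have \<theta>: "\<forall>(D, X) \<in> ded_pairs S. the (\<theta> X) \<in> terms Sig D" using sat(1) by (simp add: sat_sol_def)
  have "the (\<theta> X) \<in> terms Sig (handles_of (strip (\<Phi>, S)) X)" if X: "X \<in> snd ` ded_pairs S" for X
  proof -
    obtain D where DX: "(D, X) \<in> ded_pairs S" using X by auto
    show ?thesis unfolding F(4)[OF DX] using \<theta> DX by blast
  qed
  moreover have fo: "first_order_part (strip (\<Phi>, S)) \<theta> \<mu>"
    unfolding F(5) using sat by (simp add: sat_sol_def)
  moreover have "dom \<theta> = snd ` ded_pairs S" using dom by (simp only: sym_inv_vars[OF inv])
  ultimately have Sol: "\<theta> \<in> Sol (strip (\<Phi>, S))"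
    unfolding Sol_def F(3) using F(1) by blast
  define \<nu> where "\<nu> = lam (strip (\<Phi>, S)) \<theta>"
  have "first_order_part (strip (\<Phi>, S)) \<theta> \<nu>" unfolding \<nu>_def lam_def by (rule someI_ex[OF exI[of "first_order_part (strip (\<Phi>, S)) \<theta>", OF fo]])
  then have \<nu>: "dom \<nu> = ded_vars S" "ran \<nu> \<subseteq> ground_messages" "\<forall>k \<in> S. sat \<Phi> \<theta> \<nu> k"
    unfolding F(5) by blast+
  then have s\<nu>: "sat_sol \<theta> \<nu> \<Phi> S" using \<theta> by (simp add: sat_sol_def)
  have i: "inst_frame (\<Phi>, S) \<theta> = fsubst \<nu> \<Phi>" by (simp add: inst_frame_def \<nu>_def)
  have w: "winv \<Phi> S" using inv by (simp add: sym_inv_def)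
  have "ran (fsubst \<nu> \<Phi>) \<subseteq> ground_messages" by (rule ran_fsubst_ground[OF \<nu>(2) _ w]) (simp add: \<nu>(1))
  then have r: "ran (fsubst \<nu> \<Phi>) \<subseteq> messages" using ground_messages_subset by (rule order_trans)
  have "\<forall>Xs ws. Dep Xs ws \<in> snd (\<Phi>, S) \<and> ws \<noteq> {} \<longrightarrow>
     (\<exists>X \<in> set Xs. \<forall>M \<in> terms Sig (handles_of (strip (\<Phi>, S)) X).
        recipe_msg (inst_frame (\<Phi>, S) \<theta>) M =\<^sub>E recipe_msg (inst_frame (\<Phi>, S) \<theta>) (the (\<theta> X)) \<longrightarrow>
        atoms M \<inter> ws \<noteq> {})"
    unfolding i snd_conv Sol1_dep_iff[OF inv r dom_fsubst \<theta>] by (rule dep[OF s\<nu>])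
  with Sol show ?thesis unfolding Sol1_def by blast
qed

section \<open>Reduced inclusion as inclusion of maximal runs\<close>

lemma reduced_frun:
  assumes "reduced (\<P>0, \<Phi>0, {}) tr (\<P>', \<Phi>', S')" "closed_rep (\<P>0, \<Phi>0) f0" "\<And>c. ready (f0 c)"
    "finite (dom \<Phi>0)"
  shows "\<exists>f'. sym_inv (dom \<Phi>0) tr f' \<Phi>' S' \<and> (\<forall>\<theta> \<mu>. sat_sol \<theta> \<mu> \<Phi>' S' \<longrightarrow>
    frun (abs_state f0 Map.empty \<Phi>0) (map (conc \<theta>) tr) (val_frame (fsubst \<mu> \<Phi>')))"
proof -
  from reduced_proj[OF assms] obtain f' where f': "sym_inv (dom \<Phi>0) tr f' \<Phi>' S'"
    and r: "\<And>\<theta> \<mu>. sat_sol \<theta> \<mu> \<Phi>' S' \<Longrightarrow>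
      grun run_max (abs_state f0 Map.empty \<Phi>0) (map (conc \<theta>) tr) (abs_state f' \<mu> \<Phi>') \<or>
      f' = (\<lambda>_. PNull) \<and>
      improper_run (abs_state f0 Map.empty \<Phi>0) (map (conc \<theta>) tr) (val_frame (fsubst \<mu> \<Phi>'))"
    by blast
  have "frun (abs_state f0 Map.empty \<Phi>0) (map (conc \<theta>) tr) (val_frame (fsubst \<mu> \<Phi>'))"
    if "sat_sol \<theta> \<mu> \<Phi>' S'" for \<theta> \<mu>
    using r[OF that] unfolding frun_iff abs_state_def by blast
  with f' show ?thesis by blast
qed

text \<open>Runs are deterministic, so every first-order solution yields the same frame of values
  \<open>F\<close>, in particular the one that \<open>lam\<close> chooses.\<close>

lemma Sol1_of_frun:
  fixes tr :: "('c :: linorder, 's, 'w) block list"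
  assumes inf: "infinite (UNIV :: 'x set)" and cl: "closed_rep (\<P>, \<Phi>) f" "\<And>c. ready (f c)" "finite (dom \<Phi>)"
    and fr: "frun (abs_state f Map.empty \<Phi>) (map (conc \<theta>) tr) F" and dis: "distinct (concat (map inputs tr))"
    and dok: "depok (dom \<Phi>) F (map (conc \<theta>) tr)" and dom: "dom \<theta> = set (concat (map inputs tr))"
  shows "\<exists>\<P>' \<Phi>' S'. reduced (\<P>, \<Phi>, {}) tr (\<P>', \<Phi>', S') \<and> \<theta> \<in> Sol1 (\<Phi>', S') \<and>
    val_frame (inst_frame (\<Phi>', S') \<theta>) = F \<and> ran (inst_frame (\<Phi>', S') \<theta>) \<subseteq> messages"
proof -
  from lift_frun[OF inf cl fr dis] obtain \<P>' \<Phi>' S' \<mu> where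
    red: "reduced (\<P>, \<Phi>, {}) tr (\<P>', \<Phi>', S')" and sat: "sat_sol \<theta> \<mu> \<Phi>' S'" "dom \<mu> = ded_vars S'" by blast
  from reduced_frun[OF red cl] obtain f' where inv: "sym_inv (dom \<Phi>) tr f' \<Phi>' S'"
    and r: "\<And>\<theta> \<mu>. sat_sol \<theta> \<mu> \<Phi>' S' \<Longrightarrow>
      frun (abs_state f Map.empty \<Phi>) (map (conc \<theta>) tr) (val_frame (fsubst \<mu> \<Phi>'))"
    by blast
  have F: "val_frame (fsubst \<nu> \<Phi>') = F" if "sat_sol \<theta> \<nu> \<Phi>' S'" for \<nu>
    using frun_deterministic[OF r[OF that] fr] .
  have sol: "\<theta> \<in> Sol1 (\<Phi>', S')" by (rule Sol1_I[OF inv sat dom]) (simp add: F dok)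
  note D = Sol1_D[OF inv sol]
  show ?thesis using red sol F[OF D(1)] D(4) unfolding D(3)[symmetric] by blast
qed

text \<open>A solution turns a symbolic trace into a run, which the other side follows and which is
  then lifted back. For the opposite direction the recipes of a run are first named by
  \<open>symbolic_blocks\<close>.\<close>

lemma reduced_incl1_iff:
  fixes \<Phi>A \<Phi>B :: "('f, 'n, 'x, 'w) frame" and f g :: "'c :: linorder \<Rightarrow> ('c, 'f, 'n, 'x) proc"
  assumes infx: "infinite (UNIV :: 'x set)" and infs: "infinite (UNIV :: 's set)"
    and A: "closed_rep (\<P>A, \<Phi>A) f" "\<And>c. ready (f c)" "finite (dom \<Phi>A)"
    and B: "closed_rep (\<P>B, \<Phi>B) g" "\<And>c. ready (g c)" "finite (dom \<Phi>B)"
  shows "reduced_incl1 TYPE('s) (\<P>A, \<Phi>A) (\<P>B, \<Phi>B) \<longleftrightarrow>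
    max_incl (abs_state f Map.empty \<Phi>A) (abs_state g Map.empty \<Phi>B)"
proof
  have domA: "dom (snd (abs_state f Map.empty \<Phi>A)) = dom \<Phi>A"
    and domB: "dom (snd (abs_state g Map.empty \<Phi>B)) = dom \<Phi>B" by (simp_all add: abs_state_def)
  {
    assume incl: "max_incl (abs_state f Map.empty \<Phi>A) (abs_state g Map.empty \<Phi>B)"
    show "reduced_incl1 TYPE('s) (\<P>A, \<Phi>A) (\<P>B, \<Phi>B)"
      unfolding reduced_incl1_def fst_conv snd_conv
    proof (intro allI impI, elim conjE)
      fix tr :: "('c, 's, 'w) block list" and \<P>' \<Phi>' S\<^sub>A \<theta>
      assume red: "reduced (\<P>A, \<Phi>A, {}) tr (\<P>', \<Phi>', S\<^sub>A)" and sol: "\<theta> \<in> Sol1 (\<Phi>', S\<^sub>A)"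
      from reduced_frun[OF red A] obtain f' where inv: "sym_inv (dom \<Phi>A) tr f' \<Phi>' S\<^sub>A"
        and r: "\<And>\<theta> \<mu>. sat_sol \<theta> \<mu> \<Phi>' S\<^sub>A \<Longrightarrow>
          frun (abs_state f Map.empty \<Phi>A) (map (conc \<theta>) tr) (val_frame (fsubst \<mu> \<Phi>'))"
        by blast
      note D = Sol1_D[OF inv sol]
      from incl r[OF D(1)] D(5) obtain F' where
        F': "frun (abs_state g Map.empty \<Phi>B) (map (conc \<theta>) tr) F'" "depok (dom \<Phi>B) F' (map (conc \<theta>) tr)"
        and eq: "aeq (val_frame (inst_frame (\<Phi>', S\<^sub>A) \<theta>)) F'"
        unfolding max_incl_def domA domB D(3) by blast
      have dis: "distinct (concat (map inputs tr))" using inv by (simp add: sym_inv_def)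
      from Sol1_of_frun[OF infx B F'(1) dis F'(2) D(2)] obtain \<Q>' \<Psi>' S\<^sub>B where
        red': "reduced (\<P>B, \<Phi>B, {}) tr (\<Q>', \<Psi>', S\<^sub>B)" "\<theta> \<in> Sol1 (\<Psi>', S\<^sub>B)"
        and v: "val_frame (inst_frame (\<Psi>', S\<^sub>B) \<theta>) = F'" "ran (inst_frame (\<Psi>', S\<^sub>B) \<theta>) \<subseteq> messages" by blast
      have "ran (inst_frame (\<Phi>', S\<^sub>A) \<theta>) \<subseteq> messages" using D(4) unfolding D(3) .
      then have "inst_frame (\<Phi>', S\<^sub>A) \<theta> \<sim> inst_frame (\<Psi>', S\<^sub>B) \<theta>"
        using static_eq_iff_aeq[OF _ v(2)] eq by (simp only: v(1))
      with red' show "\<exists>\<Q>' \<Psi>' S\<^sub>B. reduced (\<P>B, \<Phi>B, {}) tr (\<Q>', \<Psi>', S\<^sub>B) \<and> \<theta> \<in> Sol1 (\<Psi>', S\<^sub>B) \<and>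
           inst_frame (\<Phi>', S\<^sub>A) \<theta> \<sim> inst_frame (\<Psi>', S\<^sub>B) \<theta>" by blast
    qed
  next
    assume incl: "reduced_incl1 TYPE('s) (\<P>A, \<Phi>A) (\<P>B, \<Phi>B)"
    show "max_incl (abs_state f Map.empty \<Phi>A) (abs_state g Map.empty \<Phi>B)"
      unfolding max_incl_def domA domB
    proof (intro allI impI, elim conjE)
      fix bl :: "('c, ('f, 'w) recipe, 'w) block list" and F
      assume fr: "frun (abs_state f Map.empty \<Phi>A) bl F" and dok: "depok (dom \<Phi>A) F bl"
      obtain tr :: "('c, 's, 'w) block list" and \<theta> where tr: "map (conc \<theta>) tr = bl"
        "distinct (concat (map inputs tr))" "dom \<theta> = set (concat (map inputs tr))"
        using symbolic_blocks[OF infs, of bl] by blast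
      from Sol1_of_frun[OF infx A, of \<theta> tr F] fr dok tr obtain \<P>' \<Phi>' S\<^sub>A where
        "reduced (\<P>A, \<Phi>A, {}) tr (\<P>', \<Phi>', S\<^sub>A)" "\<theta> \<in> Sol1 (\<Phi>', S\<^sub>A)"
        and v: "val_frame (inst_frame (\<Phi>', S\<^sub>A) \<theta>) = F" "ran (inst_frame (\<Phi>', S\<^sub>A) \<theta>) \<subseteq> messages" by blast
      with incl obtain \<Q>' \<Psi>' S\<^sub>B where red: "reduced (\<P>B, \<Phi>B, {}) tr (\<Q>', \<Psi>', S\<^sub>B)"
        and sol: "\<theta> \<in> Sol1 (\<Psi>', S\<^sub>B)" and eq: "inst_frame (\<Phi>', S\<^sub>A) \<theta> \<sim> inst_frame (\<Psi>', S\<^sub>B) \<theta>"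
        unfolding reduced_incl1_def fst_conv snd_conv by blast
      from reduced_frun[OF red B] obtain g' where inv: "sym_inv (dom \<Phi>B) tr g' \<Psi>' S\<^sub>B"
        and r: "\<And>\<theta> \<mu>. sat_sol \<theta> \<mu> \<Psi>' S\<^sub>B \<Longrightarrow>
          frun (abs_state g Map.empty \<Phi>B) (map (conc \<theta>) tr) (val_frame (fsubst \<mu> \<Psi>'))"
        by blast
      note D = Sol1_D[OF inv sol]
      have "ran (inst_frame (\<Psi>', S\<^sub>B) \<theta>) \<subseteq> messages" using D(4) unfolding D(3) .
      then have "aeq F (val_frame (inst_frame (\<Psi>', S\<^sub>B) \<theta>))"
        using static_eq_iff_aeq[OF v(2)] eq by (simp only: v(1))
      then show "\<exists>F'. frun (abs_state g Map.empty \<Phi>B) bl F' \<and> depok (dom \<Phi>B) F' bl \<and> aeq F F'"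
        using r[OF D(1)] D(5) unfolding D(3) tr(1) by blast
    qed
  }
qed

text \<open>From traces to blocks both inclusions are used together, since the maximality of blocks
  on one side rests on the other side. From blocks to traces each inclusion is treated
  alone.\<close>

lemma trace_equiv_iff_reduced_equiv1:
  fixes A B :: "('c :: linorder, 'f, 'n, 'x, 'w :: infinite) eproc"
  assumes infx: "infinite (UNIV :: 'x set)" and infs: "infinite (UNIV :: 's set)"
    and "extended_simple A" "initial A" "extended_simple B" "initial B"
  shows "trace_equiv A B \<longleftrightarrow> reduced_equiv1 TYPE('s) A B"
proof -
  obtain \<P>A \<Phi>A \<P>B \<Phi>B where AB: "A = (\<P>A, \<Phi>A)" "B = (\<P>B, \<Phi>B)" by (cases A; cases B)
  obtain f where f: "closed_rep (\<P>A, \<Phi>A) f" "\<And>c. ready (f c)" "finite (dom \<Phi>A)"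
    "initial_state (abs_state f Map.empty \<Phi>A)"
    by (rule extended_simple_rep[OF assms(3,4)[unfolded AB]]) (rule that; assumption)
  obtain g where g: "closed_rep (\<P>B, \<Phi>B) g" "\<And>c. ready (g c)" "finite (dom \<Phi>B)"
    "initial_state (abs_state g Map.empty \<Phi>B)"
    by (rule extended_simple_rep[OF assms(5,6)[unfolded AB]]) (rule that; assumption)
  note tAB = trace_incl_iff[OF f(1) g(1)] and tBA = trace_incl_iff[OF g(1) f(1)]
  note rAB = reduced_incl1_iff[OF infx infs f(1-3) g(1-3)]
    and rBA = reduced_incl1_iff[OF infx infs g(1-3) f(1-3)]
  show ?thesis unfolding trace_equiv_def reduced_equiv1_def AB tAB tBA rAB rBA
    using max_incl_of_part_incl[OF f(4) g(4)] max_incl_of_part_incl[OF g(4) f(4)]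
      part_incl_of_max_incl[OF f(4)] part_incl_of_max_incl[OF g(4)] by blast
qed

end

theorem corollary3:
  fixes Sig :: "('f \<times> nat) set"
    and E :: "(('f, 'n, 'x :: infinite) msg \<times> ('f, 'n, 'x) msg) set"
    and A B :: "('c :: linorder, 'f, 'n, 'x, 'w :: infinite) eproc"
  assumes "equational_setting Sig E"
    and "equational_setting.extended_simple Sig A" and "initial A"
    and "equational_setting.extended_simple Sig B" and "initial B"
  shows "equational_setting.trace_equiv Sig E A B \<longleftrightarrow>
         equational_setting.reduced_equiv1 Sig E TYPE('s :: infinite) A B"
  by (rule equational_setting.trace_equiv_iff_reduced_equiv1[OF assms(1) infinite_UNIV infinite_UNIV assms(2-5)])

end
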